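(* Let $\lambda$ be a partition. There is a nonempty Zariski open subset $U\subseteq\mathbb{C}^2$ such that for every $(q_0,t_0)\in U$, the specialization $P_\lambda(X;q=q_0,t=t_0)$ of the Macdonald polynomial is defined, has saturated Newton polytope, and satisfies $\mathsf{Newton}(P_\lambda(x_1,\ldots,x_n;q=q_0,t=t_0))=\mathcal{P}_\lambda\subset\mathbb{R}^n$ for every $n\geq\ell(\lambda)$.
   Context: $\mathsf{Sym}$ is the ring of symmetric functions in $X=(x_1,x_2,\ldots)$; $m_\lambda$ is the monomial symmetric function, $p_\lambda$ the power sum product. Dominance order: $\mu\leq_D\lambda$ if $|\mu|=|\lambda|$ and $\sum_{i\le k}\mu_i\leq\sum_{i\le k}\lambda_i$ for all $k$. Define an inner product on $\mathsf{Sym}\otimes\mathbb{Q}(q,t)$ by $\langle p_\lambda,p_\mu\rangle_{q,t}=\delta_{\lambda\mu}z_\lambda\prod_{i=1}^{\ell(\lambda)}\frac{1-q^{\lambda_i}}{1-t^{\lambda_i}}$, where $z_\lambda=\prod_{r\geq1}r^{m_r}m_r!$ for $\lambda=(1^{m_1}2^{m_2}\cdots)$. The Macdonald polynomials $P_\lambda(X;q,t)$ are the unique elements of the form $P_\lambda=m_\lambda+\sum_{\mu<_D\lambda}\mathsf{c}_{\lambda,\mu}(q,t)m_\mu$ with $\mathsf{c}_{\lambda,\mu}(q,t)\in\mathbb{Q}(q,t)$ such that $\langle P_\lambda,P_\mu\rangle_{q,t}=0$ for $\lambda\neq\mu$. $\ell(\lambda)$ is the number of nonzero parts of $\lambda$;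 $\mathcal{P}_\lambda\subset\mathbb{R}^n$ is the convex hull of all rearrangements of $\lambda$ (padded with zeros to length $n$). The Newton polytope of $g=\sum c_\alpha x^\alpha$ is $\mathrm{conv}\{\alpha:c_\alpha\neq0\}$; $g$ has saturated Newton polytope (SNP) if every lattice point in it is an exponent vector with nonzero coefficient; an element of $\mathsf{Sym}$ is SNP if all its specializations $x_i=0$ for $i>m$ are SNP, $m\geq1$. *)

theory Defs
  imports
    "HOL-Analysis.Analysis"
    "HOL-Analysis.Finite_Function_Topology"
    "HOL-Computational_Algebra.Polynomial"
    "HOL-Computational_Algebra.Fraction_Field"
    "HOL-Combinatorics.Permutations"
begin

section \<open>Exponent vectors and partitions\<close>

text \<open>Variables are indexed from 0.  An exponent vector is a finitely supported function
  on the variables; a partition is a weakly decreasing exponent vector, so that trailing zeros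
  never have to be added or removed.\<close>

type_synonym expo = "nat \<Rightarrow>\<^sub>0 nat"

definition is_partition :: "expo \<Rightarrow> bool" where
  "is_partition lam \<longleftrightarrow> antimono (Poly_Mapping.lookup lam)"

definition psize :: "expo \<Rightarrow> nat" where
  "psize lam = (\<Sum>i\<in>Poly_Mapping.keys lam. Poly_Mapping.lookup lam i)"

definition plength :: "expo \<Rightarrow> nat" where
  "plength lam = card (Poly_Mapping.keys lam)"

definition dominated :: "expo \<Rightarrow> expo \<Rightarrow> bool" (infix "\<preceq>D" 50) where
  "mu \<preceq>D lam \<longleftrightarrow> psize mu = psize lam \<and>
     (\<forall>k. (\<Sum>i<k. Poly_Mapping.lookup mu i) \<le> (\<Sum>i<k. Poly_Mapping.lookup lam i))"

definition strictly_dominated :: "expo \<Rightarrow> expo \<Rightarrow> bool" (infix "\<prec>D" 50) where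
  "mu \<prec>D lam \<longleftrightarrow> mu \<preceq>D lam \<and> mu \<noteq> lam"

text \<open>The range of a finitely supported function does not contain 0; values \<open>r\<close> that are
  not parts contribute a factor 1.\<close>

definition zee :: "expo \<Rightarrow> nat" where
  "zee lam = (\<Prod>r\<in>Poly_Mapping.range lam.
     let m = card {i. Poly_Mapping.lookup lam i = r} in r ^ m * fact m)"


section \<open>Symmetric functions\<close>

text \<open>A formal power series in the variables \<open>x\<^sub>0, x\<^sub>1, \<dots>\<close>, such as a symmetric function, is
  given by its coefficient function.\<close>

type_synonym 'a series = "expo \<Rightarrow> 'a"

definition series_one :: "'a::comm_ring_1 series" where
  "series_one \<alpha> = (if \<alpha> = 0 then 1 else 0)"

definition series_mult :: "'a::comm_ring_1 series \<Rightarrow> 'a series \<Rightarrow> 'a series" where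
  "series_mult f g \<alpha> = (\<Sum>(\<beta>, \<gamma>)\<in>{(\<beta>, \<gamma>). \<beta> + \<gamma> = \<alpha>}. f \<beta> * g \<gamma>)"

definition rearrangement :: "expo \<Rightarrow> expo \<Rightarrow> bool" where
  "rearrangement lam \<alpha> \<longleftrightarrow>
     (\<exists>\<pi>. bij \<pi> \<and> (\<forall>i. Poly_Mapping.lookup \<alpha> i = Poly_Mapping.lookup lam (\<pi> i)))"

definition monomial_sym :: "expo \<Rightarrow> 'a::comm_ring_1 series" where
  "monomial_sym lam \<alpha> = (if rearrangement lam \<alpha> then 1 else 0)"

definition power_sum :: "nat \<Rightarrow> 'a::comm_ring_1 series" where
  "power_sum r \<alpha> = (if \<exists>i. \<alpha> = Poly_Mapping.single i r then 1 else 0)"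

definition power_sum_product :: "expo \<Rightarrow> 'a::comm_ring_1 series" where
  "power_sum_product lam =
     foldr series_mult
       (map (\<lambda>i. power_sum (Poly_Mapping.lookup lam i)) [0..<plength lam]) series_one"

text \<open>Well defined because the power sum products form a basis of the symmetric functions
  over a field of characteristic 0.\<close>

definition power_sum_expansion :: "'a::field_char_0 series \<Rightarrow> (expo \<Rightarrow>\<^sub>0 'a)" where
  "power_sum_expansion f = (THE c.
     (\<forall>lam\<in>Poly_Mapping.keys c. is_partition lam) \<and>
     (\<forall>\<alpha>. f \<alpha> = (\<Sum>lam\<in>Poly_Mapping.keys c.
              Poly_Mapping.lookup c lam * power_sum_product lam \<alpha>)))"


section \<open>Macdonald polynomials\<close>

text \<open>\<open>\<rat>(q,t)\<close> is the fraction field of \<open>\<rat>[q][t]\<close>: the inner polynomial variable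
  is \<open>q\<close>, the outer one is \<open>t\<close>.\<close>

type_synonym ratqt = "rat poly poly fract"

definition qvar :: ratqt where "qvar = Fract [:[:0, 1:]:] 1"
definition tvar :: ratqt where "tvar = Fract [:0, 1:] 1"

definition qt_pairing :: "expo \<Rightarrow> expo \<Rightarrow> ratqt" where
  "qt_pairing lam mu =
     (if lam = mu
      then of_nat (zee lam) *
        (\<Prod>i<plength lam. (1 - qvar ^ Poly_Mapping.lookup lam i) /
                           (1 - tvar ^ Poly_Mapping.lookup lam i))
      else 0)"

text \<open>Bilinear extension of the values on power sum products.\<close>

definition qt_inner :: "ratqt series \<Rightarrow> ratqt series \<Rightarrow> ratqt" where
  "qt_inner f g =
     (\<Sum>lam\<in>Poly_Mapping.keys (power_sum_expansion f).
      \<Sum>mu\<in>Poly_Mapping.keys (power_sum_expansion g).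
        Poly_Mapping.lookup (power_sum_expansion f) lam *
        Poly_Mapping.lookup (power_sum_expansion g) mu * qt_pairing lam mu)"

definition macdonald_family :: "(expo \<Rightarrow> ratqt series) \<Rightarrow> bool" where
  "macdonald_family P \<longleftrightarrow>
     (\<forall>lam. is_partition lam \<longrightarrow>
        (\<exists>c :: expo \<Rightarrow> ratqt. \<forall>\<alpha>. P lam \<alpha> = monomial_sym lam \<alpha> +
           (\<Sum>mu\<in>{mu. is_partition mu \<and> mu \<prec>D lam}. c mu * monomial_sym mu \<alpha>))) \<and>
     (\<forall>lam mu. is_partition lam \<longrightarrow> is_partition mu \<longrightarrow> lam \<noteq> mu \<longrightarrow>
        qt_inner (P lam) (P mu) = 0)"

text \<open>By Macdonald's theorem a family as above exists, and it is unique on partitions.\<close>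

definition macdonald_P :: "expo \<Rightarrow> ratqt series" where
  "macdonald_P lam = (THE f. \<exists>P. macdonald_family P \<and> P lam = f)"


section \<open>Specialization of the parameters\<close>

definition eval2 :: "'a::comm_ring_1 poly poly \<Rightarrow> 'a \<Rightarrow> 'a \<Rightarrow> 'a" where
  "eval2 f x y = poly (poly f [:y:]) x"

definition eval_qt :: "rat poly poly \<Rightarrow> complex \<Rightarrow> complex \<Rightarrow> complex" where
  "eval_qt f q0 t0 = eval2 (map_poly (map_poly of_rat) f) q0 t0"

definition regular_at :: "ratqt \<Rightarrow> complex \<Rightarrow> complex \<Rightarrow> bool" where
  "regular_at r q0 t0 \<longleftrightarrow> (\<exists>a b. r = Fract a b \<and> eval_qt b q0 t0 \<noteq> 0)"

definition ratqt_value :: "ratqt \<Rightarrow> complex \<Rightarrow> complex \<Rightarrow> complex" where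
  "ratqt_value r q0 t0 =
     (THE z. \<exists>a b. r = Fract a b \<and> eval_qt b q0 t0 \<noteq> 0 \<and> z = eval_qt a q0 t0 / eval_qt b q0 t0)"

definition specialization_defined :: "ratqt series \<Rightarrow> complex \<Rightarrow> complex \<Rightarrow> bool" where
  "specialization_defined f q0 t0 \<longleftrightarrow> (\<forall>\<alpha>. regular_at (f \<alpha>) q0 t0)"

definition specialize :: "ratqt series \<Rightarrow> complex \<Rightarrow> complex \<Rightarrow> complex series" where
  "specialize f q0 t0 \<alpha> = ratqt_value (f \<alpha>) q0 t0"

definition zariski_open :: "(complex \<times> complex) set \<Rightarrow> bool" where
  "zariski_open U \<longleftrightarrow>
     (\<exists>F :: complex poly poly set. U = {(x, y). \<exists>f\<in>F. eval2 f x y \<noteq> 0})"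


section \<open>Newton polytopes\<close>

text \<open>\<open>\<real>\<^sup>n\<close> is the subspace of those \<open>v :: nat \<Rightarrow>\<^sub>0 real\<close> with \<open>keys v \<subseteq> {..<n}\<close>; this allows
  \<open>n\<close> to be quantified over.\<close>

definition set_vars_zero :: "nat \<Rightarrow> 'a::zero series \<Rightarrow> 'a series" where
  "set_vars_zero n f \<alpha> = (if Poly_Mapping.keys \<alpha> \<subseteq> {..<n} then f \<alpha> else 0)"

definition expo_point :: "expo \<Rightarrow> (nat \<Rightarrow>\<^sub>0 real)" where
  "expo_point \<alpha> = Poly_Mapping.map real \<alpha>"

definition newton :: "'a::zero series \<Rightarrow> (nat \<Rightarrow>\<^sub>0 real) set" where
  "newton g = convex hull (expo_point ` {\<alpha>. g \<alpha> \<noteq> 0})"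

definition has_SNP :: "'a::zero series \<Rightarrow> bool" where
  "has_SNP g \<longleftrightarrow>
     (\<forall>v\<in>newton g. (\<forall>i. Poly_Mapping.lookup v i \<in> \<int>) \<longrightarrow> v \<in> expo_point ` {\<alpha>. g \<alpha> \<noteq> 0})"

definition symmetric_SNP :: "'a::zero series \<Rightarrow> bool" where
  "symmetric_SNP f \<longleftrightarrow> (\<forall>m\<ge>1. has_SNP (set_vars_zero m f))"

definition permutohedron :: "nat \<Rightarrow> expo \<Rightarrow> (nat \<Rightarrow>\<^sub>0 real) set" where
  "permutohedron n lam = convex hull
     {v. \<exists>\<pi>. \<pi> permutes {..<n} \<and>
          (\<forall>i. Poly_Mapping.lookup v i = real (Poly_Mapping.lookup lam (\<pi> i)))}"


section \<open>Well-definedness checks\<close>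

lemma keys_plus_expo:
  "Poly_Mapping.keys (\<beta> + \<gamma> :: expo) = Poly_Mapping.keys \<beta> \<union> Poly_Mapping.keys \<gamma>"
  by (auto simp: in_keys_iff lookup_add)

lemma finite_bounded_expos:
  assumes "finite A"
  shows "finite {\<beta> :: expo. Poly_Mapping.keys \<beta> \<subseteq> A \<and> (\<forall>i. Poly_Mapping.lookup \<beta> i \<le> d)}"
proof (rule finite_subset)
  let ?F = "{f :: nat \<Rightarrow> nat. \<forall>i. (i \<in> A \<longrightarrow> f i \<in> {..d}) \<and> (i \<notin> A \<longrightarrow> f i = 0)}"
  show "{\<beta> :: expo. Poly_Mapping.keys \<beta> \<subseteq> A \<and> (\<forall>i. Poly_Mapping.lookup \<beta> i \<le> d)}
      \<subseteq> Poly_Mapping.lookup -` ?F"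
    by (auto simp: in_keys_iff)
  have "finite ?F"
    using finite_set_of_finite_funs[OF assms, of "{..d}" 0] by simp
  then show "finite (Poly_Mapping.lookup -` ?F)"
    by (rule finite_vimageI) (simp add: inj_on_def)
qed

lemma lookup_le_psize: "Poly_Mapping.lookup \<alpha> i \<le> psize \<alpha>"
proof (cases "i \<in> Poly_Mapping.keys \<alpha>")
  case True
  then show ?thesis unfolding psize_def by (intro member_le_sum) auto
qed (simp add: in_keys_iff)

lemma finite_splittings: "finite {(\<beta>, \<gamma>). \<beta> + \<gamma> = (\<alpha> :: expo)}"
proof -
  let ?B = "{\<beta> :: expo. Poly_Mapping.keys \<beta> \<subseteq> Poly_Mapping.keys \<alpha> \<and>
               (\<forall>i. Poly_Mapping.lookup \<beta> i \<le> psize \<alpha>)}"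
  have "\<beta> \<in> ?B \<and> \<gamma> \<in> ?B" if "\<beta> + \<gamma> = \<alpha>" for \<beta> \<gamma> :: expo
  proof -
    have "Poly_Mapping.lookup \<beta> i + Poly_Mapping.lookup \<gamma> i \<le> psize \<alpha>" for i
      using that lookup_le_psize[of \<alpha> i] by (metis lookup_add)
    then have "Poly_Mapping.lookup \<beta> i \<le> psize \<alpha>" "Poly_Mapping.lookup \<gamma> i \<le> psize \<alpha>" for i
      by (meson add_leD1 add_leD2)+
    moreover have "Poly_Mapping.keys \<beta> \<subseteq> Poly_Mapping.keys \<alpha>"
      "Poly_Mapping.keys \<gamma> \<subseteq> Poly_Mapping.keys \<alpha>"
      using keys_plus_expo[of \<beta> \<gamma>] that by blast+
    ultimately show ?thesis by simp
  qed
  then have "{(\<beta>, \<gamma>). \<beta> + \<gamma> = \<alpha>} \<subseteq> ?B \<times> ?B" by blast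
  then show ?thesis
    by (rule finite_subset)
       (rule finite_cartesian_product[OF finite_bounded_expos[OF finite_keys]
          finite_bounded_expos[OF finite_keys]])
qed

lemma partition_keys:
  assumes "is_partition lam"
  shows "Poly_Mapping.keys lam = {..<plength lam}"
proof -
  have down: "j \<in> Poly_Mapping.keys lam" if "i \<in> Poly_Mapping.keys lam" "j \<le> i" for i j
    using that antimonoD[OF assms[unfolded is_partition_def], of j i] by (simp add: in_keys_iff)
  have "\<exists>n. Poly_Mapping.keys lam = {..<n}"
  proof (cases "Poly_Mapping.keys lam = {}")
    case True then show ?thesis by (intro exI[of _ 0]) simp
  next
    case False
    have "Poly_Mapping.keys lam = {..<Suc (Max (Poly_Mapping.keys lam))}"
      using down[OF Max_in[OF finite_keys False]] by (auto simp: less_Suc_eq_le)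
    then show ?thesis by blast
  qed
  then obtain n where "Poly_Mapping.keys lam = {..<n}" by blast
  then show ?thesis unfolding plength_def by (metis card_lessThan)
qed

lemma plength_le_psize: "plength lam \<le> psize lam"
proof -
  have "(\<Sum>i\<in>Poly_Mapping.keys lam. 1) \<le> psize lam"
    unfolding psize_def by (rule sum_mono) (simp add: in_keys_iff Suc_leI)
  then show ?thesis by (simp add: plength_def)
qed

lemma finite_strictly_dominated: "finite {mu. is_partition mu \<and> mu \<prec>D lam}"
proof (rule finite_subset)
  let ?d = "psize lam"
  show "{mu. is_partition mu \<and> mu \<prec>D lam} \<subseteq>
      {mu. Poly_Mapping.keys mu \<subseteq> {..<?d} \<and> (\<forall>i. Poly_Mapping.lookup mu i \<le> ?d)}"
  proof clarify
    fix mu assume mu: "is_partition mu" "mu \<prec>D lam"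
    then have "psize mu = ?d" by (simp add: strictly_dominated_def dominated_def)
    then show "Poly_Mapping.keys mu \<subseteq> {..<?d} \<and> (\<forall>i. Poly_Mapping.lookup mu i \<le> ?d)"
      using partition_keys[OF mu(1)] plength_le_psize[of mu] lookup_le_psize[of mu] by auto
  qed
qed (rule finite_bounded_expos, simp)

lemma map_poly_of_rat_mult:
  "map_poly (of_rat :: rat \<Rightarrow> complex) (a * b) = map_poly of_rat a * map_poly of_rat b"
  by (rule poly_eqI) (simp add: coeff_map_poly coeff_mult of_rat_sum of_rat_mult)

lemma map_poly_of_rat_sum:
  "map_poly (of_rat :: rat \<Rightarrow> complex) (sum f A) = (\<Sum>x\<in>A. map_poly of_rat (f x))"
  by (rule poly_eqI) (simp add: coeff_map_poly coeff_sum of_rat_sum)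

lemma eval_qt_mult: "eval_qt (a * b) q0 t0 = eval_qt a q0 t0 * eval_qt b q0 t0"
proof -
  have "map_poly (map_poly (of_rat :: rat \<Rightarrow> complex)) (a * b) =
      map_poly (map_poly of_rat) a * map_poly (map_poly of_rat) b"
    by (rule poly_eqI)
       (simp add: coeff_map_poly coeff_mult map_poly_of_rat_sum map_poly_of_rat_mult)
  then show ?thesis by (simp add: eval_qt_def eval2_def)
qed

lemma ratqt_value_Fract:
  assumes b: "eval_qt b q0 t0 \<noteq> 0"
  shows "ratqt_value (Fract a b) q0 t0 = eval_qt a q0 t0 / eval_qt b q0 t0"
  unfolding ratqt_value_def
proof (rule the_equality)
  show "\<exists>a' b'. Fract a b = Fract a' b' \<and> eval_qt b' q0 t0 \<noteq> 0 \<and>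
      eval_qt a q0 t0 / eval_qt b q0 t0 = eval_qt a' q0 t0 / eval_qt b' q0 t0"
    using b by blast
next
  fix z
  assume "\<exists>a' b'. Fract a b = Fract a' b' \<and> eval_qt b' q0 t0 \<noteq> 0 \<and>
      z = eval_qt a' q0 t0 / eval_qt b' q0 t0"
  then obtain a' b' where *: "Fract a b = Fract a' b'" "eval_qt b' q0 t0 \<noteq> 0"
    "z = eval_qt a' q0 t0 / eval_qt b' q0 t0" by blast
  have nz: "b \<noteq> 0" "b' \<noteq> 0" using b *(2) by (auto simp: eval_qt_def eval2_def)
  then have "a * b' = a' * b" using *(1) by (simp add: eq_fract)
  then have "eval_qt a q0 t0 * eval_qt b' q0 t0 = eval_qt a' q0 t0 * eval_qt b q0 t0"
    by (metis eval_qt_mult)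
  then show "z = eval_qt a q0 t0 / eval_qt b q0 t0"
    unfolding *(3) using b *(2) by (simp add: frac_eq_eq)
qed

end

theory Submission
  imports Defs
begin

text \<open>Model the ring of symmetric functions as polynomials in the power sums, and let \<open>g\<^sub>n\<close> be the
  element whose products \<open>g\<^sub>\<nu>\<close> are dual to the monomial functions \<open>m\<^sub>\<mu>\<close>. If \<open>B\<^sub>k\<close> are the components of
  the substitution \<open>p\<^sub>r \<mapsto> p\<^sub>r + (q\<^sup>r - 1) (z/t)\<^sup>r\<close>, the Macdonald operator is
  \<open>E = \<Sum>\<^sub>k t\<^sup>k B\<^sub>k\<^sup>* B\<^sub>k\<close>, so it is visibly self-adjoint. On products of \<open>g\<close>'s it acts by
  raising operators, with explicit coefficients; hence it is triangular for dominance, and its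
  eigenvalues are pairwise distinct. Its eigenvectors are the Macdonald polynomials.

  The eigenvector equation is a recursion for the coefficient of \<open>m\<^sub>\<mu>\<close> in \<open>P\<^sub>\<lambda>\<close>. Along the curve
  \<open>q = 1 - x\<^sup>2\<close>, \<open>t = 1/(1 - x)\<close> its leading terms for \<open>x \<rightarrow> 0\<close> are nonnegative, as for Jack
  polynomials, and positive for moves of a single box. Since dominance is generated by such moves,
  all coefficients with \<open>\<mu> \<le> \<lambda>\<close> are nonzero rational functions. Where none of their numerators and
  denominators vanishes, the support of \<open>P\<^sub>\<lambda>\<close> consists of all exponent vectors whose sorted version
  is dominated by \<open>\<lambda>\<close>, and by Rado's theorem these are the lattice points of the permutohedron.\<close>

text \<open>Why an operator: orthogonality alone gives the coefficients by a Gram-Schmidt process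
  that shows neither sign nor support, whereas a self-adjoint operator yields a linear recursion for
  <g_mu, P_lambda> through larger partitions. The duality behind it: pairing with g_n reads off z^n
  after p_r is replaced by p_r + z^r, that is, after one variable z is split off. Why this curve:
  with t = 1/(1 - x) the parameter 1 - 1/t of all matrices is x itself. At x = 0 the diagonal
  entries of \<open>Tcoef\<close> in one degree coincide and the off-diagonal ones vanish, so the
  recursion becomes 0/0 and only first-order terms count. The square in q = 1 - x^2 makes q-integers
  agree with integers up to order x^2, so q adds nothing at order x. This corresponds to Jack
  parameter 0, where P_lambda is known to become the elementary function of the conjugate partition,
  in which m_mu has a positive coefficient exactly for mu below lambda. Positivity of the limits,
  unlike mere nonvanishing, survives the sums in the recursion.\<close>

abbreviation lk :: "('a \<Rightarrow>\<^sub>0 'b::zero) \<Rightarrow> 'a \<Rightarrow> 'b" where "lk \<equiv> Poly_Mapping.lookup"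

section \<open>Partitions, rearrangements and dominance\<close>

definition psum :: "expo \<Rightarrow> nat \<Rightarrow> nat" where "psum \<alpha> k = (\<Sum>i<k. lk \<alpha> i)"

lemma psize_eq: "Poly_Mapping.keys \<alpha> \<subseteq> {..<N} \<Longrightarrow> psize \<alpha> = psum \<alpha> N"
  unfolding psize_def psum_def
  by (rule sum.mono_neutral_left) (auto simp: in_keys_iff)

lemma keys_bounded: "\<exists>N. Poly_Mapping.keys (\<alpha> :: nat \<Rightarrow>\<^sub>0 'a::zero) \<subseteq> {..<N}"
  using finite_nat_bounded[OF finite_keys] .

lemma psum_le_psize: "psum \<alpha> k \<le> psize \<alpha>"
proof -
  obtain N where "Poly_Mapping.keys \<alpha> \<subseteq> {..<N}" using keys_bounded by blast
  then have "Poly_Mapping.keys \<alpha> \<subseteq> {..<max k N}" by auto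
  then have "psize \<alpha> = psum \<alpha> (max k N)" by (rule psize_eq)
  also have "\<dots> \<ge> psum \<alpha> k" unfolding psum_def by (rule sum_mono2) auto
  finally show ?thesis .
qed

lemma rearrangement_refl: "rearrangement \<alpha> \<alpha>"
  unfolding rearrangement_def by (rule exI[of _ id]) simp

lemma rearrangement_sym: "rearrangement \<alpha> \<beta> \<Longrightarrow> rearrangement \<beta> \<alpha>"
  unfolding rearrangement_def
  by (metis bij_imp_bij_inv bij_inv_eq_iff)

lemma rearrangement_trans: "rearrangement \<alpha> \<beta> \<Longrightarrow> rearrangement \<beta> \<gamma> \<Longrightarrow> rearrangement \<alpha> \<gamma>"
  unfolding rearrangement_def by (metis bij_comp comp_apply)

lemma rearrangement_sum:
  assumes "rearrangement \<alpha> \<beta>" "f 0 = (0::'a::comm_monoid_add)"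
  shows "(\<Sum>i\<in>Poly_Mapping.keys \<beta>. f (lk \<beta> i)) = (\<Sum>i\<in>Poly_Mapping.keys \<alpha>. f (lk \<alpha> i))"
proof -
  obtain p where p: "bij p" "\<And>i. lk \<beta> i = lk \<alpha> (p i)"
    using assms(1) unfolding rearrangement_def by blast
  show ?thesis
    by (rule sum.reindex_bij_witness[of _ "inv p" p])
       (use p in \<open>auto simp: in_keys_iff bij_is_surj surj_f_inv_f bij_is_inj\<close>)
qed

lemma rearrangement_prod:
  assumes "rearrangement \<alpha> \<beta>"
  shows "(\<Prod>i\<in>Poly_Mapping.keys \<beta>. f (lk \<beta> i)) = (\<Prod>i\<in>Poly_Mapping.keys \<alpha>. (f (lk \<alpha> i) :: 'a::comm_monoid_mult))"
proof -
  obtain p where p: "bij p" "\<And>i. lk \<beta> i = lk \<alpha> (p i)"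
    using assms(1) unfolding rearrangement_def by blast
  show ?thesis
    by (rule prod.reindex_bij_witness[of _ "inv p" p])
       (use p in \<open>auto simp: in_keys_iff bij_is_surj surj_f_inv_f bij_is_inj\<close>)
qed

lemma rearrangement_psize: "rearrangement \<alpha> \<beta> \<Longrightarrow> psize \<beta> = psize \<alpha>"
  unfolding psize_def using rearrangement_sum[of \<alpha> \<beta> "\<lambda>x. x"] by simp

text \<open>The maximum of a set with n + 1 elements is at least n, so its value is at most
  \<open>f n\<close>; removing it leaves n elements.\<close>

lemma antimono_sum_le:
  fixes f :: "nat \<Rightarrow> nat"
  assumes "antimono f" "finite S"
  shows "sum f S \<le> (\<Sum>i<card S. f i)"
  using assms(2)
proof (induction "card S" arbitrary: S)
  case 0
  then show ?case by auto
next
  case (Suc n)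
  then have ne: "S \<noteq> {}" by auto
  define m where "m = Max S"
  have m: "m \<in> S" unfolding m_def using Suc ne by auto
  have "S \<subseteq> {..m}" unfolding m_def using Suc ne by auto
  then have "card S \<le> Suc m" by (metis card_atMost card_mono finite_atMost)
  then have "f m \<le> f n" using assms(1) Suc(2) by (auto simp: antimono_def)
  moreover have "sum f (S - {m}) \<le> (\<Sum>i<n. f i)"
    using Suc(1)[of "S - {m}"] Suc m by (metis card_Diff_singleton diff_Suc_1 finite_Diff)
  moreover have "sum f S = f m + sum f (S - {m})"
    using m Suc(3) by (simp add: sum.remove)
  ultimately show ?case using Suc(2) by (metis add.commute add_mono sum.lessThan_Suc)
qed

text \<open>Source of the uniqueness of the sorted form, of \<open>dominated_srt\<close> and of the
  inequalities for the permutohedron: the chosen positions come from distinct rows of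
  \<open>mu\<close>, and its first rows are the largest.\<close>

lemma rearrangement_sum_le:
  assumes "is_partition mu" "rearrangement mu \<alpha>" "finite S"
  shows "(\<Sum>i\<in>S. lk \<alpha> i) \<le> psum mu (card S)"
proof -
  obtain p where p: "bij p" "\<And>i. lk \<alpha> i = lk mu (p i)"
    using assms(2) unfolding rearrangement_def by blast
  have inj: "inj_on p S" using p(1) by (meson bij_is_inj inj_on_subset subset_UNIV)
  have "(\<Sum>i\<in>S. lk \<alpha> i) = sum (lk mu) (p ` S)"
    using inj by (simp add: sum.reindex p(2))
  also have "\<dots> \<le> psum mu (card (p ` S))"
    unfolding psum_def
    by (rule antimono_sum_le) (use assms in \<open>auto simp: is_partition_def\<close>)
  also have "card (p ` S) = card S" using inj by (rule card_image)
  finally show ?thesis .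
qed

lemma psum_eqI: "(\<And>k. psum \<alpha> k = psum \<beta> k) \<Longrightarrow> \<alpha> = \<beta>"
proof (rule poly_mapping_eqI)
  fix k assume *: "\<And>k. psum \<alpha> k = psum \<beta> k"
  show "lk \<alpha> k = lk \<beta> k"
    using *[of "Suc k"] *[of k] by (simp add: psum_def)
qed

lemma partition_rearrangement_unique:
  assumes "is_partition mu" "is_partition nu" "rearrangement mu nu"
  shows "mu = nu"
proof (rule psum_eqI)
  fix k
  show "psum mu k = psum nu k"
    using rearrangement_sum_le[OF assms(1,3), of "{..<k}"]
      rearrangement_sum_le[OF assms(2) rearrangement_sym[OF assms(3)], of "{..<k}"]
    by (simp add: psum_def)
qed

lemma lookup_nth_list: "lk (Poly_Mapping.nth xs) i = (if i < length xs then xs ! i else 0)"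
  by (simp add: nth_default_def)

lemma is_partition_nth:
  assumes "sorted (rev ys)"
  shows "is_partition (Poly_Mapping.nth ys)"
  unfolding is_partition_def
proof (rule antimonoI)
  fix i j :: nat assume ij: "i \<le> j"
  show "lk (Poly_Mapping.nth ys) j \<le> lk (Poly_Mapping.nth ys) i"
    using assms ij by (auto simp: lookup_nth_list sorted_rev_iff_nth_mono simp del: lookup_nth)
qed

lemma partition_rearrangement_exists: "\<exists>mu. is_partition mu \<and> rearrangement mu \<alpha>"
proof -
  obtain N where N: "Poly_Mapping.keys \<alpha> \<subseteq> {..<N}" using keys_bounded by blast
  define xs where "xs = map (lk \<alpha>) [0..<N]"
  define ys where "ys = rev (sort xs)"
  have "mset xs = mset ys" by (simp add: ys_def)
  then obtain p where p: "p permutes {..<length ys}" "permute_list p ys = xs"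
    by (rule mset_eq_permutation)
  have len: "length ys = N" by (simp add: ys_def xs_def)
  have "lk \<alpha> i = lk (Poly_Mapping.nth ys) (p i)" for i
  proof (cases "i < N")
    case True
    then have "p i < N" using permutes_in_image[OF p(1), of i] len by simp
    moreover have "xs ! i = ys ! p i"
      using p True len permute_list_nth[of p ys i] by simp
    ultimately show ?thesis using True len by (simp add: xs_def lookup_nth_list del: lookup_nth)
  next
    case False
    then have "p i = i" using p(1) len by (simp add: permutes_def)
    then show ?thesis using False N len by (auto simp: lookup_nth_list in_keys_iff simp del: lookup_nth)
  qed
  then have "rearrangement (Poly_Mapping.nth ys) \<alpha>"
    unfolding rearrangement_def using permutes_bij[OF p(1)] by blast
  moreover have "is_partition (Poly_Mapping.nth ys)"
    by (rule is_partition_nth) (simp add: ys_def)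
  ultimately show ?thesis by blast
qed

definition srt :: "expo \<Rightarrow> expo" where
  "srt \<alpha> = (SOME mu. is_partition mu \<and> rearrangement mu \<alpha>)"

lemma srt: "is_partition (srt \<alpha>)" "rearrangement (srt \<alpha>) \<alpha>"
  using someI_ex[OF partition_rearrangement_exists[of \<alpha>]] unfolding srt_def by auto

lemma srt_eqI: "is_partition mu \<Longrightarrow> rearrangement mu \<alpha> \<Longrightarrow> srt \<alpha> = mu"
  using srt partition_rearrangement_unique rearrangement_trans rearrangement_sym by metis

lemma srt_partition: "is_partition mu \<Longrightarrow> srt mu = mu"
  by (intro srt_eqI rearrangement_refl)

lemma rearrangement_iff_srt: "is_partition mu \<Longrightarrow> rearrangement mu \<alpha> \<longleftrightarrow> srt \<alpha> = mu"
  using srt srt_eqI by metis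

lemma psize_srt: "psize (srt \<alpha>) = psize \<alpha>"
  using rearrangement_psize srt(2) by metis

section \<open>The dominance order and its single-box moves\<close>

lemma dominated_psum: "mu \<preceq>D lam \<longleftrightarrow> psize mu = psize lam \<and> (\<forall>k. psum mu k \<le> psum lam k)"
  by (simp add: dominated_def psum_def)

lemma dominated_refl: "mu \<preceq>D mu" by (simp add: dominated_psum)

lemma dominated_trans: "mu \<preceq>D nu \<Longrightarrow> nu \<preceq>D lam \<Longrightarrow> mu \<preceq>D lam"
  by (auto simp: dominated_psum intro: order_trans)

lemma dominated_antisym: "mu \<preceq>D nu \<Longrightarrow> nu \<preceq>D mu \<Longrightarrow> mu = nu"
  by (auto simp: dominated_psum intro: psum_eqI order_antisym)

lemma dominated_srt: "\<alpha> \<preceq>D srt \<alpha>"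
  using rearrangement_sum_le[OF srt, of "{..<k}" for k]
  by (simp add: dominated_psum psize_srt) (simp add: psum_def)

lemma finite_dominated: "finite {mu. is_partition mu \<and> mu \<preceq>D lam}"
  by (rule finite_subset[of _ "insert lam {mu. is_partition mu \<and> mu \<prec>D lam}"])
     (use finite_strictly_dominated[of lam] in \<open>auto simp: strictly_dominated_def\<close>)

text \<open>A number that grows strictly along dominance of partitions and measures the inductions
  over that order. By \<open>row_stat_rowlist\<close> it is also, up to sign and a constant for each
  size, the first-order term of the eigenvalues at x = 0.\<close>

definition dom_rank :: "expo \<Rightarrow> nat" where
  "dom_rank mu = (\<Sum>k\<le>psize mu. psum mu k)"

lemma psum_eq_psize: "is_partition mu \<Longrightarrow> psize mu \<le> k \<Longrightarrow> psum mu k = psize mu"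
  using psize_eq[of mu k] partition_keys[of mu] plength_le_psize[of mu] by auto

lemma dom_rank_less:
  assumes "is_partition mu" "is_partition lam" "mu \<prec>D lam"
  shows "dom_rank mu < dom_rank lam"
proof -
  have D: "psize mu = psize lam" "\<And>k. psum mu k \<le> psum lam k" "mu \<noteq> lam"
    using assms by (auto simp: strictly_dominated_def dominated_psum)
  obtain k where k: "psum mu k \<noteq> psum lam k" using D(3) psum_eqI by blast
  then have "k \<le> psize mu"
    using psum_eq_psize[OF assms(1), of k] psum_eq_psize[OF assms(2), of k] D(1) by fastforce
  then show ?thesis unfolding dom_rank_def D(1)
    by (intro sum_strict_mono_ex1) (use D k in \<open>auto intro!: bexI[of _ k] simp: le_neq_implies_less\<close>)
qed

lemma dom_rank_le: "dom_rank mu \<le> Suc (psize mu) * psize mu"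
  unfolding dom_rank_def using sum_bounded_above[of "{..psize mu}" "psum mu" "psize mu"]
  by (simp add: psum_le_psize)

lemma sum_fun_upd2:
  fixes f :: "nat \<Rightarrow> nat"
  assumes "i < j" "0 < f j"
  shows "(\<Sum>l<k. (f(i := Suc (f i), j := f j - 1)) l) = (\<Sum>l<k. f l) + (if i < k \<and> k \<le> j then 1 else 0)"
proof (induction k)
  case (Suc k)
  show ?case
    unfolding sum.lessThan_Suc Suc using assms
    by (cases "k = i"; cases "k = j") auto
qed simp

text \<open>Row \<open>i\<close> is the first where the partitions differ, and \<open>j\<close> the
  first later row after which the partial sums agree again. In between \<open>lam\<close> is
  strictly ahead, so the partial sums raised by moving a box from \<open>j\<close> to
  \<open>i\<close> stay below those of \<open>lam\<close>.\<close>

lemma dominance_step: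
  assumes mu: "is_partition mu" and lam: "is_partition lam" and lt: "mu \<prec>D lam"
  obtains nu i j where "i < j" "0 < lk mu j" "is_partition nu" "nu \<preceq>D lam" "mu \<prec>D nu"
    "lk nu = (lk mu)(i := Suc (lk mu i), j := lk mu j - 1)"
proof -
  have D: "psize mu = psize lam" "\<And>k. psum mu k \<le> psum lam k" "mu \<noteq> lam"
    using lt by (auto simp: strictly_dominated_def dominated_psum)
  have S: "psum \<alpha> (Suc k) = psum \<alpha> k + lk \<alpha> k" for \<alpha> k by (simp add: psum_def)
  have mumono: "lk mu b \<le> lk mu a" if "a \<le> b" for a b
    using mu that by (auto simp: is_partition_def antimono_def)
  have lammono: "lk lam b \<le> lk lam a" if "a \<le> b" for a b
    using lam that by (auto simp: is_partition_def antimono_def)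
  define i where "i = (LEAST k. lk mu k \<noteq> lk lam k)"
  have "\<exists>k. lk mu k \<noteq> lk lam k" using D(3) by (metis poly_mapping_eqI)
  then have i: "lk mu i \<noteq> lk lam i" unfolding i_def by (rule LeastI_ex)
  have less_i: "lk mu k = lk lam k" if "k < i" for k
    using not_less_Least that unfolding i_def by blast
  have psi: "psum mu i = psum lam i" unfolding psum_def using less_i by simp
  have mui: "lk mu i < lk lam i" using D(2)[of "Suc i"] psi i by (simp add: S)
  define j where "j = (LEAST j. i < j \<and> psum mu (Suc j) = psum lam (Suc j))"
  have "\<exists>j. i < j \<and> psum mu (Suc j) = psum lam (Suc j)"
    by (rule exI[of _ "Suc i + psize mu"])
       (use psum_eq_psize[OF mu] psum_eq_psize[OF lam] D(1) in simp)
  then have j: "i < j" "psum mu (Suc j) = psum lam (Suc j)"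
    unfolding j_def using LeastI_ex by (metis (mono_tags, lifting))+
  have less_j: "psum mu (Suc k) \<noteq> psum lam (Suc k)" if "i < k" "k < j" for k
    using not_less_Least that unfolding j_def by blast
  have strict: "psum mu k < psum lam k" if "i < k" "k \<le> j" for k
  proof (cases "k = Suc i")
    case True
    then show ?thesis using psi mui by (simp add: S)
  next
    case False
    then obtain k' where "k = Suc k'" "i < k'" "k' < j" using \<open>i < k\<close> \<open>k \<le> j\<close> by (cases k) auto
    then show ?thesis using less_j[of k'] D(2)[of k] by simp
  qed
  \<comment> \<open>The partial sums differ before row \<open>j\<close> and agree after it, hence
    mu_j > lam_j >= lam_(j+1) >= mu_(j+1): row \<open>j\<close> can lose a box without breaking the
    order.\<close>
  have muj: "lk lam j < lk mu j" using strict[of j] j by (simp add: S)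
  have muj': "lk mu (Suc j) \<le> lk lam j"
    using D(2)[of "Suc (Suc j)"] j lammono[of j "Suc j"] by (simp add: S)
  define nu where "nu = Poly_Mapping.update i (Suc (lk mu i)) (Poly_Mapping.update j (lk mu j - 1) mu)"
  have nu: "lk nu = (lk mu)(i := Suc (lk mu i), j := lk mu j - 1)"
    using j(1) by (auto simp: nu_def lookup_update fun_eq_iff)
  have pnu: "psum nu k = psum mu k + (if i < k \<and> k \<le> j then 1 else 0)" for k
    unfolding psum_def nu using sum_fun_upd2[of i j "lk mu" k] j(1) muj by simp
  have "is_partition nu"
    unfolding is_partition_def
  proof (rule antimonoI)
    fix a b :: nat assume "a \<le> b"
    have step: "lk nu (Suc a) \<le> lk nu a" for a
    proof -
      \<comment> \<open>The row before \<open>i\<close> is common to both partitions, so it is at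
        least lam_i > mu_i.\<close>
      have 1: "Suc (lk mu i) \<le> lk mu a" if "Suc a = i"
        using mui lammono[of a i] less_i[of a] that by simp
      have 2: "lk mu (Suc j) \<le> lk mu j - 1" using muj' muj by simp
      show ?thesis unfolding nu using 1 2 mumono[of a "Suc a"] j(1) by auto
    qed
    show "lk nu b \<le> lk nu a" using \<open>a \<le> b\<close> step by (rule lift_Suc_antimono_le[rotated])
  qed
  moreover have psn: "psize nu = psize mu"
  proof -
    obtain N where N: "Poly_Mapping.keys nu \<subseteq> {..<N}" using keys_bounded by blast
    obtain M where M: "Poly_Mapping.keys mu \<subseteq> {..<M}" using keys_bounded by blast
    let ?K = "max (max N M) (Suc j)"
    have "psize nu = psum nu ?K" using N by (intro psize_eq) auto
    also have "\<dots> = psum mu ?K" by (simp add: pnu)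
    also have "\<dots> = psize mu" using M by (intro psize_eq[symmetric]) auto
    finally show ?thesis .
  qed
  moreover have "nu \<preceq>D lam"
    unfolding dominated_psum pnu using psn D strict by (auto simp: Suc_le_eq)
  moreover have "mu \<prec>D nu"
    unfolding strictly_dominated_def dominated_psum pnu using psn nu j(1)
    by (auto simp: fun_eq_iff split: if_splits)
  ultimately show thesis using that[of i j nu] j(1) muj nu by simp
qed

section \<open>Newton polytopes and Rado's theorem\<close>

lemma lookup_scaleR_pm [simp]: "lk (c *\<^sub>R (v :: 'a \<Rightarrow>\<^sub>0 real)) i = c * lk v i"
proof -
  have "finite {i. c *\<^sub>R lk v i \<noteq> 0}"
    by (rule finite_subset[OF _ finite_keys[of v]]) (auto simp: in_keys_iff)
  then show ?thesis by (simp add: scaleR_poly_mapping_def Abs_poly_mapping_inverse)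
qed

lemma lookup_map_key: "inj f \<Longrightarrow> lk (Poly_Mapping.map_key f p) i = lk p (f i)"
  by (simp add: Poly_Mapping.map_key.rep_eq)

lemma lookup_expo_point [simp]: "lk (expo_point \<alpha>) i = real (lk \<alpha> i)"
  by (simp add: expo_point_def Poly_Mapping.map.rep_eq when_def)

text \<open>The summand over the keys is written as a function of the entry that is empty at 0, the
  form that \<open>rearrangement_sum\<close> transports; the zeros are counted separately.\<close>

lemma mset_map_lookup:
  fixes \<alpha> :: expo
  assumes "Poly_Mapping.keys \<alpha> \<subseteq> {..<n}"
  shows "mset (map (lk \<alpha>) [0..<n]) =
    (\<Sum>i\<in>Poly_Mapping.keys \<alpha>. if lk \<alpha> i = 0 then {#} else {#lk \<alpha> i#}) +
    replicate_mset (n - card (Poly_Mapping.keys \<alpha>)) 0"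
proof -
  let ?K = "Poly_Mapping.keys \<alpha>"
  have "mset (map (lk \<alpha>) [0..<n]) = (\<Sum>i\<in>{..<n}. {#lk \<alpha> i#})"
    by (induction n) (simp_all add: lessThan_Suc)
  also have "\<dots> = (\<Sum>i\<in>?K. {#lk \<alpha> i#}) + (\<Sum>i\<in>{..<n} - ?K. {#lk \<alpha> i#})"
    using assms by (subst sum.subset_diff[of ?K]) (simp_all add: add.commute)
  also have "(\<Sum>i\<in>{..<n} - ?K. {#lk \<alpha> i#}) = (\<Sum>i\<in>{..<n} - ?K. {#0#})"
    by (rule sum.cong) (auto simp: in_keys_iff)
  also have "\<dots> = replicate_mset (n - card ?K) 0"
  proof -
    have "(\<Sum>i\<in>A. {#0::nat#}) = replicate_mset (card A) 0" if "finite A" for A :: "nat set"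
      using that by induction simp_all
    then have "(\<Sum>i\<in>{..<n} - ?K. {#0::nat#}) = replicate_mset (card ({..<n} - ?K)) 0" by blast
    then show ?thesis using assms by (simp add: card_Diff_subset)
  qed
  also have "(\<Sum>i\<in>?K. {#lk \<alpha> i#}) = (\<Sum>i\<in>?K. if lk \<alpha> i = 0 then {#} else {#lk \<alpha> i#})"
    by (rule sum.cong) (auto simp: in_keys_iff)
  finally show ?thesis .
qed

lemma rearrangement_card_keys:
  "rearrangement \<alpha> \<beta> \<Longrightarrow> card (Poly_Mapping.keys \<beta>) = card (Poly_Mapping.keys \<alpha>)"
proof -
  have "(\<Sum>i\<in>Poly_Mapping.keys \<gamma>. if lk \<gamma> i = 0 then 0 else 1) = card (Poly_Mapping.keys \<gamma>)" for \<gamma>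
    by (simp add: in_keys_iff cong: sum.cong_simp)
  then show "rearrangement \<alpha> \<beta> \<Longrightarrow> card (Poly_Mapping.keys \<beta>) = card (Poly_Mapping.keys \<alpha>)"
    using rearrangement_sum[of \<alpha> \<beta> "\<lambda>x. if x = 0 then 0 else (1::nat)"] by metis
qed

text \<open>The bijection behind \<open>rearrangement\<close> may carry zero positions out of the
  first n variables. Equality of the multisets of entries supplies a permutation of these variables
  instead, as \<open>permutohedron\<close> demands.\<close>

lemma rearrangement_permutes:
  assumes "rearrangement \<alpha> \<beta>" "Poly_Mapping.keys \<alpha> \<subseteq> {..<n}" "Poly_Mapping.keys \<beta> \<subseteq> {..<n}"
  obtains p where "p permutes {..<n}" "\<And>i. lk \<beta> i = lk \<alpha> (p i)"
proof -
  have "mset (map (lk \<beta>) [0..<n]) = mset (map (lk \<alpha>) [0..<n])"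
    unfolding mset_map_lookup[OF assms(2)] mset_map_lookup[OF assms(3)]
    using rearrangement_sum[OF assms(1), of "\<lambda>x. if x = 0 then {#} else {#x#}"]
      rearrangement_card_keys[OF assms(1)] by simp
  then obtain p where p: "p permutes {..<n}"
    "permute_list p (map (lk \<alpha>) [0..<n]) = map (lk \<beta>) [0..<n]"
    using mset_eq_permutation by (metis length_map length_upt minus_nat.diff_0)
  have "lk \<beta> i = lk \<alpha> (p i)" for i
  proof (cases "i < n")
    case True
    then have "p i < n" using permutes_in_image[OF p(1), of i] by simp
    moreover have "map (lk \<beta>) [0..<n] ! i = map (lk \<alpha>) [0..<n] ! p i"
      unfolding p(2)[symmetric] using True p(1) by (subst permute_list_nth) auto
    ultimately show ?thesis using True by simp
  next
    case False
    then have "p i = i" using p(1) by (simp add: permutes_def)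
    then show ?thesis using False assms by (metis in_keys_iff lessThan_iff subsetD)
  qed
  then show thesis using that p(1) by blast
qed

definition dominated_expos :: "nat \<Rightarrow> expo \<Rightarrow> expo set" where
  "dominated_expos n lam = {\<alpha>. Poly_Mapping.keys \<alpha> \<subseteq> {..<n} \<and> srt \<alpha> \<preceq>D lam}"

lemma keys_srt:
  assumes "Poly_Mapping.keys \<alpha> \<subseteq> {..<n}"
  shows "Poly_Mapping.keys (srt \<alpha>) \<subseteq> {..<n}"
proof -
  have "plength (srt \<alpha>) = card (Poly_Mapping.keys \<alpha>)"
    unfolding plength_def using rearrangement_card_keys[OF srt(2)] by metis
  also have "\<dots> \<le> n" using card_mono[OF _ assms] by simp
  finally show ?thesis using partition_keys[OF srt(1)] by auto
qed

text \<open>A dominance step moves a box from row \<open>j\<close> to row \<open>i < j\<close>; the smaller exponent vector lies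
  on the segment between the larger one and its image under the transposition of \<open>i\<close> and \<open>j\<close>.\<close>

lemma dominated_in_permutohedron:
  assumes lam: "is_partition lam"
  shows "\<alpha> \<in> dominated_expos n lam \<Longrightarrow> Poly_Mapping.keys lam \<subseteq> {..<n}
    \<Longrightarrow> expo_point \<alpha> \<in> permutohedron n lam"
proof (induction "dom_rank lam - dom_rank (srt \<alpha>)" arbitrary: \<alpha> rule: less_induct)
  case less
  have \<alpha>: "Poly_Mapping.keys \<alpha> \<subseteq> {..<n}" "srt \<alpha> \<preceq>D lam"
    using less.prems by (auto simp: dominated_expos_def)
  define mu where "mu = srt \<alpha>"
  have mu: "is_partition mu" "rearrangement mu \<alpha>" "mu \<preceq>D lam" "Poly_Mapping.keys mu \<subseteq> {..<n}"
    using srt \<alpha> keys_srt by (auto simp: mu_def)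
  obtain p where p: "p permutes {..<n}" "\<And>i. lk \<alpha> i = lk mu (p i)"
    using rearrangement_permutes[OF mu(2,4) \<alpha>(1)] by blast
  show ?case
  proof (cases "mu = lam")
    case True
    then show ?thesis unfolding permutohedron_def
      using p by (intro hull_inc) auto
  next
    case False
    then obtain nu i j where nu: "i < j" "0 < lk mu j" "is_partition nu" "nu \<preceq>D lam" "mu \<prec>D nu"
      "lk nu = (lk mu)(i := Suc (lk mu i), j := lk mu j - 1)"
      using dominance_step[OF mu(1) lam] mu(3) unfolding strictly_dominated_def by metis
    have jn: "j < n" using nu(2) mu(4) by (metis gr_implies_not0 in_keys_iff lessThan_iff subsetD)
    have keysnu: "Poly_Mapping.keys nu \<subseteq> {..<n}"
      using mu(4) nu(1) jn by (auto simp: in_keys_iff nu(6) subset_iff split: if_splits)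
    have muij: "lk mu j \<le> lk mu i"
      using mu(1) nu(1) by (simp add: is_partition_def antimono_def)
    have hull: "expo_point (Poly_Mapping.map_key s nu) \<in> permutohedron n lam"
      if s: "s permutes {..<n}" for s
    proof -
      let ?\<beta> = "Poly_Mapping.map_key s nu"
      have inj: "inj s" using s by (rule permutes_inj)
      have "rearrangement nu ?\<beta>"
        unfolding rearrangement_def using lookup_map_key[OF inj] permutes_bij[OF s] by blast
      then have srt: "srt ?\<beta> = nu" using nu(3) by (simp add: srt_eqI)
      have "Poly_Mapping.keys ?\<beta> \<subseteq> {..<n}"
      proof
        fix k assume "k \<in> Poly_Mapping.keys ?\<beta>"
        then have "s k < n" using keysnu by (auto simp: keys_map_key[OF inj])
        then show "k \<in> {..<n}" using permutes_in_image[OF s, of k] by simp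
      qed
      then have "?\<beta> \<in> dominated_expos n lam" using srt nu(4) by (simp add: dominated_expos_def)
      moreover have "dom_rank nu \<le> dom_rank lam"
        using dom_rank_less[OF nu(3) lam] nu(4) by (cases "nu = lam") (auto simp: strictly_dominated_def)
      then have "dom_rank lam - dom_rank (srt ?\<beta>) < dom_rank lam - dom_rank (srt \<alpha>)"
        using dom_rank_less[OF mu(1) nu(3,5)] srt mu_def by simp
      ultimately show ?thesis using less.hyps less.prems(2) by blast
    qed
    let ?q = "Transposition.transpose i j \<circ> p"
    have q: "?q permutes {..<n}"
      by (rule permutes_compose[OF p(1)]) (use nu(1) jn in \<open>auto intro!: permutes_swap_id\<close>)
    \<comment> \<open>Rows \<open>i\<close> and \<open>j\<close> of \<open>nu\<close> differ by mu_i
      - mu_j + 2, and mixing in their exchange with this weight carries back the one box that was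
      moved.\<close>
    define u where "u = 1 / real (lk mu i - lk mu j + 2)"
    have u: "0 \<le> u" "u \<le> 1" by (auto simp: u_def)
    have ud: "u * (real (lk mu i) - real (lk mu j) + 2) = 1"
      using muij by (simp add: u_def of_nat_diff)
    have "expo_point \<alpha> = (1 - u) *\<^sub>R expo_point (Poly_Mapping.map_key p nu)
        + u *\<^sub>R expo_point (Poly_Mapping.map_key ?q nu)"
    proof (rule poly_mapping_eqI)
      fix k
      have inj: "inj p" "inj ?q" using p(1) q by (auto dest: permutes_inj)
      have E: "real (lk mu l) = (1 - u) * real (lk nu l) + u * real (lk nu (Transposition.transpose i j l))" for l
      proof -
        consider "l = i" | "l = j" | "l \<noteq> i" "l \<noteq> j" by blast
        then show ?thesis
        proof cases
          case 1
          then show ?thesis using nu(1,2) ud by (simp add: nu(6) of_nat_diff algebra_simps)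
        next
          case 2
          then show ?thesis using nu(1,2) ud by (simp add: nu(6) of_nat_diff algebra_simps)
        next
          case 3
          then show ?thesis by (simp add: nu(6) algebra_simps)
        qed
      qed
      show "lk (expo_point \<alpha>) k = lk ((1 - u) *\<^sub>R expo_point (Poly_Mapping.map_key p nu)
        + u *\<^sub>R expo_point (Poly_Mapping.map_key ?q nu)) k"
        using E[of "p k"] by (simp add: lookup_add lookup_map_key inj p(2))
    qed
    moreover have "convex (permutohedron n lam)" by (simp add: permutohedron_def)
    ultimately show ?thesis using hull[OF p(1)] hull[OF q] u by (simp add: convexD_alt)
  qed
qed

lemma hull_dominated_expos:
  assumes lam: "is_partition lam" "plength lam \<le> n"
  shows "convex hull (expo_point ` dominated_expos n lam) = permutohedron n lam"
proof
  have keys: "Poly_Mapping.keys lam \<subseteq> {..<n}" using partition_keys[OF lam(1)] lam(2) by auto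
  show "convex hull (expo_point ` dominated_expos n lam) \<subseteq> permutohedron n lam"
    by (rule hull_minimal) (use dominated_in_permutohedron[OF lam(1) _ keys] in
      \<open>auto simp: permutohedron_def\<close>)
  show "permutohedron n lam \<subseteq> convex hull (expo_point ` dominated_expos n lam)"
    unfolding permutohedron_def
  proof (rule hull_mono, safe)
    fix v s assume s: "s permutes {..<n}" and v: "\<forall>i. lk v i = real (lk lam (s i))"
    have inj: "inj s" using s by (rule permutes_inj)
    let ?\<beta> = "Poly_Mapping.map_key s lam"
    have "rearrangement lam ?\<beta>"
      unfolding rearrangement_def using lookup_map_key[OF inj] permutes_bij[OF s] by blast
    then have "srt ?\<beta> = lam" using lam(1) by (simp add: srt_eqI)
    moreover have "Poly_Mapping.keys ?\<beta> \<subseteq> {..<n}"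
    proof
      fix k assume "k \<in> Poly_Mapping.keys ?\<beta>"
      then have "s k < n" using keys by (auto simp: keys_map_key[OF inj])
      then show "k \<in> {..<n}" using permutes_in_image[OF s, of k] by simp
    qed
    moreover have "v = expo_point ?\<beta>"
      by (rule poly_mapping_eqI) (simp add: v lookup_map_key[OF inj])
    ultimately show "v \<in> expo_point ` dominated_expos n lam"
      by (auto simp: dominated_expos_def dominated_refl)
  qed
qed

text \<open>The subset-sum inequalities collected in \<open>C\<close> define a convex set and hold
  at the generators; at a lattice point, applied to the positions of its k largest entries, they
  give dominance. The hull of \<open>dominated_expos\<close> appears instead of the permutohedron
  because \<open>symmetric_SNP\<close> also asks about fewer variables than \<open>lam\<close> has
  parts.\<close>

lemma lattice_point_dominated:
  assumes v: "v \<in> convex hull (expo_point ` dominated_expos m lam)"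
    and int: "\<And>i. lk v i \<in> \<int>"
  shows "v \<in> expo_point ` dominated_expos m lam"
proof -
  define C where "C = {v :: nat \<Rightarrow>\<^sub>0 real. (\<forall>i. lk v i \<ge> 0) \<and> (\<forall>i\<ge>m. lk v i = 0) \<and>
    (\<forall>S. finite S \<longrightarrow> (\<Sum>i\<in>S. lk v i) \<le> real (psum lam (card S))) \<and>
    (\<Sum>i<m. lk v i) = real (psize lam)}"
  have "convex hull (expo_point ` dominated_expos m lam) \<subseteq> C"
  proof (rule hull_minimal)
    show "convex C"
    proof (rule convexI)
      fix x y :: "nat \<Rightarrow>\<^sub>0 real" and a b :: real
      assume x: "x \<in> C" and y: "y \<in> C" and ab: "0 \<le> a" "0 \<le> b" "a + b = 1"
      have "(\<Sum>i\<in>S. a * lk x i + b * lk y i) \<le> real (psum lam (card S))" if "finite S" for S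
      proof -
        have "(\<Sum>i\<in>S. a * lk x i + b * lk y i) = a * (\<Sum>i\<in>S. lk x i) + b * (\<Sum>i\<in>S. lk y i)"
          by (simp add: sum.distrib sum_distrib_left)
        also have "\<dots> \<le> real (psum lam (card S))"
          by (rule convex_bound_le) (use x y ab that in \<open>auto simp: C_def\<close>)
        finally show ?thesis .
      qed
      moreover have "(\<Sum>i<m. a * lk x i + b * lk y i) = real (psize lam)"
      proof -
        have "(\<Sum>i<m. a * lk x i + b * lk y i) = a * (\<Sum>i<m. lk x i) + b * (\<Sum>i<m. lk y i)"
          by (simp add: sum.distrib sum_distrib_left)
        also have "\<dots> = (a + b) * real (psize lam)"
          using x y by (simp add: C_def algebra_simps)
        finally show ?thesis using ab by simp
      qed
      ultimately show "a *\<^sub>R x + b *\<^sub>R y \<in> C"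
        using x y ab by (simp add: C_def lookup_add)
    qed
    show "expo_point ` dominated_expos m lam \<subseteq> C"
    proof safe
      fix \<alpha> assume "\<alpha> \<in> dominated_expos m lam"
      then have \<alpha>: "Poly_Mapping.keys \<alpha> \<subseteq> {..<m}" "psize \<alpha> = psize lam"
        "\<And>k. psum (srt \<alpha>) k \<le> psum lam k"
        by (auto simp: dominated_expos_def dominated_psum psize_srt)
      have "(\<Sum>i\<in>S. real (lk \<alpha> i)) \<le> real (psum lam (card S))" if "finite S" for S
        using rearrangement_sum_le[OF srt that, of \<alpha>] \<alpha>(3)[of "card S"]
        by (metis of_nat_le_iff of_nat_sum order_trans)
      moreover have "(\<Sum>i<m. real (lk \<alpha> i)) = real (psize lam)"
        using psize_eq[OF \<alpha>(1)] \<alpha>(2) by (simp add: psum_def)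
      ultimately show "expo_point \<alpha> \<in> C"
        using \<alpha>(1) by (auto simp: C_def in_keys_iff)
    qed
  qed
  then have "v \<in> C" using v by blast
  then have C: "\<And>i. lk v i \<ge> 0" "\<And>i. i \<ge> m \<Longrightarrow> lk v i = 0"
    "\<And>S. finite S \<Longrightarrow> (\<Sum>i\<in>S. lk v i) \<le> real (psum lam (card S))"
    "(\<Sum>i<m. lk v i) = real (psize lam)" by (auto simp: C_def)
  define \<alpha> where "\<alpha> = Poly_Mapping.map (\<lambda>r. nat \<lfloor>r\<rfloor>) v"
  have lka: "real (lk \<alpha> i) = lk v i" for i
    using int[of i] C(1)[of i] by (auto simp: \<alpha>_def Poly_Mapping.map.rep_eq when_def elim!: Ints_cases)
  have keys: "Poly_Mapping.keys \<alpha> \<subseteq> {..<m}"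
  proof
    fix i assume "i \<in> Poly_Mapping.keys \<alpha>"
    then show "i \<in> {..<m}" using C(2)[of i] lka[of i] by (force simp: in_keys_iff)
  qed
  have "real (psize \<alpha>) = real (psize lam)"
    using C(4) unfolding psize_eq[OF keys] psum_def by (simp add: lka)
  moreover have "psum (srt \<alpha>) k \<le> psum lam k" for k
  proof -
    obtain p where p: "bij p" "\<And>i. lk (srt \<alpha>) i = lk \<alpha> (p i)"
      using rearrangement_sym[OF srt(2), of \<alpha>] unfolding rearrangement_def by blast
    have inj: "inj_on p {..<k}" using p(1) by (meson bij_is_inj inj_on_subset subset_UNIV)
    have "psum (srt \<alpha>) k = (\<Sum>i\<in>p ` {..<k}. lk \<alpha> i)"
      using inj by (simp add: psum_def p(2) sum.reindex)
    then have "real (psum (srt \<alpha>) k) = (\<Sum>i\<in>p ` {..<k}. lk v i)" by (simp add: lka)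
    also have "\<dots> \<le> real (psum lam (card (p ` {..<k})))" by (rule C(3)) simp
    also have "card (p ` {..<k}) = k" using card_image[OF inj] by simp
    finally show ?thesis by simp
  qed
  ultimately have "\<alpha> \<in> dominated_expos m lam"
    using keys by (simp add: dominated_expos_def dominated_psum psize_srt)
  moreover have "v = expo_point \<alpha>" by (rule poly_mapping_eqI) (simp add: lka)
  ultimately show ?thesis by blast
qed

theorem SNP_of_dominated_support:
  fixes f :: "'a::zero series"
  assumes lam: "is_partition lam" and supp: "\<And>\<alpha>. f \<alpha> \<noteq> 0 \<longleftrightarrow> srt \<alpha> \<preceq>D lam"
  shows "symmetric_SNP f"
    and "plength lam \<le> n \<Longrightarrow> newton (set_vars_zero n f) = permutohedron n lam"
proof -
  have eq: "{\<alpha>. set_vars_zero m f \<alpha> \<noteq> 0} = dominated_expos m lam" for m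
    using supp by (auto simp: set_vars_zero_def dominated_expos_def)
  show "symmetric_SNP f"
    unfolding symmetric_SNP_def has_SNP_def newton_def eq using lattice_point_dominated by blast
  show "newton (set_vars_zero n f) = permutohedron n lam" if "plength lam \<le> n"
    unfolding newton_def eq by (rule hull_dominated_expos[OF lam that])
qed

section \<open>The ring of symmetric functions as polynomials in power sums\<close>

text \<open>The monomial indexed by a multiset \<open>M\<close> is the product of the power sums \<open>p\<^bsub>i+1\<^esub>\<close> for
  \<open>i \<in># M\<close>; the shift by one keeps \<open>p\<^sub>0\<close> out of the ring.\<close>

type_synonym 'a sf = "nat multiset \<Rightarrow>\<^sub>0 'a"

abbreviation cst :: "'a \<Rightarrow> 'a::comm_ring_1 sf" where "cst c \<equiv> Poly_Mapping.single {#} c"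
abbreviation pvar :: "nat \<Rightarrow> 'a::comm_ring_1 sf" where "pvar i \<equiv> Poly_Mapping.single {#i#} 1"

lemma poly_mapping_additive_induct [case_names zero single add]:
  fixes f :: "'k \<Rightarrow>\<^sub>0 'v::comm_monoid_add"
  assumes "P 0" "\<And>k v. P (Poly_Mapping.single k v)" "\<And>f g. P f \<Longrightarrow> P g \<Longrightarrow> P (f + g)"
  shows "P f"
proof -
  have "P (\<Sum>k\<in>K. Poly_Mapping.single k (lk f k))" if "finite K" for K
    using that by induction (auto intro: assms)
  moreover have "f = (\<Sum>k\<in>Poly_Mapping.keys f. Poly_Mapping.single k (lk f k))"
    by (rule poly_mapping_eqI) (simp add: lookup_sum lookup_single when_def in_keys_iff)
  ultimately show ?thesis by (metis finite_keys)
qed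

text \<open>The coefficient is an argument of the summand instead of a scalar factor, so that one
  scheme serves values in the field, in the ring and in polynomials over it; additivity becomes a
  hypothesis of \<open>lin_ext_add\<close>.\<close>

definition lin_ext :: "('k \<Rightarrow> 'v::zero \<Rightarrow> 'b::comm_monoid_add) \<Rightarrow> ('k \<Rightarrow>\<^sub>0 'v) \<Rightarrow> 'b" where
  "lin_ext \<phi> f = (\<Sum>k\<in>Poly_Mapping.keys f. \<phi> k (lk f k))"

lemma lin_ext_superset:
  assumes "\<And>k. \<phi> k 0 = 0" "finite K" "Poly_Mapping.keys f \<subseteq> K"
  shows "lin_ext \<phi> f = (\<Sum>k\<in>K. \<phi> k (lk f k))"
  unfolding lin_ext_def using assms by (intro sum.mono_neutral_left) (auto simp: in_keys_iff)

lemma lin_ext_single: "\<phi> k 0 = 0 \<Longrightarrow> lin_ext \<phi> (Poly_Mapping.single k v) = \<phi> k v"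
  by (cases "v = 0") (simp_all add: lin_ext_def)

lemma lin_ext_add:
  assumes "\<And>k. \<phi> k 0 = 0" "\<And>k a b. \<phi> k (a + b) = \<phi> k a + \<phi> k b"
  shows "lin_ext \<phi> (f + g) = lin_ext \<phi> f + lin_ext \<phi> g"
proof -
  let ?K = "Poly_Mapping.keys f \<union> Poly_Mapping.keys g"
  have "Poly_Mapping.keys (f + g) \<subseteq> ?K" by (rule Poly_Mapping.keys_add)
  then show ?thesis
    using lin_ext_superset[of \<phi> ?K f] lin_ext_superset[of \<phi> ?K g] lin_ext_superset[of \<phi> ?K "f + g"] assms
    by (simp add: lookup_add sum.distrib)
qed

lemma lin_ext_zero [simp]: "lin_ext \<phi> 0 = 0" by (simp add: lin_ext_def)

lemma single_add_mset:
  "Poly_Mapping.single (add_mset i M) c = pvar i * Poly_Mapping.single M (c::'a::comm_ring_1)"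
  by (simp add: mult_single)

declare single_of_nat [simp del]

lemma cst_one [simp]: "cst 1 = (1 :: 'a::comm_ring_1 sf)"
  unfolding single_one[symmetric] by simp

lemma cst_mult: "cst (a * b) = cst a * cst (b::'a::comm_ring_1)"
  by (simp add: mult_single)

lemma lookup_cst_mult [simp]: "lk (cst c * f) M = c * lk f (M :: nat multiset)"
proof (induction f rule: poly_mapping_additive_induct)
  case (single k v)
  then show ?case by (simp add: mult_single lookup_single when_def)
qed (simp_all add: distrib_left lookup_add)

lemma lookup_pvar_mult: "lk (pvar i * f) M = (if i \<in># M then lk f (M - {#i#}) else 0)"
proof (induction f rule: poly_mapping_additive_induct)
  case (single k v)
  then show ?case by (auto simp: mult_single lookup_single when_def)
qed (simp_all add: distrib_left lookup_add)

lemma lookup_mult_empty: "lk (f * g) {#} = lk f {#} * lk (g :: 'a::comm_ring_1 sf) {#}"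
proof (induction f rule: poly_mapping_additive_induct)
  case (single k v)
  show ?case
    by (induction g rule: poly_mapping_additive_induct)
       (auto simp: mult_single lookup_single when_def distrib_left lookup_add)
qed (simp_all add: distrib_right lookup_add)

section \<open>Derivatives, degrees and substitutions in the ring\<close>

definition pderivat :: "nat \<Rightarrow> 'a::comm_ring_1 sf \<Rightarrow> 'a sf" where
  "pderivat i = lin_ext (\<lambda>M c. Poly_Mapping.single (M - {#i#}) (of_nat (count M i) * c))"

lemma pderivat_add: "pderivat i (f + g) = pderivat i f + pderivat i g"
  unfolding pderivat_def by (rule lin_ext_add) (simp_all add: distrib_left single_add)

lemma pderivat_single:
  "pderivat i (Poly_Mapping.single M c) = Poly_Mapping.single (M - {#i#}) (of_nat (count M i) * c)"
  unfolding pderivat_def by (rule lin_ext_single) simp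

lemma pderivat_0 [simp]: "pderivat i 0 = 0" by (simp add: pderivat_def)

lemma pderivat_sum: "pderivat i (sum f A) = (\<Sum>x\<in>A. pderivat i (f x))"
  by (induction A rule: infinite_finite_induct) (auto simp: pderivat_add)

lemma lookup_pderivat: "lk (pderivat i f) M = of_nat (Suc (count M i)) * lk f (add_mset i M)"
proof (induction f rule: poly_mapping_additive_induct)
  case (single k v)
  have "k - {#i#} = M \<longleftrightarrow> k = add_mset i M" if "i \<in># k" using that by auto
  then show ?case
    by (cases "i \<in># k") (auto simp: pderivat_single lookup_single when_def not_in_iff)
qed (simp_all add: pderivat_add lookup_add distrib_left)

lemma pderivat_mult: "pderivat i (f * g) = pderivat i f * g + f * pderivat i (g :: 'a::comm_ring_1 sf)"
proof (induction f rule: poly_mapping_additive_induct)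
  case (single k v)
  show ?case
  proof (induction g rule: poly_mapping_additive_induct)
    case (single l u)
    have 1: "Poly_Mapping.single (k - {#i#} + l) (of_nat (count k i) * v * u) =
        Poly_Mapping.single (k + l - {#i#}) (of_nat (count k i) * v * u)"
      by (cases "i \<in># k") (simp_all add: not_in_iff)
    have 2: "Poly_Mapping.single (k + (l - {#i#})) (v * (of_nat (count l i) * u)) =
        Poly_Mapping.single (k + l - {#i#}) (v * (of_nat (count l i) * u))"
      by (cases "i \<in># l") (simp_all add: not_in_iff)
    show ?case
      unfolding pderivat_single mult_single 1 2 single_add[symmetric]
      by (rule arg_cong[of _ _ "Poly_Mapping.single _"]) (simp add: algebra_simps)
  qed (simp_all add: pderivat_add distrib_left)
qed (simp_all add: pderivat_add distrib_right)

definition wt :: "nat multiset \<Rightarrow> nat" where "wt M = (\<Sum>i\<in>#M. Suc i)"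

lemma wt_simps [simp]: "wt {#} = 0" "wt (add_mset i M) = Suc i + wt M" "wt (M + N) = wt M + wt N"
  by (simp_all add: wt_def)

lemma wt_diff: "i \<in># M \<Longrightarrow> wt (M - {#i#}) = wt M - Suc i"
  using wt_simps(2)[of i "M - {#i#}"] by simp

lemma Suc_le_wt: "i \<in># M \<Longrightarrow> Suc i \<le> wt M"
  using wt_simps(2)[of i "M - {#i#}"] by simp

lemma wt_0_iff [simp]: "wt M = 0 \<longleftrightarrow> M = {#}"
  by (cases M) simp_all

lemma finite_wt: "finite {M. wt M = k}"
proof (rule finite_subset)
  show "{M. wt M = k} \<subseteq> mset ` {xs. set xs \<subseteq> {..<k} \<and> length xs \<le> k}"
  proof safe
    fix M :: "nat multiset"
    obtain xs where xs: "M = mset xs" using ex_mset by metis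
    have "size M \<le> wt M" by (induction M) auto
    then show "M \<in> mset ` {xs. set xs \<subseteq> {..<wt M} \<and> length xs \<le> wt M}"
      using Suc_le_wt[of _ M] xs by (force intro: imageI)
  qed
  show "finite (mset ` {xs. set xs \<subseteq> {..<k} \<and> length xs \<le> k})"
    by (intro finite_imageI finite_lists_length_le) simp
qed


lemma wt_eq_sum_count:
  "finite A \<Longrightarrow> set_mset M \<subseteq> A \<Longrightarrow> wt M = (\<Sum>i\<in>A. Suc i * count M i)"
proof (induction M)
  case (add x M)
  have "(\<Sum>i\<in>A. Suc i * count (add_mset x M) i) = (\<Sum>i\<in>A. Suc i * count M i + (if i = x then Suc i else 0))"
    by (rule sum.cong) auto
  also have "\<dots> = wt M + Suc x"
    using add by (simp only: sum.distrib) simp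
  finally show ?case by simp
qed simp

text \<open>The ring homomorphism p_(i+1) -> p_(i+1) + a_i z^(i+1), with z the variable of the outer
  polynomial. For \<open>a\<close> constantly 1 it splits off one variable z from a symmetric
  function.\<close>

definition shift_hom :: "(nat \<Rightarrow> 'a::comm_ring_1) \<Rightarrow> 'a sf \<Rightarrow> 'a sf poly" where
  "shift_hom a = lin_ext (\<lambda>M c. [:cst c:] * (\<Prod>i\<in>#M. [:pvar i:] + monom (cst (a i)) (Suc i)))"

lemma shift_hom_add: "shift_hom a (f + g) = shift_hom a f + shift_hom a g"
  unfolding shift_hom_def by (rule lin_ext_add) (simp_all add: single_add smult_add_left)

lemma shift_hom_0 [simp]: "shift_hom a 0 = 0" by (simp add: shift_hom_def)

lemma shift_hom_single: "shift_hom a (Poly_Mapping.single M c) =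
    [:cst c:] * (\<Prod>i\<in>#M. [:pvar i:] + monom (cst (a i)) (Suc i))"
  unfolding shift_hom_def by (rule lin_ext_single) simp

lemma shift_hom_mult: "shift_hom a (f * g) = shift_hom a f * shift_hom a g"
proof (induction f rule: poly_mapping_additive_induct)
  case (single k v)
  show ?case
  proof (induction g rule: poly_mapping_additive_induct)
    case (single l u)
    have "shift_hom a (Poly_Mapping.single k v * Poly_Mapping.single l u) = 
      [:cst v * cst u:] * ((\<Prod>i\<in>#k. [:pvar i:] + monom (cst (a i)) (Suc i)) *
         (\<Prod>i\<in>#l. [:pvar i:] + monom (cst (a i)) (Suc i)))"
      unfolding mult_single shift_hom_single by (simp add: cst_mult)
    also have "[:cst v * cst u:] = [:cst v:] * [:cst u:]" by simp
    finally show ?case unfolding shift_hom_single by (simp only: mult_ac)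
  qed (simp_all add: shift_hom_add distrib_left)
qed (simp_all add: shift_hom_add distrib_right)

definition B :: "(nat \<Rightarrow> 'a::comm_ring_1) \<Rightarrow> nat \<Rightarrow> 'a sf \<Rightarrow> 'a sf" where
  "B a k f = coeff (shift_hom a f) k"

lemma B_add: "B a k (f + g) = B a k f + B a k g"
  by (simp add: B_def shift_hom_add)

lemma B_0 [simp]: "B a k 0 = 0" by (simp add: B_def)

lemma B_mult: "B a k (f * g) = (\<Sum>i\<le>k. B a i f * B a (k - i) g)"
  by (simp add: B_def shift_hom_mult coeff_mult)

lemma B_cst: "B a k (cst c) = (if k = 0 then cst c else 0)"
  by (simp add: B_def shift_hom_single coeff_pCons split: nat.splits)

lemma B_pvar_mult: "B a k (pvar i * f) = pvar i * B a k f +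
    (if Suc i \<le> k then cst (a i) * B a (k - Suc i) f else 0)"
proof -
  have 1: "shift_hom a (pvar i) = [:pvar i:] + monom (cst (a i)) (Suc i)"
    by (simp add: shift_hom_single)
  have "shift_hom a (pvar i * f) = smult (pvar i) (shift_hom a f) + monom (cst (a i)) (Suc i) * shift_hom a f"
    unfolding shift_hom_mult 1 by (simp add: distrib_right)
  then show ?thesis unfolding B_def by (simp add: coeff_monom_mult not_le not_less)
qed

section \<open>Weighted inner products, exponential series and their adjoints\<close>

locale sf_form =
  fixes w :: "nat \<Rightarrow> 'a::field_char_0"
  assumes w_nz: "w i \<noteq> 0"
begin

text \<open>The squared norm of the product of power sums indexed by \<open>M\<close>, where
  \<open>w i\<close> is that of p_(i+1).\<close>

definition Z :: "nat multiset \<Rightarrow> 'a" where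
  "Z M = (\<Prod>i\<in>#M. w i) * of_nat (\<Prod>i\<in>set_mset M. fact (count M i))"

lemma Z_empty [simp]: "Z {#} = 1" by (simp add: Z_def)

lemma Z_add_mset: "Z (add_mset i M) = w i * of_nat (Suc (count M i)) * Z M"
proof -
  have "(\<Prod>j\<in>set_mset (add_mset i M). fact (count (add_mset i M) j)) =
      fact (Suc (count M i)) * (\<Prod>j\<in>set_mset M - {i}. fact (count M j) :: nat)"
    by (simp add: prod.insert_remove)
  moreover have "(\<Prod>j\<in>set_mset M. fact (count M j)) =
      fact (count M i) * (\<Prod>j\<in>set_mset M - {i}. fact (count M j) :: nat)"
    by (cases "i \<in># M") (auto simp: prod.remove not_in_iff)
  ultimately have "(\<Prod>j\<in>set_mset (add_mset i M). fact (count (add_mset i M) j)) =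
      Suc (count M i) * (\<Prod>j\<in>set_mset M. fact (count M j) :: nat)"
    by (simp add: algebra_simps)
  then show ?thesis unfolding Z_def by (simp only: of_nat_mult image_mset_add_mset prod_mset.add_mset mult_ac)
qed

lemma Z_nz: "Z M \<noteq> 0"
proof (induction M)
  case (add i M)
  have "of_nat (Suc (count M i)) \<noteq> (0::'a)" by (rule of_nat_neq_0)
  then show ?case unfolding Z_add_mset using add w_nz by simp
qed simp

definition ip :: "'a sf \<Rightarrow> 'a sf \<Rightarrow> 'a" where
  "ip f g = lin_ext (\<lambda>M c. c * lk g M * Z M) f"

lemma ip_add_left: "ip (f + g) h = ip f h + ip g h"
  unfolding ip_def by (rule lin_ext_add) (simp_all add: algebra_simps)

lemma ip_0 [simp]: "ip 0 h = 0" "ip h 0 = 0"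
  by (simp_all add: ip_def) (simp add: lin_ext_def)

lemma ip_single: "ip (Poly_Mapping.single M c) h = c * lk h M * Z M"
  unfolding ip_def by (rule lin_ext_single) simp

lemma ip_add_right: "ip h (f + g) = ip h f + ip h g"
  by (simp add: ip_def lin_ext_def lookup_add algebra_simps sum.distrib)

lemma ip_commute: "ip f g = ip g f"
proof (induction f rule: poly_mapping_additive_induct)
  case (single k v)
  show ?case
    by (induction g rule: poly_mapping_additive_induct)
       (auto simp: ip_single ip_add_left ip_add_right lookup_single when_def)
qed (simp_all add: ip_add_left ip_add_right)

lemma ip_sum_left: "ip (sum f A) h = (\<Sum>x\<in>A. ip (f x) h)"
  by (induction A rule: infinite_finite_induct) (auto simp: ip_add_left)

lemma ip_sum_right: "ip h (sum f A) = (\<Sum>x\<in>A. ip h (f x))"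
  by (induction A rule: infinite_finite_induct) (auto simp: ip_add_right)

lemma ip_cst_mult_right: "ip f (cst c * g) = c * ip f g"
  unfolding ip_def lin_ext_def lookup_cst_mult sum_distrib_left by (simp add: mult_ac)

lemma ip_cst_mult_left: "ip (cst c * f) g = c * ip f g"
  using ip_cst_mult_right ip_commute by metis

lemma ip_diff_right: "ip h (f - g) = ip h f - ip h g"
  using ip_add_right[of h "f - g" g] by simp

lemma ip_one: "ip 1 g = lk g {#}"
  using ip_single[of "{#}" 1 g] by simp

lemma ip_nondegenerate:
  assumes "\<And>f. ip f g = ip f h"
  shows "g = h"
proof (rule poly_mapping_eqI)
  fix M
  show "lk g M = lk h M" using assms[of "Poly_Mapping.single M 1"] Z_nz by (simp add: ip_single)
qed

lemma ip_pvar_mult: "ip (pvar i * f) g = w i * ip f (pderivat i g)"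
proof (induction f rule: poly_mapping_additive_induct)
  case (single k v)
  then show ?case
    unfolding single_add_mset[symmetric] by (simp add: ip_single lookup_pderivat Z_add_mset)
qed (simp_all add: distrib_left ip_add_left)

text \<open>The coefficient of \<open>z\<^sup>k\<close> in \<open>exp (\<Sum>\<^sub>i a i * p\<^bsub>i+1\<^esub> * z\<^bsup>i+1\<^esup> / w i)\<close>.\<close>

definition G :: "(nat \<Rightarrow> 'a) \<Rightarrow> nat \<Rightarrow> 'a sf" where
  "G a k = (\<Sum>M | wt M = k. Poly_Mapping.single M ((\<Prod>i\<in>#M. a i) / Z M))"

lemma lookup_G: "lk (G a k) M = (if wt M = k then (\<Prod>i\<in>#M. a i) / Z M else 0)"
proof -
  have "lk (G a k) M = (\<Sum>N | wt N = k. if N = M then (\<Prod>i\<in>#N. a i) / Z N else 0)"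
    by (simp add: G_def lookup_sum lookup_single when_def)
  also have "\<dots> = (if wt M = k then (\<Prod>i\<in>#M. a i) / Z M else 0)"
    using finite_wt[of k] by (simp add: sum.delta)
  finally show ?thesis .
qed

lemma G_0 [simp]: "G a 0 = 1"
  by (rule poly_mapping_eqI) (simp add: lookup_G lookup_one when_def)

lemma pderivat_G:
  "pderivat i (G a k) = (if Suc i \<le> k then cst (a i / w i) * G a (k - Suc i) else 0)"
proof (rule poly_mapping_eqI)
  fix M
  have "of_nat (Suc (count M i)) \<noteq> (0::'a)" by (rule of_nat_neq_0)
  then show "lk (pderivat i (G a k)) M =
      lk (if Suc i \<le> k then cst (a i / w i) * G a (k - Suc i) else 0) M"
    by (auto simp: lookup_pderivat lookup_G Z_add_mset simp del: of_nat_Suc)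
qed

text \<open>Every coefficient except the constant term is, up to a positive integer factor, a
  coefficient of some derivative. This allows identities of exponentials to be checked by
  differentiation.\<close>

lemma G_unique:
  assumes pd: "\<And>i m. pderivat i (U m) = (if Suc i \<le> m then cst (a i / w i) * U (m - Suc i) else 0)"
    and const: "\<And>m. lk (U m) {#} = (if m = 0 then 1 else 0)"
  shows "U m = G a m"
proof (rule poly_mapping_eqI)
  fix M
  show "lk (U m) M = lk (G a m) M"
  proof (induction M arbitrary: m)
    case empty
    then show ?case by (simp add: const lookup_G)
  next
    case (add i M)
    have nz: "of_nat (Suc (count M i)) \<noteq> (0::'a)" by (rule of_nat_neq_0)
    have "of_nat (Suc (count M i)) * lk (U m) (add_mset i M) =
        of_nat (Suc (count M i)) * lk (G a m) (add_mset i M)"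
      unfolding lookup_pderivat[symmetric] pd pderivat_G using add by simp
    then show ?case using nz by (metis mult_left_cancel)
  qed
qed

text \<open>Induction on the monomial in the second argument: pulling out a factor p_(i+1)
  differentiates the first argument, and the product rule there matches the recursion
  \<open>B_pvar_mult\<close> on the other side.\<close>

lemma G_adjoint: "ip (G a k * f) g = ip f (B a k g)"
proof (induction g arbitrary: f k rule: poly_mapping_additive_induct)
  case (single M c)
  show ?case
  proof (induction M arbitrary: f k)
    case empty
    have "ip (G a k * f) (cst c) = ip (cst c) (G a k * f)" by (rule ip_commute)
    also have "\<dots> = (if k = 0 then ip (cst c) f else 0)"
      by (auto simp: ip_single lookup_mult_empty lookup_G)
    finally show ?case by (simp add: B_cst ip_commute)
  next
    case (add i M)
    let ?g = "Poly_Mapping.single M c"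
    have "ip (G a k * f) (Poly_Mapping.single (add_mset i M) c) = w i * ip (pderivat i (G a k * f)) ?g"
      unfolding single_add_mset[of i M c] by (metis ip_pvar_mult ip_commute)
    also have "\<dots> = w i * ip (pderivat i (G a k) * f) ?g + w i * ip (G a k * pderivat i f) ?g"
      by (simp add: pderivat_mult ip_add_left distrib_left)
    also have "w i * ip (pderivat i (G a k) * f) ?g =
        (if Suc i \<le> k then a i * ip f (B a (k - Suc i) ?g) else 0)"
      using w_nz[of i] add by (simp add: pderivat_G ip_cst_mult_left mult.assoc)
    also have "w i * ip (G a k * pderivat i f) ?g = ip f (pvar i * B a k ?g)"
      unfolding add by (metis ip_pvar_mult ip_commute)
    finally show ?case
      unfolding single_add_mset[of i M c] B_pvar_mult by (simp add: ip_add_right ip_cst_mult_right)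
  qed
qed (simp_all add: ip_add_right B_add)

lemma ip_G: "ip (G a k) f = lk (B a k f) {#}"
  using G_adjoint[of a k 1 f] by (simp add: ip_one)

lemma ip_G_mult: "ip (G a k) (f * g) = (\<Sum>i\<le>k. ip (G a i) f * ip (G a (k - i)) g)"
  by (simp add: ip_G B_mult lookup_sum lookup_mult_empty)

text \<open>The coefficient of z^k in exp (sum over i of a_i b_i z^(i+1) / w_i).\<close>

definition \<theta> :: "(nat \<Rightarrow> 'a) \<Rightarrow> (nat \<Rightarrow> 'a) \<Rightarrow> nat \<Rightarrow> 'a" where
  "\<theta> a b k = ip (G b k) (G a k)"

lemma ip_G_G_neq: "i \<noteq> k \<Longrightarrow> ip (G b i) (G a k) = 0"
  unfolding ip_def lin_ext_def by (rule sum.neutral) (auto simp: lookup_G in_keys_iff)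

text \<open>Paired with an arbitrary \<open>f\<close>, the lowering operator becomes multiplication
  by \<open>G a k\<close>. After \<open>ip_G_mult\<close> only one splitting is left, since members
  of the two series in different degrees are orthogonal.\<close>

lemma B_G: "B a k (G b n) = (if k \<le> n then cst (\<theta> a b k) * G b (n - k) else 0)"
proof (rule ip_nondegenerate)
  fix f
  have "ip f (B a k (G b n)) = ip (G b n) (G a k * f)"
    using G_adjoint ip_commute by metis
  also have "\<dots> = (\<Sum>i\<le>n. if i = k then \<theta> a b k * ip (G b (n - k)) f else 0)"
    unfolding ip_G_mult by (rule sum.cong) (auto simp: ip_G_G_neq \<theta>_def)
  also have "\<dots> = ip f (if k \<le> n then cst (\<theta> a b k) * G b (n - k) else 0)"
    by (simp add: ip_commute[of f] ip_cst_mult_left)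
  finally show "ip f (B a k (G b n)) = \<dots>" .
qed

text \<open>Euler's identity for homogeneous polynomials.\<close>

lemma G_rec: "cst (of_nat k) * G a k =
  (\<Sum>i<k. cst (of_nat (Suc i) * (a i / w i)) * (pvar i * G a (k - Suc i)))"
proof (rule poly_mapping_eqI)
  fix M
  show "lk (cst (of_nat k) * G a k) M =
    lk (\<Sum>i<k. cst (of_nat (Suc i) * (a i / w i)) * (pvar i * G a (k - Suc i))) M"
  proof (cases "wt M = k")
    case True
    have *: "of_nat (Suc i) * (a i / w i) * lk (pvar i * G a (k - Suc i)) M =
      of_nat (Suc i * count M i) * ((\<Prod>i\<in>#M. a i) / Z M)" for i
    proof (cases "i \<in># M")
      case iM: True
      then obtain N where N: "M = add_mset i N" by (metis mset_add)
      have "of_nat (Suc (count N i)) \<noteq> (0::'a)" by (rule of_nat_neq_0)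
      then show ?thesis using True w_nz[of i] Z_nz[of N]
        by (auto simp: lookup_pvar_mult lookup_G N Z_add_mset divide_simps simp del: of_nat_Suc)
          (simp_all add: algebra_simps)
    next
      case False
      then have "count M i = 0" by (simp add: not_in_iff)
      then show ?thesis using False by (simp add: lookup_pvar_mult)
    qed
    have k: "k = (\<Sum>i<k. Suc i * count M i)"
    proof -
      have "set_mset M \<subseteq> {..<k}" using Suc_le_wt[of _ M] True by (auto simp: Suc_le_eq)
      then show ?thesis using wt_eq_sum_count[of "{..<k}" M] True by simp
    qed
    have "of_nat k * ((\<Prod>i\<in>#M. a i) / Z M) =
        (\<Sum>i<k. of_nat (Suc i * count M i) * ((\<Prod>i\<in>#M. a i) / Z M))"
      using arg_cong[OF k, of "\<lambda>n. of_nat n * ((\<Prod>i\<in>#M. a i) / Z M)"]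
      by (simp only: of_nat_sum sum_distrib_right)
    then show ?thesis using True by (simp only: lookup_sum lookup_cst_mult * lookup_G) simp
  next
    case False
    have "lk (pvar i * G a (k - Suc i)) M = 0" if "i < k" for i
      using that False Suc_le_wt[of i M] by (auto simp: lookup_pvar_mult lookup_G wt_diff)
    then show ?thesis using False by (simp add: lookup_sum lookup_G)
  qed
qed

lemma \<theta>_0 [simp]: "\<theta> a b 0 = 1"
  by (simp add: \<theta>_def ip_one lookup_one)

lemma \<theta>_rec: "of_nat k * \<theta> a b k = (\<Sum>i<k. of_nat (Suc i) * a i * b i / w i * \<theta> a b (k - Suc i))"
proof -
  have "of_nat k * \<theta> a b k = ip (G b k) (cst (of_nat k) * G a k)"
    unfolding \<theta>_def by (rule ip_cst_mult_right[symmetric])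
  also have "\<dots> = (\<Sum>i<k. of_nat (Suc i) * (a i / w i) * ip (G b k) (pvar i * G a (k - Suc i)))"
    by (simp only: G_rec ip_sum_right ip_cst_mult_right)
  also have "\<dots> = (\<Sum>i<k. of_nat (Suc i) * a i * b i / w i * \<theta> a b (k - Suc i))"
  proof (rule sum.cong)
    fix i assume "i \<in> {..<k}"
    then have "ip (G b k) (pvar i * G a (k - Suc i)) = w i * (b i / w i * \<theta> a b (k - Suc i))"
      using ip_commute ip_pvar_mult[of i "G a (k - Suc i)" "G b k"]
      by (simp add: pderivat_G ip_cst_mult_right \<theta>_def)
    then show "of_nat (Suc i) * (a i / w i) * ip (G b k) (pvar i * G a (k - Suc i)) =
        of_nat (Suc i) * a i * b i / w i * \<theta> a b (k - Suc i)"
      using w_nz[of i] by (simp add: field_simps)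
  qed simp
  finally show ?thesis .
qed

text \<open>Exponentials multiply by adding exponents; \<open>G_unique\<close> reduces this to the
  product rule.\<close>

lemma G_convolution: "(\<Sum>j\<le>m. G a j * G b (m - j)) = G (\<lambda>i. a i + b i) m"
proof (rule G_unique)
  fix m show "lk (\<Sum>j\<le>m. G a j * G b (m - j)) {#} = (if m = 0 then 1 else 0)"
    by (auto simp: lookup_sum lookup_mult_empty lookup_G intro!: sum.neutral)
next
  fix i m
  let ?U = "\<lambda>m. \<Sum>j\<le>m. G a j * G b (m - j)"
  have split: "(\<Sum>j\<le>m. if Suc i \<le> j then f j else 0) =
      (if Suc i \<le> m then \<Sum>j\<le>m - Suc i. f (j + Suc i) else (0::'a sf))" for f
  proof (cases "Suc i \<le> m")
    case True
    have "(\<Sum>j\<le>m. if Suc i \<le> j then f j else 0) = (\<Sum>j\<in>{Suc i..m}. f j)"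
      by (rule sum.mono_neutral_cong_right) auto
    also have "\<dots> = (\<Sum>j\<le>m - Suc i. f (j + Suc i))"
      by (rule sum.reindex_bij_witness[of _ "\<lambda>j. j + Suc i" "\<lambda>j. j - Suc i"]) (use True in auto)
    finally show ?thesis using True by simp
  qed (auto intro!: sum.neutral)
  have "(\<Sum>j\<le>m. pderivat i (G a j) * G b (m - j)) =
      (\<Sum>j\<le>m. if Suc i \<le> j then cst (a i / w i) * G a (j - Suc i) * G b (m - j) else 0)"
    by (rule sum.cong) (auto simp: pderivat_G)
  also have "\<dots> = (if Suc i \<le> m then cst (a i / w i) * ?U (m - Suc i) else 0)"
    unfolding split by (auto simp: sum_distrib_left mult.assoc add.commute[of i] intro!: sum.cong)
  finally have 1: "(\<Sum>j\<le>m. pderivat i (G a j) * G b (m - j)) =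
      (if Suc i \<le> m then cst (a i / w i) * ?U (m - Suc i) else 0)" .
  have "(\<Sum>j\<le>m. G a j * pderivat i (G b (m - j))) = (\<Sum>j\<le>m. G a (m - j) * pderivat i (G b j))"
    by (rule sum.reindex_bij_witness[of _ "\<lambda>j. m - j" "\<lambda>j. m - j"]) auto
  also have "\<dots> =
      (\<Sum>j\<le>m. if Suc i \<le> j then cst (b i / w i) * (G a (m - j) * G b (j - Suc i)) else 0)"
    by (rule sum.cong) (auto simp: pderivat_G mult_ac)
  also have "\<dots> = (if Suc i \<le> m then cst (b i / w i) * (\<Sum>j\<le>m - Suc i. G a (m - Suc i - j) * G b j) else 0)"
    unfolding split by (auto simp: sum_distrib_left mult.assoc add.commute[of i] intro!: sum.cong)
  also have "(\<Sum>j\<le>m - Suc i. G a (m - Suc i - j) * G b j) = ?U (m - Suc i)"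
    by (rule sum.reindex_bij_witness[of _ "\<lambda>j. m - Suc i - j" "\<lambda>j. m - Suc i - j"])
       (auto intro!: arg_cong[of _ _ "\<lambda>j. _ * G b j"])
  finally have 2: "(\<Sum>j\<le>m. G a j * pderivat i (G b (m - j))) =
      (if Suc i \<le> m then cst (b i / w i) * ?U (m - Suc i) else 0)" .
  have "pderivat i (?U m) = (\<Sum>j\<le>m. pderivat i (G a j) * G b (m - j)) + (\<Sum>j\<le>m. G a j * pderivat i (G b (m - j)))"
    by (simp only: pderivat_sum pderivat_mult sum.distrib)
  also have "\<dots> = (if Suc i \<le> m then cst ((a i + b i) / w i) * ?U (m - Suc i) else 0)"
    unfolding 1 2 by (simp add: add_divide_distrib single_add distrib_right)
  finally show "pderivat i (?U m) = \<dots>" .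
qed

lemma G_scale: "cst (s ^ k) * G a k = G (\<lambda>i. s ^ Suc i * a i) k"
proof (rule poly_mapping_eqI)
  fix M
  have "(\<Prod>i\<in>#M. s ^ Suc i * a i) = s ^ wt M * (\<Prod>i\<in>#M. a i)"
  proof (induction M)
    case (add i M)
    show ?case unfolding image_mset_add_mset prod_mset.add_mset wt_simps add power_add
      by (simp only: mult_ac)
  qed simp
  then show "lk (cst (s ^ k) * G a k) M = lk (G (\<lambda>i. s ^ Suc i * a i) k) M"
    unfolding lookup_cst_mult lookup_G by auto
qed

end

section \<open>The Macdonald operator\<close>

text \<open>The coefficient of the product g_s in a lowering operator applied to g_r, where each
  shortened row costs one factor x (\<open>Bg_expansion\<close>). For lists of equal length the last
  equation concerns two empty lists.\<close>

fun Bcoef :: "'a::comm_ring_1 \<Rightarrow> nat list \<Rightarrow> nat list \<Rightarrow> 'a" where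
  "Bcoef x (n # r) (m # s) = (if m = n then 1 else if m < n then x else 0) * Bcoef x r s"
| "Bcoef x _ _ = 1"

text \<open>In the first summand the first row absorbs the raising factor and the later rows are
  only lowered. In the second one the first row is kept or lengthened, and the operator passes on to
  the later rows.\<close>

fun Ecoef :: "'a::comm_ring_1 \<Rightarrow> 'a \<Rightarrow> nat list \<Rightarrow> nat list \<Rightarrow> 'a" where
  "Ecoef x q (n # r) (m # s) = x * q ^ m * Bcoef x r s +
     (if m = n then 1 - x else if m > n then - x else 0) * Ecoef x q r s"
| "Ecoef x q _ _ = 1"

definition compositions :: "nat \<Rightarrow> nat \<Rightarrow> nat list set" where
  "compositions l s = {\<alpha>. length \<alpha> = l \<and> sum_list \<alpha> = s}"

lemma finite_compositions: "finite (compositions l s)"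
proof (rule finite_subset)
  show "compositions l s \<subseteq> {\<alpha>. set \<alpha> \<subseteq> {..s} \<and> length \<alpha> = l}"
    by (auto simp: compositions_def member_le_sum_list)
qed (simp add: finite_lists_length_eq)

lemma compositions_0: "compositions 0 s = (if s = 0 then {[]} else {})"
  by (auto simp: compositions_def)

lemma sum_compositions_Suc:
  "(\<Sum>\<alpha>\<in>compositions (Suc l) s. f \<alpha>) = (\<Sum>m\<le>s. \<Sum>\<alpha>\<in>compositions l (s - m). f (m # \<alpha>))"
proof -
  have "(\<Sum>\<alpha>\<in>compositions (Suc l) s. f \<alpha>) = (\<Sum>(m, \<alpha>)\<in>(SIGMA m:{..s}. compositions l (s - m)). f (m # \<alpha>))"
    by (rule sum.reindex_bij_witness[of _ "\<lambda>(m, \<alpha>). m # \<alpha>" "\<lambda>\<alpha>. (hd \<alpha>, tl \<alpha>)"])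
       (auto simp: compositions_def length_Suc_conv)
  also have "\<dots> = (\<Sum>m\<le>s. \<Sum>\<alpha>\<in>compositions l (s - m). f (m # \<alpha>))"
    by (rule sum.Sigma[symmetric]) (auto simp: finite_compositions)
  finally show ?thesis .
qed

text \<open>The constant term in z of P(z) times the series with coefficient \<open>c j\<close> at
  z^(-j); it stands in for Laurent series in the vertex operator.\<close>

definition pair_coeffs :: "(nat \<Rightarrow> 'b) \<Rightarrow> 'b::comm_ring_1 poly \<Rightarrow> 'b" where
  "pair_coeffs c P = (\<Sum>j\<le>degree P. c j * coeff P j)"

lemma pair_coeffs_eq: "degree P \<le> N \<Longrightarrow> pair_coeffs c P = (\<Sum>j\<le>N. c j * coeff P j)"
  unfolding pair_coeffs_def by (rule sum.mono_neutral_left) (auto simp: coeff_eq_0)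

lemma pair_coeffs_add: "pair_coeffs c (P + Q) = pair_coeffs c P + pair_coeffs c Q"
proof -
  let ?N = "max (degree P) (degree Q)"
  have "degree (P + Q) \<le> ?N" by (rule degree_add_le_max)
  then show ?thesis
    using pair_coeffs_eq[of P ?N c] pair_coeffs_eq[of Q ?N c] pair_coeffs_eq[of "P + Q" ?N c]
    by (simp add: distrib_left sum.distrib)
qed

lemma pair_coeffs_0 [simp]: "pair_coeffs c 0 = 0" by (simp add: pair_coeffs_def)

lemma pair_coeffs_monom_mult: "pair_coeffs c (monom a i * Q) = a * pair_coeffs (\<lambda>j. c (i + j)) Q"
proof -
  have "degree (monom a i * Q) \<le> i + degree Q"
    by (rule order_trans[OF degree_mult_le]) (simp add: degree_monom_le)
  then have "pair_coeffs c (monom a i * Q) = (\<Sum>j\<le>i + degree Q. c j * coeff (monom a i * Q) j)"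
    by (rule pair_coeffs_eq)
  also have "\<dots> = (\<Sum>j\<in>{i..i + degree Q}. c j * (a * coeff Q (j - i)))"
    by (rule sum.mono_neutral_cong_right) (auto simp: coeff_monom_mult)
  also have "\<dots> = (\<Sum>j\<le>degree Q. c (i + j) * (a * coeff Q j))"
    by (rule sum.reindex_bij_witness[of _ "\<lambda>j. i + j" "\<lambda>j. j - i"]) auto
  also have "\<dots> = a * pair_coeffs (\<lambda>j. c (i + j)) Q"
    by (simp add: pair_coeffs_def sum_distrib_left mult_ac)
  finally show ?thesis .
qed

lemma pair_coeffs_mult:
  assumes "degree P \<le> n"
  shows "pair_coeffs c (P * Q) = pair_coeffs (\<lambda>j. \<Sum>i\<le>n. coeff P i * c (i + j)) Q"
proof -
  have sum: "pair_coeffs c (sum F A) = (\<Sum>i\<in>A. pair_coeffs c (F i))" for F :: "nat \<Rightarrow> _" and A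
    by (induction A rule: infinite_finite_induct) (auto simp: pair_coeffs_add)
  have "P * Q = (\<Sum>i\<le>n. monom (coeff P i) i * Q)"
    using poly_as_sum_of_monoms'[OF assms] by (simp flip: sum_distrib_right)
  then have "pair_coeffs c (P * Q) = (\<Sum>i\<le>n. coeff P i * pair_coeffs (\<lambda>j. c (i + j)) Q)"
    by (simp add: sum pair_coeffs_monom_mult)
  also have "\<dots> = pair_coeffs (\<lambda>j. \<Sum>i\<le>n. coeff P i * c (i + j)) Q"
    unfolding pair_coeffs_def sum_distrib_left sum_distrib_right mult.assoc
    by (rule sum.swap)
  finally show ?thesis .
qed

definition mac_weight :: "'a::field_char_0 \<Rightarrow> 'a \<Rightarrow> nat \<Rightarrow> 'a" where
  "mac_weight q t i = of_nat (Suc i) * (1 - q ^ Suc i) / (1 - t ^ Suc i)"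

locale macdonald =
  fixes q t :: "'a::field_char_0"
  assumes q_nontriv: "q ^ Suc i \<noteq> 1" and t_nontriv: "t ^ Suc i \<noteq> 1" and t_nz: "t \<noteq> 0"

sublocale macdonald \<subseteq> sf_form "mac_weight q t"
proof
  fix i :: nat
  have "of_nat (Suc i) \<noteq> (0::'a)" by (rule of_nat_neq_0)
  then show "mac_weight q t i \<noteq> 0"
    using q_nontriv[of i] t_nontriv[of i] by (auto simp: mac_weight_def simp del: of_nat_Suc power_Suc)
qed

context macdonald
begin

abbreviation xt :: 'a where "xt \<equiv> 1 - 1 / t"

definition ma :: "nat \<Rightarrow> 'a" where "ma i = (1 / t) ^ Suc i * (q ^ Suc i - 1)"

definition g :: "nat \<Rightarrow> 'a sf" where "g = G (\<lambda>_. 1)"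

definition gprod :: "nat list \<Rightarrow> 'a sf" where "gprod r = prod_list (map g r)"

text \<open>The factor t^k cancels the powers of 1/t in \<open>ma\<close>, which leaves the
  exponential series with exponents q^r - 1 (\<open>h_eq\<close>).\<close>

definition h :: "nat \<Rightarrow> 'a sf" where "h k = cst (t ^ k) * G ma k"

lemma gprod_simps [simp]: "gprod [] = 1" "gprod (n # r) = g n * gprod r"
  by (simp_all add: gprod_def)

lemma g_0 [simp]: "g 0 = 1" by (simp add: g_def)

text \<open>The generating series is exp (sum of (1 - t^(-r)) z^r / r) = (1 - z/t) / (1 - z), and
  all coefficients after the constant one are 1 - 1/t. Hence a shortened row costs the same however
  many boxes it loses.\<close>

lemma \<theta>_ma: "0 < k \<Longrightarrow> \<theta> ma (\<lambda>_. 1) k = xt"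
proof (induction k rule: less_induct)
  case (less k)
  have fac: "of_nat (Suc i) * ma i * 1 / mac_weight q t i = 1 - (1 / t) ^ Suc i" for i
  proof -
    have "of_nat (Suc i) \<noteq> (0::'a)" by (rule of_nat_neq_0)
    moreover have "(1 / t) ^ Suc i * t ^ Suc i = 1"
      using t_nz by (simp add: power_divide del: power_Suc)
    ultimately show ?thesis using q_nontriv[of i] t_nontriv[of i]
      by (simp add: ma_def mac_weight_def field_simps del: of_nat_Suc power_Suc power_divide power_one_over)
  qed
  obtain k' where k': "k = Suc k'" using less.prems by (cases k) auto
  have "of_nat k * \<theta> ma (\<lambda>_. 1) k = (\<Sum>i<k. (1 - (1 / t) ^ Suc i) * \<theta> ma (\<lambda>_. 1) (k - Suc i))"
    by (simp only: \<theta>_rec fac)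
  also have "\<dots> = (\<Sum>i<k'. (1 - (1 / t) ^ Suc i) * xt) + (1 - (1 / t) ^ k)"
    unfolding k' sum.lessThan_Suc using less.IH by (simp add: k' del: power_Suc)
  also have "(\<Sum>i<k'. (1 - (1 / t) ^ Suc i) * xt) = of_nat k' * xt - (1 / t - (1 / t) ^ k)"
  proof -
    have "(\<Sum>i<m. (1 - u ^ Suc i) * (1 - u)) = of_nat m * (1 - u) - (u - u ^ Suc m)" for m and u :: 'a
      by (induction m) (simp_all add: algebra_simps)
    then show ?thesis unfolding k' .
  qed
  finally have "of_nat k * \<theta> ma (\<lambda>_. 1) k = of_nat k * xt"
    by (simp add: k' algebra_simps)
  moreover have "of_nat k \<noteq> (0::'a)" using less.prems by simp
  ultimately show ?case by (metis mult_left_cancel)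
qed

lemma B_g: "B ma k (g n) = (if k = 0 then g n else if k \<le> n then cst xt * g (n - k) else 0)"
  unfolding g_def B_G by (auto simp: \<theta>_ma)

lemma h_eq: "h k = G (\<lambda>i. q ^ Suc i - 1) k"
proof -
  have "(\<lambda>i. t ^ Suc i * ma i) = (\<lambda>i. q ^ Suc i - 1)"
    using t_nz by (auto simp: ma_def power_divide simp del: power_Suc)
  then show ?thesis unfolding h_def G_scale by simp
qed

lemma h_0 [simp]: "h 0 = 1" by (simp add: h_eq)

text \<open>The exponents q^r - 1 of \<open>h\<close> and 1 of \<open>g\<close> add up to q^r, which
  only rescales z by q. The powers q^m in the matrix of the operator originate here.\<close>

lemma h_g_convolution: "(\<Sum>j\<le>m. h j * g (m - j)) = cst (q ^ m) * g m"
  unfolding h_eq g_def G_convolution G_scale by simp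

lemma B_gprod_eq_0: "sum_list r < k \<Longrightarrow> B ma k (gprod r) = 0"
proof (induction r arbitrary: k)
  case Nil
  then show ?case using B_cst[of ma k 1] by simp
next
  case (Cons n r)
  have "B ma i (g n) * B ma (k - i) (gprod r) = 0" if "i \<le> k" for i
    using Cons that by (cases "i \<le> n") (auto simp: B_g)
  then show ?case by (simp add: B_mult)
qed

text \<open>Indexed by the degree \<open>u\<close> that remains, so that it matches sums over
  compositions of \<open>u\<close>. The case distinction keeps the truncated difference from
  producing the operator of index 0.\<close>

definition Bg :: "nat list \<Rightarrow> nat \<Rightarrow> 'a sf" where
  "Bg r u = (if u \<le> sum_list r then B ma (sum_list r - u) (gprod r) else 0)"

lemma Bg_Cons:
  "Bg (n # r) u = (\<Sum>m\<le>u. cst (if m = n then 1 else if m < n then xt else 0) * g m * Bg r (u - m))"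
proof -
  define F where "F m = cst (if m = n then 1 else if m < n then xt else 0) * g m * Bg r (u - m)" for m
  let ?k = "n + sum_list r - u"
  show ?thesis
  proof (cases "u \<le> n + sum_list r")
    case True
    have "Bg (n # r) u = (\<Sum>i\<le>?k. B ma i (g n) * B ma (?k - i) (gprod r))"
      using True by (simp add: Bg_def B_mult)
    also have "\<dots> = (\<Sum>i\<in>{i. i \<le> ?k \<and> i \<le> n \<and> n - i \<le> u}. F (n - i))"
    proof (rule sum.mono_neutral_cong_right)
      show "\<forall>i\<in>{..?k} - {i. i \<le> ?k \<and> i \<le> n \<and> n - i \<le> u}. B ma i (g n) * B ma (?k - i) (gprod r) = 0"
      proof
        fix i assume i: "i \<in> {..?k} - {i. i \<le> ?k \<and> i \<le> n \<and> n - i \<le> u}"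
        show "B ma i (g n) * B ma (?k - i) (gprod r) = 0"
        proof (cases "i \<le> n")
          case True
          then have "sum_list r < ?k - i" using i by auto
          then show ?thesis by (simp add: B_gprod_eq_0)
        qed (simp add: B_g)
      qed
      fix i assume i: "i \<in> {i. i \<le> ?k \<and> i \<le> n \<and> n - i \<le> u}"
      then have "?k - i = sum_list r - (u - (n - i))" "u - (n - i) \<le> sum_list r" using True by auto
      then show "B ma i (g n) * B ma (?k - i) (gprod r) = F (n - i)"
        using i by (auto simp: B_g F_def Bg_def)
    qed auto
    also have "\<dots> = (\<Sum>m\<in>{m. m \<le> u \<and> m \<le> n \<and> n - m \<le> ?k}. F m)"
      by (rule sum.reindex_bij_witness[of _ "\<lambda>m. n - m" "\<lambda>m. n - m"]) auto
    also have "\<dots> = (\<Sum>m\<le>u. F m)"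
      by (rule sum.mono_neutral_left) (use True in \<open>auto simp: F_def Bg_def\<close>)
    finally show ?thesis by (simp add: F_def)
  next
    case False
    then have "(\<Sum>m\<le>u. F m) = 0" by (auto simp: F_def Bg_def intro!: sum.neutral)
    then show ?thesis using False by (simp add: Bg_def F_def)
  qed
qed

lemma Bg_expansion:
  "(\<Sum>\<alpha>\<in>compositions (length r) u. cst (Bcoef xt r \<alpha>) * gprod \<alpha>) = Bg r u"
proof (induction r arbitrary: u)
  case Nil
  then show ?case using B_cst[of ma 0 1] by (simp add: compositions_0 Bg_def)
next
  case (Cons n r)
  have "(\<Sum>\<alpha>\<in>compositions (length (n # r)) u. cst (Bcoef xt (n # r) \<alpha>) * gprod \<alpha>) =
    (\<Sum>m\<le>u. \<Sum>\<alpha>\<in>compositions (length r) (u - m).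
      (cst (if m = n then 1 else if m < n then xt else 0) * g m) * (cst (Bcoef xt r \<alpha>) * gprod \<alpha>))"
    unfolding list.size(4) add_Suc_right add_0_right sum_compositions_Suc
    by (intro sum.cong refl) (simp only: Bcoef.simps gprod_simps cst_mult mult_ac)
  also have "\<dots> = Bg (n # r) u"
    unfolding Bg_Cons by (simp only: sum_distrib_left[symmetric] Cons)
  finally show ?case .
qed

definition hshift :: "nat \<Rightarrow> nat \<Rightarrow> 'a sf" where "hshift d j = (if d \<le> j then h (j - d) else 0)"

text \<open>For \<open>d = 0\<close> this is the Macdonald operator; the other modes of the vertex operator are needed
  for the recursion over a product of \<open>g\<close>'s.\<close>

definition Emode :: "nat \<Rightarrow> 'a sf \<Rightarrow> 'a sf" where
  "Emode d f = pair_coeffs (hshift d) (shift_hom ma f)"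

lemma Emode_0_selfadjoint: "ip (Emode 0 f) u = ip f (Emode 0 u)"
proof -
  let ?N = "max (degree (shift_hom ma f)) (degree (shift_hom ma u))"
  have E: "Emode 0 v = (\<Sum>j\<le>?N. cst (t ^ j) * (G ma j * B ma j v))"
    if "degree (shift_hom ma v) \<le> ?N" for v
    unfolding Emode_def pair_coeffs_eq[OF that] by (simp add: hshift_def h_def B_def mult.assoc)
  have "ip (Emode 0 f) u = (\<Sum>j\<le>?N. t ^ j * ip (B ma j f) (B ma j u))"
    by (simp add: E ip_sum_left ip_cst_mult_left G_adjoint)
  also have "\<dots> = ip (Emode 0 u) f"
    by (simp add: E ip_sum_left ip_cst_mult_left G_adjoint ip_commute[of "B ma _ f"])
  also have "\<dots> = ip f (Emode 0 u)" by (rule ip_commute)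
  finally show ?thesis .
qed

text \<open>The effect of one factor g_n. For e = j - d the products g_(n-i) h_(e+i) with i <= n are
  part of the convolution that sums to q^(n+e) g_(n+e). The missing terms have a factor g_(n+k) with
  k > 0 and become the moves that lengthen the row.\<close>

lemma hshift_recursion:
  "(\<Sum>i\<le>n. B ma i (g n) * hshift d (i + j)) =
    (if d \<le> j + n then cst (xt * q ^ (j + n - d)) * g (j + n - d) else 0) +
    (if d \<le> j then cst (1 - xt) * (g n * h (j - d)) -
       (\<Sum>k\<in>{1..j - d}. cst xt * (g (n + k) * h (j - d - k))) else 0)"
proof (cases "d \<le> j")
  case True
  define e where "e = j - d"
  have "(\<Sum>i\<le>n. B ma i (g n) * hshift d (i + j)) = (\<Sum>i\<le>n. B ma i (g n) * h (e + i))"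
    by (rule sum.cong) (use True in \<open>auto simp: hshift_def e_def add.commute\<close>)
  also have "\<dots> = g n * h e + (\<Sum>i\<in>{1..n}. B ma i (g n) * h (e + i))"
    unfolding atMost_atLeast0 by (subst sum.atLeast_Suc_atMost) (auto simp: B_g)
  also have "(\<Sum>i\<in>{1..n}. B ma i (g n) * h (e + i)) = cst xt * (\<Sum>i\<in>{1..n}. g (n - i) * h (e + i))"
    unfolding sum_distrib_left by (rule sum.cong) (auto simp: B_g mult.assoc)
  also have "(\<Sum>i\<in>{1..n}. g (n - i) * h (e + i)) =
     cst (q ^ (n + e)) * g (n + e) - g n * h e - (\<Sum>k\<in>{1..e}. g (n + k) * h (e - k))"
  proof -
    have "cst (q ^ (n + e)) * g (n + e) = (\<Sum>i\<le>n + e. h i * g (n + e - i))"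
      by (rule h_g_convolution[symmetric])
    also have "\<dots> = (\<Sum>i<e. h i * g (n + e - i)) + (\<Sum>i\<in>{e..n + e}. h i * g (n + e - i))"
    proof -
      have "{..n + e} = {..<e} \<union> {e..n + e}" by auto
      moreover have "{..<e} \<inter> {e..n + e} = {}" by auto
      ultimately show ?thesis by (simp add: sum.union_disjoint del: ivl_disj_un)
    qed
    also have "(\<Sum>i\<in>{e..n + e}. h i * g (n + e - i)) = h e * g n + (\<Sum>i\<in>{Suc e..n + e}. h i * g (n + e - i))"
      by (subst sum.atLeast_Suc_atMost) auto
    also have "(\<Sum>i\<in>{Suc e..n + e}. h i * g (n + e - i)) = (\<Sum>i\<in>{1..n}. g (n - i) * h (e + i))"
      by (rule sum.reindex_bij_witness[of _ "\<lambda>i. e + i" "\<lambda>i. i - e"]) (auto simp: mult.commute)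
    also have "(\<Sum>i<e. h i * g (n + e - i)) = (\<Sum>k\<in>{1..e}. g (n + k) * h (e - k))"
      by (rule sum.reindex_bij_witness[of _ "\<lambda>k. e - k" "\<lambda>i. e - i"]) (auto simp: mult.commute)
    finally show ?thesis by (simp add: algebra_simps)
  qed
  finally have "(\<Sum>i\<le>n. B ma i (g n) * hshift d (i + j)) = g n * h e +
     cst xt * (cst (q ^ (n + e)) * g (n + e) - g n * h e - (\<Sum>k\<in>{1..e}. g (n + k) * h (e - k)))" .
  also have "\<dots> = cst (xt * q ^ (n + e)) * g (n + e) + (cst (1 - xt) * (g n * h e) -
       (\<Sum>k\<in>{1..e}. cst xt * (g (n + k) * h (e - k))))"
    unfolding sum_distrib_left[symmetric] cst_mult single_diff[of _ 1] cst_one by (simp add: algebra_simps)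
  finally show ?thesis using True by (simp add: e_def add.commute[of n])
next
  case False
  \<comment> \<open>Here the convolution is complete and nothing is subtracted: the row is not
    lengthened.\<close>
  define e where "e = d - j"
  have "(\<Sum>i\<le>n. B ma i (g n) * hshift d (i + j)) =
      (\<Sum>i\<in>{e..n}. cst xt * (h (i - e) * g (n - i)))"
    by (rule sum.mono_neutral_cong_right) (use False in \<open>auto simp: hshift_def e_def B_g mult_ac diff_diff_right\<close>)
  also have "\<dots> = (if e \<le> n then cst (xt * q ^ (n - e)) * g (n - e) else 0)"
  proof (cases "e \<le> n")
    case True
    have "(\<Sum>i\<in>{e..n}. cst xt * (h (i - e) * g (n - i))) = (\<Sum>i\<le>n - e. cst xt * (h i * g (n - e - i)))"
      by (rule sum.reindex_bij_witness[of _ "\<lambda>i. e + i" "\<lambda>i. i - e"]) (use True in auto)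
    also have "\<dots> = cst xt * (cst (q ^ (n - e)) * g (n - e))"
      by (simp only: sum_distrib_left[symmetric] h_g_convolution)
    finally show ?thesis using True by (simp add: cst_mult mult.assoc)
  qed simp
  also have "n - e = j + n - d" using False by (auto simp: e_def)
  also have "e \<le> n \<longleftrightarrow> d \<le> j + n" using False by (auto simp: e_def)
  finally show ?thesis using False by simp
qed

lemma degree_shift_hom_gprod: "degree (shift_hom ma (gprod r)) \<le> sum_list r"
  by (rule degree_le) (use B_gprod_eq_0 in \<open>auto simp: B_def\<close>)

lemma Emode_expansion:
  "s \<le> sum_list r \<Longrightarrow>
    (\<Sum>\<alpha>\<in>compositions (length r) s. cst (Ecoef xt q r \<alpha>) * gprod \<alpha>) = Emode (sum_list r - s) (gprod r)"
proof (induction r arbitrary: s)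
  case Nil
  have "shift_hom ma (1 :: 'a sf) = 1" using shift_hom_single[of ma "{#}" 1] by simp
  then show ?case using Nil by (simp add: compositions_0 Emode_def pair_coeffs_def hshift_def)
next
  case (Cons n r)
  define N where "N = sum_list r"
  define f where "f = gprod r"
  define d where "d = n + N - s"
  have s: "s + d = n + N" using Cons.prems by (simp add: d_def N_def)
  have Em: "Emode e f = (\<Sum>j\<le>N. hshift e j * B ma j f)" for e
    unfolding Emode_def B_def by (rule pair_coeffs_eq) (simp add: f_def N_def degree_shift_hom_gprod)
  have "Emode d (g n * f) = pair_coeffs (\<lambda>j. \<Sum>i\<le>n. B ma i (g n) * hshift d (i + j)) (shift_hom ma f)"
    unfolding Emode_def shift_hom_mult B_def
    by (rule pair_coeffs_mult) (use degree_shift_hom_gprod[of "[n]"] in simp)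
  also have "\<dots> = (\<Sum>j\<le>N. (\<Sum>i\<le>n. B ma i (g n) * hshift d (i + j)) * B ma j f)"
    unfolding B_def by (rule pair_coeffs_eq) (simp add: f_def N_def degree_shift_hom_gprod)
  also have "\<dots> = (\<Sum>j\<le>N. (if d \<le> j + n then cst (xt * q ^ (j + n - d)) * g (j + n - d) else 0) * B ma j f) +
    (\<Sum>j\<le>N. (if d \<le> j then cst (1 - xt) * (g n * h (j - d)) -
       (\<Sum>k\<in>{1..j - d}. cst xt * (g (n + k) * h (j - d - k))) else 0) * B ma j f)"
    by (simp only: hshift_recursion distrib_right sum.distrib)
  also have "(\<Sum>j\<le>N. (if d \<le> j + n then cst (xt * q ^ (j + n - d)) * g (j + n - d) else 0) * B ma j f) =
     (\<Sum>m\<le>s. cst (xt * q ^ m) * g m * Bg r (s - m))"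
  proof -
    have "(\<Sum>j\<le>N. (if d \<le> j + n then cst (xt * q ^ (j + n - d)) * g (j + n - d) else 0) * B ma j f) =
      (\<Sum>j\<in>{j. j \<le> N \<and> d \<le> j + n}. cst (xt * q ^ (j + n - d)) * g (j + n - d) * B ma j f)"
      by (rule sum.mono_neutral_cong_right) auto
    \<comment> \<open>The new length of the first row is m = j + n - d, and then
      \<open>N - (s - m)\<close> equals j.\<close>
    also have "\<dots> = (\<Sum>m\<in>{m. m \<le> s \<and> s - m \<le> N}. cst (xt * q ^ m) * g m * B ma (N - (s - m)) f)"
      by (rule sum.reindex_bij_witness[of _ "\<lambda>m. N - (s - m)" "\<lambda>j. j + n - d"]) (use s in auto)
    also have "\<dots> = (\<Sum>m\<le>s. cst (xt * q ^ m) * g m * Bg r (s - m))"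
      by (rule sum.mono_neutral_cong_left) (auto simp: Bg_def N_def f_def)
    finally show ?thesis .
  qed
  also have "(\<Sum>j\<le>N. (if d \<le> j then cst (1 - xt) * (g n * h (j - d)) -
       (\<Sum>k\<in>{1..j - d}. cst xt * (g (n + k) * h (j - d - k))) else 0) * B ma j f) =
     (\<Sum>m\<in>{n..s}. cst (if m = n then 1 - xt else - xt) * g m * Emode (N - (s - m)) f)"
  proof -
    have inner: "(if d \<le> j then cst (1 - xt) * (g n * h (j - d)) -
       (\<Sum>k\<in>{1..j - d}. cst xt * (g (n + k) * h (j - d - k))) else 0) =
       (\<Sum>m\<in>{n..s}. cst (if m = n then 1 - xt else - xt) * g m * hshift (N - (s - m)) j)"
      if j: "j \<le> N" for j
    proof (cases "d \<le> j")
      case True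
      then have ns: "n \<le> s" using s j by simp
      then have nd: "N - (s - n) = d" using s by simp
      have "(\<Sum>m\<in>{n..s}. cst (if m = n then 1 - xt else - xt) * g m * hshift (N - (s - m)) j) =
        cst (1 - xt) * g n * h (j - d) + (\<Sum>m\<in>{Suc n..s}. cst (- xt) * g m * hshift (N - (s - m)) j)"
        using ns True by (subst sum.atLeast_Suc_atMost) (auto simp: hshift_def nd)
      also have "(\<Sum>m\<in>{Suc n..s}. cst (- xt) * g m * hshift (N - (s - m)) j) =
        (\<Sum>k\<in>{1..j - d}. cst (- xt) * g (n + k) * h (j - d - k))"
      proof (rule sum.mono_neutral_cong_right[where S = "(+) n ` {1..j - d}", THEN trans])
        show "finite {Suc n..s}" by simp
        show "(+) n ` {1..j - d} \<subseteq> {Suc n..s}" using s j True by auto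
        show "\<forall>i\<in>{Suc n..s} - (+) n ` {1..j - d}. cst (- xt) * g i * hshift (N - (s - i)) j = 0"
        proof
          fix i assume i: "i \<in> {Suc n..s} - (+) n ` {1..j - d}"
          have "\<not> N - (s - i) \<le> j"
          proof
            assume "N - (s - i) \<le> j"
            then have "i = n + (i - n)" "i - n \<in> {1..j - d}" using i s by auto
            then show False using i by blast
          qed
          then show "cst (- xt) * g i * hshift (N - (s - i)) j = 0" by (simp add: hshift_def)
        qed
        show "cst (- xt) * g i * hshift (N - (s - i)) j = cst (- xt) * g i * h (j - (N - (s - i)))"
          if "i \<in> (+) n ` {1..j - d}" for i using that s j True by (auto simp: hshift_def)
        show "(\<Sum>i\<in>(+) n ` {1..j - d}. cst (- xt) * g i * h (j - (N - (s - i)))) =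
          (\<Sum>k\<in>{1..j - d}. cst (- xt) * g (n + k) * h (j - d - k))"
        proof -
          have "N - (s - (n + k)) = d + k" if "k \<in> {1..j - d}" for k
            using that s j True by auto
          then show ?thesis by (subst sum.reindex) (auto intro!: sum.cong)
        qed
      qed
      finally have calc: "(\<Sum>m\<in>{n..s}. cst (if m = n then 1 - xt else - xt) * g m * hshift (N - (s - m)) j) =
        cst (1 - xt) * g n * h (j - d) + (\<Sum>k\<in>{1..j - d}. cst (- xt) * g (n + k) * h (j - d - k))" .
      have neg: "cst (- xt) = - cst xt" by (rule single_uminus)
      show ?thesis unfolding calc neg using True by (simp add: sum_negf mult.assoc)
    next
      case False
      then have "hshift (N - (s - m)) j = 0" if "m \<in> {n..s}" for m
        using that s by (auto simp: hshift_def)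
      then show ?thesis using False by simp
    qed
    show ?thesis unfolding Em
      by (simp add: inner sum_distrib_right sum_distrib_left mult.assoc) (rule sum.swap)
  qed
  finally have RHS: "Emode d (g n * f) = (\<Sum>m\<le>s. cst (xt * q ^ m) * g m * Bg r (s - m)) +
    (\<Sum>m\<in>{n..s}. cst (if m = n then 1 - xt else - xt) * g m * Emode (N - (s - m)) f)" .
  have "(\<Sum>\<alpha>\<in>compositions (length (n # r)) s. cst (Ecoef xt q (n # r) \<alpha>) * gprod \<alpha>) =
    (\<Sum>m\<le>s. cst (xt * q ^ m) * g m * (\<Sum>\<alpha>\<in>compositions (length r) (s - m). cst (Bcoef xt r \<alpha>) * gprod \<alpha>)) +
    (\<Sum>m\<le>s. cst (if m = n then 1 - xt else if m > n then - xt else 0) * g m *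
       (\<Sum>\<alpha>\<in>compositions (length r) (s - m). cst (Ecoef xt q r \<alpha>) * gprod \<alpha>))"
    unfolding list.size(4) add_Suc_right add_0_right sum_compositions_Suc sum_distrib_left sum.distrib[symmetric]
    by (intro sum.cong refl) (simp only: Ecoef.simps gprod_simps cst_mult single_add distrib_right distrib_left mult_ac)
  also have "(\<Sum>m\<le>s. cst (if m = n then 1 - xt else if m > n then - xt else 0) * g m *
       (\<Sum>\<alpha>\<in>compositions (length r) (s - m). cst (Ecoef xt q r \<alpha>) * gprod \<alpha>)) =
     (\<Sum>m\<in>{n..s}. cst (if m = n then 1 - xt else - xt) * g m * Emode (N - (s - m)) f)"
  proof (rule sum.mono_neutral_cong_right)
    fix m assume "m \<in> {n..s}"
    then have "s - m \<le> sum_list r" using s by (auto simp: N_def)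
    from Cons.IH[OF this]
    show "cst (if m = n then 1 - xt else if m > n then - xt else 0) * g m *
       (\<Sum>\<alpha>\<in>compositions (length r) (s - m). cst (Ecoef xt q r \<alpha>) * gprod \<alpha>) =
       cst (if m = n then 1 - xt else - xt) * g m * Emode (N - (s - m)) f"
      using \<open>m \<in> {n..s}\<close> by (auto simp: N_def f_def)
  qed auto
  finally show ?case unfolding Bg_expansion using RHS by (simp add: d_def f_def N_def)
qed

lemma Emode_gprod:
  "Emode 0 (gprod r) = (\<Sum>\<alpha>\<in>compositions (length r) (sum_list r). cst (Ecoef xt q r \<alpha>) * gprod \<alpha>)"
  using Emode_expansion[of "sum_list r" r] by simp

end

section \<open>Triangularity and the coefficients of the Macdonald polynomials\<close>

definition qnum :: "'a::comm_ring_1 \<Rightarrow> nat \<Rightarrow> 'a" where "qnum q m = (\<Sum>i<m. q ^ i)"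

lemma qnum_mult: "(1 - q) * qnum q m = 1 - q ^ m"
  unfolding qnum_def by (induction m) (simp_all add: distrib_left, simp add: algebra_simps)

text \<open>The quotient of \<open>Bcoef - Ecoef\<close> by (1 - q) x, written so that it still
  makes sense for q = 1 or x = 0.\<close>

fun Tcoef :: "'a::comm_ring_1 \<Rightarrow> 'a \<Rightarrow> nat list \<Rightarrow> nat list \<Rightarrow> 'a" where
  "Tcoef x q (n # r) (m # s) = qnum q m * Bcoef x r s +
     (if m = n then 1 - x else if m > n then - x else 0) * Tcoef x q r s"
| "Tcoef x q _ _ = 0"

text \<open>At \<open>q = 1\<close> the matrices \<open>Ecoef\<close> and \<open>Bcoef\<close> agree, so their difference is divisible by \<open>1 - q\<close>.\<close>

lemma Ecoef_eq_Tcoef: "Ecoef x q r s = Bcoef x r s - (1 - q) * x * Tcoef x q r s"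
proof (induction x q r s rule: Ecoef.induct)
  case (1 x q n r m s)
  let ?y = "if m = n then 1 - x else if m > n then - x else 0"
  have q: "q ^ m = 1 - (1 - q) * qnum q m" by (simp add: qnum_mult)
  \<comment> \<open>For q = 1 the two weights merge: \<open>x + ?y\<close> is 1, 0 or x as m = n, m
    > n or m < n.\<close>
  have "Bcoef x (n # r) (m # s) = (x + ?y) * Bcoef x r s" by simp
  then show ?case unfolding Ecoef.simps Tcoef.simps 1 q by (simp add: algebra_simps)
qed auto

text \<open>Rows can only shrink. The last claim says, without subtraction, that the first k rows
  lose at most what all rows lose together.\<close>

lemma Bcoef_nonzero:
  assumes "length r = length s" "Bcoef x r s \<noteq> 0"
  shows "sum_list s \<le> sum_list r" "sum_list s = sum_list r \<Longrightarrow> s = r"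
    "sum_list (take k r) + sum_list s \<le> sum_list (take k s) + sum_list r"
  using assms
proof (induction r s arbitrary: k rule: list_induct2)
  case (Cons n r m s)
  have *: "m \<le> n" "Bcoef x r s \<noteq> 0" if "Bcoef x (n # r) (m # s) \<noteq> 0"
    using that by (auto split: if_splits)
  { case 1 then show ?case using *[OF 1] Cons.IH(1)[OF *(2)[OF 1]] by simp }
  { case 2 then show ?case using *[OF 2(2)] Cons.IH(1)[OF *(2)[OF 2(2)]] Cons.IH(2)[OF _ *(2)[OF 2(2)]] 2(1) by simp }
  { case 3 then show ?case using *[OF 3] Cons.IH(1)[OF *(2)[OF 3]] Cons.IH(3)[OF *(2)[OF 3]]
      by (cases k) simp_all }
qed auto

lemma Bcoef_off_diagonal:
  "length r = length s \<Longrightarrow> sum_list r \<le> sum_list s \<Longrightarrow> r \<noteq> s \<Longrightarrow> Bcoef x r s = 0"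
  using Bcoef_nonzero(1,2)[of r s x] by force

text \<open>A move keeps or lengthens an initial run of rows, changes one row at will and shortens
  later ones. So the first k rows lose no more than the whole list; for equal totals they lose
  nothing, which is dominance.\<close>

lemma Tcoef_nonzero:
  assumes "length r = length s" "sum_list s \<le> sum_list r" "Tcoef x q r s \<noteq> 0"
  shows "sum_list (take k r) + sum_list s \<le> sum_list (take k s) + sum_list r"
  using assms
proof (induction r s arbitrary: k rule: list_induct2)
  case (Cons n r m s)
  show ?case
  proof (cases k)
    case 0
    then show ?thesis using Cons by simp
  next
    case (Suc k')
    have "Bcoef x r s \<noteq> 0 \<or> n \<le> m \<and> Tcoef x q r s \<noteq> 0"
      using Cons.prems(2) by (cases "Bcoef x r s = 0"; cases "Tcoef x q r s = 0") (auto split: if_splits)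
    then consider "Bcoef x r s \<noteq> 0" | "n \<le> m" "Tcoef x q r s \<noteq> 0" by blast
    then show ?thesis
    proof cases
      case 1
      then show ?thesis using Bcoef_nonzero(3)[OF Cons.hyps 1, of k'] Suc by simp
    next
      case 2
      then show ?thesis using Cons.IH[of k'] Cons.prems Suc by simp
    qed
  qed
qed simp

definition rowlist :: "nat \<Rightarrow> expo \<Rightarrow> nat list" where "rowlist N \<alpha> = map (lk \<alpha>) [0..<N]"

lemma length_rowlist [simp]: "length (rowlist N \<alpha>) = N" by (simp add: rowlist_def)

lemma sum_list_take: "sum_list (take k s) = (\<Sum>i<min k (length s). s ! i)"
  by (simp add: sum_list_sum_nth atLeast0LessThan min.commute)

lemma sum_take_rowlist: "sum_list (take k (rowlist N \<alpha>)) = psum \<alpha> (min k N)"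
  unfolding sum_list_take psum_def by (auto simp: rowlist_def intro!: sum.cong)

lemma sum_rowlist: "sum_list (rowlist N \<alpha>) = psum \<alpha> N"
  using sum_take_rowlist[of N N \<alpha>] by simp

lemma psum_nth: "psum (Poly_Mapping.nth s) k = sum_list (take k s)"
proof -
  have "psum (Poly_Mapping.nth s) k = (\<Sum>i<k. if i < length s then s ! i else 0)"
    unfolding psum_def lookup_nth_list ..
  also have "\<dots> = (\<Sum>i<min k (length s). s ! i)"
    by (rule sum.mono_neutral_cong_right) auto
  finally show ?thesis by (simp add: sum_list_take)
qed

lemma keys_nth_subset: "Poly_Mapping.keys (Poly_Mapping.nth s) \<subseteq> {..<length s}"
  by (auto simp: in_keys_iff lookup_nth_list simp del: lookup_nth keys_nth split: if_splits)

lemma psize_nth: "psize (Poly_Mapping.nth s) = sum_list s"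
  using psize_eq[OF keys_nth_subset, of s] by (simp add: psum_nth)

lemma rowlist_nth: "length s = N \<Longrightarrow> rowlist N (Poly_Mapping.nth s) = s"
  by (rule nth_equalityI) (auto simp: rowlist_def lookup_nth_list simp del: lookup_nth)

lemma nth_rowlist: "Poly_Mapping.keys \<alpha> \<subseteq> {..<N} \<Longrightarrow> Poly_Mapping.nth (rowlist N \<alpha>) = \<alpha>"
  by (rule poly_mapping_eqI) (auto simp: rowlist_def lookup_nth_list in_keys_iff simp del: lookup_nth)

lemma partition_keys_psize: "is_partition mu \<Longrightarrow> psize mu \<le> N \<Longrightarrow> Poly_Mapping.keys mu \<subseteq> {..<N}"
  using partition_keys[of mu] plength_le_psize[of mu] by auto

lemma rowlist_compositions: "is_partition mu \<Longrightarrow> rowlist (psize mu) mu \<in> compositions (psize mu) (psize mu)"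
  by (simp add: compositions_def sum_rowlist psum_eq_psize)

lemma Tcoef_dominance:
  assumes mu: "is_partition mu" "psize mu = N" and s: "s \<in> compositions N N" "s \<noteq> rowlist N mu"
    and nz: "Tcoef x q (rowlist N mu) s \<noteq> 0"
  shows "mu \<prec>D srt (Poly_Mapping.nth s)"
proof -
  have len: "length s = N" and sum: "sum_list s = N" using s by (auto simp: compositions_def)
  have sumv: "sum_list (rowlist N mu) = N" using mu by (simp add: sum_rowlist psum_eq_psize)
  have keys: "Poly_Mapping.keys mu \<subseteq> {..<N}" using mu by (simp add: partition_keys_psize)
  have *: "psum mu (min k N) \<le> psum (Poly_Mapping.nth s) k" for k
    using Tcoef_nonzero[of "rowlist N mu" s x q k] nz len sum sumv by (simp add: sum_take_rowlist psum_nth)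
  have "psum mu k \<le> psum (Poly_Mapping.nth s) k" for k
  proof (cases "k \<le> N")
    case True
    then show ?thesis using *[of k] by (simp add: min_def)
  next
    case False
    then have "psum mu k = psum mu (min k N)" using mu by (simp add: psum_eq_psize)
    then show ?thesis using * by metis
  qed
  then have dom: "mu \<preceq>D Poly_Mapping.nth s"
    using mu sum by (simp add: dominated_psum psize_nth)
  moreover have "mu \<noteq> srt (Poly_Mapping.nth s)"
  proof
    assume "mu = srt (Poly_Mapping.nth s)"
    \<comment> \<open>The unsorted vector is squeezed between \<open>mu\<close> and its own sorted
      form.\<close>
    then have "mu = Poly_Mapping.nth s" using dominated_antisym[OF dom] dominated_srt by metis
    then show False using s(2) len rowlist_nth by metis
  qed
  ultimately show ?thesis
    using dominated_trans[OF dom dominated_srt] by (simp add: strictly_dominated_def)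
qed

text \<open>The coefficient of \<open>m\<^sub>\<mu>\<close> in \<open>P\<^sub>\<lambda>\<close>, obtained by solving the triangular eigenvector equation
  for the operator with matrix \<open>Tcoef\<close>.\<close>

function mac_coef :: "'a::field \<Rightarrow> 'a \<Rightarrow> expo \<Rightarrow> expo \<Rightarrow> 'a" where
  "mac_coef x q lam mu = (if mu = lam then 1 else if is_partition mu \<and> mu \<preceq>D lam then
     (\<Sum>s\<in>{s \<in> compositions (psize lam) (psize lam). mu \<prec>D srt (Poly_Mapping.nth s)}.
        Tcoef x q (rowlist (psize lam) mu) s * mac_coef x q lam (srt (Poly_Mapping.nth s))) /
     (Tcoef x q (rowlist (psize lam) lam) (rowlist (psize lam) lam) -
      Tcoef x q (rowlist (psize lam) mu) (rowlist (psize lam) mu))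
   else 0)"
  by auto
termination
\<comment> \<open>Each call climbs strictly in dominance, and \<open>dom_rank\<close> is bounded in
  terms of the size.\<close>
proof (relation "Wellfounded.measure (\<lambda>(x, q, lam, mu). Suc (psize lam) * psize lam - dom_rank mu)")
  fix x q :: 'a and lam mu s
  assume a: "is_partition mu \<and> mu \<preceq>D lam"
    "s \<in> {s \<in> compositions (psize lam) (psize lam). mu \<prec>D srt (Poly_Mapping.nth s)}"
  let ?nu = "srt (Poly_Mapping.nth s)"
  have "psize ?nu = psize lam" using a(2) by (auto simp: psize_srt psize_nth compositions_def)
  then have "dom_rank ?nu \<le> Suc (psize lam) * psize lam" using dom_rank_le[of ?nu] by simp
  moreover have "dom_rank mu < dom_rank ?nu" using a srt(1) by (intro dom_rank_less) auto
  ultimately show "((x, q, lam, ?nu), (x, q, lam, mu)) \<in>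
    Wellfounded.measure (\<lambda>(x, q, lam, mu). Suc (psize lam) * psize lam - dom_rank mu)" by auto
qed simp

declare mac_coef.simps [simp del]

lemma mac_coef_self [simp]: "mac_coef x q lam lam = 1"
  by (subst mac_coef.simps) simp

lemma mac_coef_nonzero: "mac_coef x q lam mu \<noteq> 0 \<Longrightarrow> mu \<preceq>D lam"
  by (subst (asm) mac_coef.simps) (auto simp: dominated_refl split: if_splits)

text \<open>For \<open>mu\<close> strictly below \<open>lam\<close> this is the definition with its
  denominator cleared and the diagonal term put back. For other \<open>mu\<close> the off-diagonal
  terms vanish, because nothing strictly above \<open>mu\<close> lies below
  \<open>lam\<close>.\<close>

lemma mac_coef_eigen:
  fixes lam mu :: expo and x q :: "'a::field"
  defines "N \<equiv> psize lam"
  defines "d \<equiv> \<lambda>mu. Tcoef x q (rowlist N mu) (rowlist N mu)"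
  assumes mu: "is_partition mu" "psize mu = N" and neq: "mu \<noteq> lam \<Longrightarrow> d mu \<noteq> d lam"
  shows "(\<Sum>s\<in>compositions N N. Tcoef x q (rowlist N mu) s * mac_coef x q lam (srt (Poly_Mapping.nth s))) =
    d lam * mac_coef x q lam mu"
proof -
  let ?F = "mac_coef x q lam" and ?T = "Tcoef x q (rowlist N mu)" and ?n = "\<lambda>s. srt (Poly_Mapping.nth s)"
  have rowlist: "rowlist N mu \<in> compositions N N" using rowlist_compositions mu by metis
  have keys: "Poly_Mapping.keys mu \<subseteq> {..<N}" using mu by (simp add: partition_keys_psize)
  have "(\<Sum>s\<in>compositions N N. ?T s * ?F (?n s)) =
      d mu * ?F mu + (\<Sum>s\<in>compositions N N - {rowlist N mu}. ?T s * ?F (?n s))"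
    using rowlist by (simp add: sum.remove finite_compositions d_def nth_rowlist[OF keys] srt_partition mu(1))
  also have "(\<Sum>s\<in>compositions N N - {rowlist N mu}. ?T s * ?F (?n s)) =
      (\<Sum>s\<in>{s \<in> compositions N N. mu \<prec>D ?n s}. ?T s * ?F (?n s))"
  proof (rule sum.mono_neutral_right)
    show "{s \<in> compositions N N. mu \<prec>D ?n s} \<subseteq> compositions N N - {rowlist N mu}"
      by (auto simp: nth_rowlist[OF keys] srt_partition mu(1) strictly_dominated_def)
    show "\<forall>s\<in>compositions N N - {rowlist N mu} - {s \<in> compositions N N. mu \<prec>D ?n s}. ?T s * ?F (?n s) = 0"
      using Tcoef_dominance[OF mu] by auto
  qed (simp add: finite_compositions)
  also have "\<dots> = (d lam - d mu) * ?F mu"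
  proof (cases "mu \<prec>D lam")
    case True
    then have "?F mu = (\<Sum>s\<in>{s \<in> compositions N N. mu \<prec>D ?n s}. ?T s * ?F (?n s)) / (d lam - d mu)"
      unfolding d_def N_def using mu(1) by (subst mac_coef.simps) (auto simp: strictly_dominated_def)
    moreover have "d lam - d mu \<noteq> 0" using neq True by (auto simp: strictly_dominated_def)
    ultimately show ?thesis by simp
  next
    case False
    have "?F (?n s) = 0" if "mu \<prec>D ?n s" for s
    proof (rule ccontr)
      assume "?F (?n s) \<noteq> 0"
      then have "?n s \<preceq>D lam" by (rule mac_coef_nonzero)
      moreover from this have "mu \<preceq>D lam" using that dominated_trans by (auto simp: strictly_dominated_def)
      ultimately show False using False that dominated_antisym by (auto simp: strictly_dominated_def)
    qed
    then have "(\<Sum>s\<in>{s \<in> compositions N N. mu \<prec>D ?n s}. ?T s * ?F (?n s)) = 0"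
      by (intro sum.neutral) auto
    moreover have "(d lam - d mu) * ?F mu = 0"
      using False mac_coef_nonzero[of x q lam mu] by (cases "mu = lam") (auto simp: strictly_dominated_def)
    ultimately show ?thesis by simp
  qed
  finally show ?thesis by (simp add: algebra_simps)
qed

section \<open>Behaviour along a curve through the degenerate point\<close>

text \<open>We put \<open>q = 1 - x\<^sup>2\<close> and \<open>t = 1 / (1 - x)\<close> and let \<open>x\<close> tend to 0. To leading order only the
  moves of boxes from one row to an earlier one survive in \<open>Tcoef\<close>, all with positive weights.\<close>

fun beta_lim :: "nat list \<Rightarrow> nat list \<Rightarrow> nat" where
  "beta_lim (n # r) (m # s) = (if m = n then beta_lim r s else if m < n \<and> r = s then 1 else 0)"
| "beta_lim _ _ = 0"

text \<open>The value of \<open>Tcoef\<close> at x = 0, nonzero only if at most one row differs.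
  Likewise \<open>beta_lim\<close> is the coefficient of x in \<open>Bcoef\<close> off the diagonal:
  1 if a single row is shortened, 0 otherwise.\<close>

fun theta_lim :: "nat list \<Rightarrow> nat list \<Rightarrow> nat" where
  "theta_lim (n # r) (m # s) = (if r = s then m else 0) + (if m = n then theta_lim r s else 0)"
| "theta_lim _ _ = 0"

text \<open>The coefficient of x in \<open>Tcoef\<close> between different lists of equal total. The
  first row that differs must be lengthened: its \<open>Bcoef\<close> term contributes
  \<open>m * beta_lim r s\<close>, and its factor -x meets the value
  \<open>theta_lim r s\<close>.\<close>

fun tau_lim :: "nat list \<Rightarrow> nat list \<Rightarrow> int" where
  "tau_lim (n # r) (m # s) = (if m = n then tau_lim r s
     else if m > n then int (m * beta_lim r s) - int (theta_lim r s) else 0)"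
| "tau_lim _ _ = 0"

text \<open>The sum of i times row i, counted from 0, usually written n(lambda).\<close>

fun row_stat :: "nat list \<Rightarrow> nat" where
  "row_stat (n # r) = row_stat r + sum_list r"
| "row_stat [] = 0"

lemma tendsto_id0: "((\<lambda>x::complex. x) \<longlongrightarrow> 0) (at 0)" by (rule tendsto_ident_at)

lemma eventually_at0: "eventually (\<lambda>x::complex. x \<noteq> 0) (at 0)"
  by (simp add: eventually_at_filter)

lemma tendsto_qnum: "((\<lambda>x::complex. qnum (1 - x\<^sup>2) m) \<longlongrightarrow> of_nat m) (at 0)"
proof -
  have "((\<lambda>x::complex. qnum (1 - x\<^sup>2) m) \<longlongrightarrow> qnum (1 - 0\<^sup>2) m) (at 0)"
    unfolding qnum_def by (intro tendsto_intros)
  then show ?thesis by (simp add: qnum_def)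
qed

lemma tendsto_qnum_deriv: "((\<lambda>x::complex. (qnum (1 - x\<^sup>2) m - of_nat m) / x) \<longlongrightarrow> 0) (at 0)"
proof (induction m)
  case (Suc m)
  have "((\<lambda>x::complex. (qnum (1 - x\<^sup>2) m - of_nat m) / x - x * qnum (1 - x\<^sup>2) m) \<longlongrightarrow> 0 - 0 * of_nat m) (at 0)"
    by (intro tendsto_intros Suc tendsto_qnum)
  then have *: "((\<lambda>x::complex. (qnum (1 - x\<^sup>2) m - of_nat m) / x - x * qnum (1 - x\<^sup>2) m) \<longlongrightarrow> 0) (at 0)"
    by simp
  show ?case
  proof (rule Lim_transform_eventually[OF * eventually_mono[OF eventually_at0]])
    fix x :: complex assume x: "x \<noteq> 0"
    have "(1 - x\<^sup>2) ^ m = 1 - x\<^sup>2 * qnum (1 - x\<^sup>2) m" using qnum_mult[of "1 - x\<^sup>2" m] by simp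
    then have "qnum (1 - x\<^sup>2) (Suc m) = qnum (1 - x\<^sup>2) m + 1 - x\<^sup>2 * qnum (1 - x\<^sup>2) m"
      by (simp add: qnum_def)
    then show "(qnum (1 - x\<^sup>2) m - of_nat m) / x - x * qnum (1 - x\<^sup>2) m =
        (qnum (1 - x\<^sup>2) (Suc m) - of_nat (Suc m)) / x"
      using x by (simp add: field_simps power2_eq_square)
  qed
qed (simp add: qnum_def)

lemma tendsto_Bcoef:
  "length r = length s \<Longrightarrow> ((\<lambda>x::complex. Bcoef x r s) \<longlongrightarrow> (if r = s then 1 else 0)) (at 0)"
proof (induction r s rule: list_induct2)
  case (Cons n r m s)
  have "((\<lambda>x::complex. x * Bcoef x r s) \<longlongrightarrow> 0 * (if r = s then 1 else 0)) (at 0)"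
    by (intro tendsto_intros Cons)
  then show ?case using Cons by (cases m n rule: linorder_cases) auto
qed simp

lemma tendsto_Bcoef_deriv:
  "length r = length s \<Longrightarrow> r \<noteq> s \<Longrightarrow>
    ((\<lambda>x::complex. Bcoef x r s / x) \<longlongrightarrow> of_nat (beta_lim r s)) (at 0)"
proof (induction r s rule: list_induct2)
  case (Cons n r m s)
  show ?case
  proof (cases m n rule: linorder_cases)
    case less
    have "((\<lambda>x::complex. Bcoef x (n # r) (m # s) / x) \<longlongrightarrow> (if r = s then 1 else 0)) (at 0)"
      by (rule Lim_transform_eventually[OF tendsto_Bcoef[OF Cons.hyps]
            eventually_mono[OF eventually_at0]]) (use less in simp)
    then show ?thesis using less by (cases "r = s") simp_all
  qed (use Cons in auto)
qed simp

lemma tendsto_Tcoef: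
  "length r = length s \<Longrightarrow>
    ((\<lambda>x::complex. Tcoef x (1 - x\<^sup>2) r s) \<longlongrightarrow> of_nat (theta_lim r s)) (at 0)"
proof (induction r s rule: list_induct2)
  case (Cons n r m s)
  define y where "y x = (if m = n then 1 - x else if m > n then - x else 0)" for x :: complex
  have "(y \<longlongrightarrow> (if m = n then 1 - 0 else if m > n then - 0 else 0)) (at 0)"
  proof -
    have "((\<lambda>x::complex. 1 - x) \<longlongrightarrow> 1 - 0) (at 0)" "((\<lambda>x::complex. - x) \<longlongrightarrow> - 0) (at 0)"
      by (intro tendsto_intros)+
    then show ?thesis unfolding y_def by (cases "m = n"; cases "m > n") simp_all
  qed
  then have "((\<lambda>x. qnum (1 - x\<^sup>2) m * Bcoef x r s + y x * Tcoef x (1 - x\<^sup>2) r s) \<longlongrightarrow>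
      of_nat m * (if r = s then 1 else 0) +
      (if m = n then 1 - 0 else if m > n then - 0 else 0) * of_nat (theta_lim r s)) (at 0)"
    by (intro tendsto_add tendsto_mult tendsto_qnum tendsto_Bcoef Cons)
  moreover have "of_nat m * (if r = s then 1 else 0) +
      (if m = n then 1 - 0 else if m > n then - 0 else 0) * of_nat (theta_lim r s) =
      (of_nat (theta_lim (n # r) (m # s)) :: complex)" by auto
  ultimately show ?case by (simp add: y_def)
qed simp

lemma tendsto_Tcoef_deriv:
  "length r = length s \<Longrightarrow> r \<noteq> s \<Longrightarrow> sum_list r = sum_list s \<Longrightarrow>
    ((\<lambda>x::complex. Tcoef x (1 - x\<^sup>2) r s / x) \<longlongrightarrow> of_int (tau_lim r s)) (at 0)"
proof (induction r s rule: list_induct2)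
  case (Cons n r m s)
  show ?case
  proof (cases m n rule: linorder_cases)
    case less
    then have "Bcoef x r s = 0" for x :: complex
      using Cons by (intro Bcoef_off_diagonal) auto
    then show ?thesis using less by simp
  next
    case equal
    then have B: "Bcoef x r s = 0" for x :: complex
      using Cons by (intro Bcoef_off_diagonal) auto
    have "((\<lambda>x::complex. (1 - x) * (Tcoef x (1 - x\<^sup>2) r s / x)) \<longlongrightarrow> (1 - 0) * of_int (tau_lim r s)) (at 0)"
      using Cons equal by (intro tendsto_mult tendsto_diff tendsto_const tendsto_id0) auto
    then show ?thesis using equal B by simp
  next
    case greater
    then have rs: "r \<noteq> s" using Cons by auto
    have *: "((\<lambda>x::complex. qnum (1 - x\<^sup>2) m * (Bcoef x r s / x) - Tcoef x (1 - x\<^sup>2) r s) \<longlongrightarrow>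
        of_nat m * of_nat (beta_lim r s) - of_nat (theta_lim r s)) (at 0)"
      by (intro tendsto_diff tendsto_mult tendsto_qnum tendsto_Bcoef_deriv tendsto_Tcoef Cons.hyps rs)
    have "((\<lambda>x::complex. Tcoef x (1 - x\<^sup>2) (n # r) (m # s) / x) \<longlongrightarrow>
        of_nat m * of_nat (beta_lim r s) - of_nat (theta_lim r s)) (at 0)"
      by (rule Lim_transform_eventually[OF * eventually_mono[OF eventually_at0]])
         (use greater in \<open>simp add: field_simps\<close>)
    then show ?thesis using greater by simp
  qed
qed simp

text \<open>If \<open>theta_lim\<close> is nonzero, a single row differs, and since the total drops
  it is shortened: \<open>beta_lim\<close> is 1, and the new length is below the old one, which is
  at most m.\<close>

lemma theta_lim_le:
  "length r = length s \<Longrightarrow> sum_list s < sum_list r \<Longrightarrow> \<forall>n\<in>set r. n \<le> m \<Longrightarrow>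
    theta_lim r s \<le> m * beta_lim r s"
  by (induction r s rule: list_induct2) auto

text \<open>In a sorted list the first lengthened row exceeds all later ones. For unsorted lists the
  sign can fail: [1,5] and [2,4] give -2.\<close>

lemma tau_lim_nonneg:
  "length r = length s \<Longrightarrow> sum_list r = sum_list s \<Longrightarrow> sorted_wrt (\<ge>) r \<Longrightarrow> 0 \<le> tau_lim r s"
proof (induction r s rule: list_induct2)
  case (Cons n r m s)
  show ?case
  proof (cases "m > n")
    case True
    then have "theta_lim r s \<le> m * beta_lim r s"
      using Cons by (intro theta_lim_le) auto
    then show ?thesis using True by (simp add: of_nat_le_iff[symmetric, where ?'a = int] del: of_nat_le_iff)
  qed (use Cons in auto)
qed simp

lemma theta_lim_update: "j < length r \<Longrightarrow> c \<noteq> r ! j \<Longrightarrow> theta_lim r (r[j := c]) = c"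
proof (induction r arbitrary: j)
  case (Cons n r)
  show ?case
  proof (cases j)
    case 0
    then show ?thesis using Cons.prems by simp
  next
    case (Suc i)
    then have "r[i := c] \<noteq> r" using Cons.prems by (metis length_Cons nth_Cons_Suc nth_list_update_eq Suc_less_eq)
    then show ?thesis using Suc Cons by force
  qed
qed simp

lemma beta_lim_update: "j < length r \<Longrightarrow> c < r ! j \<Longrightarrow> beta_lim r (r[j := c]) = 1"
proof (induction r arbitrary: j)
  case (Cons n r)
  then show ?case by (cases j) auto
qed simp

text \<open>The value is (r_i + 1) - (r_j - 1), the difference of the two rows after the
  move.\<close>

lemma tau_lim_step:
  "i < j \<Longrightarrow> j < length r \<Longrightarrow> 0 < r ! j \<Longrightarrow> sorted_wrt (\<ge>) r \<Longrightarrow>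
    0 < tau_lim r (r[i := Suc (r ! i), j := r ! j - 1])"
proof (induction r arbitrary: i j)
  case (Cons n r)
  obtain j' where j: "j = Suc j'" using Cons.prems(1) by (cases j) auto
  show ?case
  proof (cases i)
    case 0
    have "r ! j' \<le> n" using Cons.prems j by auto
    moreover have "tau_lim (n # r) ((n # r)[i := Suc ((n # r) ! i), j := (n # r) ! j - 1]) =
        int (Suc n) - int (r ! j' - 1)"
      using Cons.prems j 0 by (simp add: beta_lim_update theta_lim_update)
    ultimately show ?thesis by linarith
  next
    case (Suc i')
    then show ?thesis using Cons j by simp
  qed
qed simp

text \<open>At x = 0 the diagonal entries depend on the degree only, so their differences are of
  first order, like the off-diagonal entries. The derivative comes from the weights (1 - x)^i of the
  rows alone, as q is constant to first order.\<close>

lemma tendsto_Tcoef_diagonal: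
  "((\<lambda>x::complex. (Tcoef x (1 - x\<^sup>2) r r - of_nat (sum_list r)) / x) \<longlongrightarrow> - of_nat (row_stat r)) (at 0)"
proof (induction r)
  case (Cons n r)
  have B: "Bcoef x r r = 1" for x :: complex by (induction r) auto
  have th: "theta_lim r r = sum_list r" by (induction r) auto
  have *: "((\<lambda>x::complex. (qnum (1 - x\<^sup>2) n - of_nat n) / x +
      (Tcoef x (1 - x\<^sup>2) r r - of_nat (sum_list r)) / x - Tcoef x (1 - x\<^sup>2) r r) \<longlongrightarrow>
      0 + - of_nat (row_stat r) - of_nat (theta_lim r r)) (at 0)"
    by (intro tendsto_add tendsto_diff tendsto_qnum_deriv tendsto_Tcoef refl Cons)
  have "((\<lambda>x::complex. (Tcoef x (1 - x\<^sup>2) (n # r) (n # r) - of_nat (sum_list (n # r))) / x) \<longlongrightarrow>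
      0 + - of_nat (row_stat r) - of_nat (theta_lim r r)) (at 0)"
    by (rule Lim_transform_eventually[OF * eventually_mono[OF eventually_at0]])
       (simp add: B field_simps)
  then show ?case by (simp add: th)
qed simp

text \<open>Summation by parts: row i occurs in \<open>length r - i\<close> of the initial sums and
  i times in \<open>row_stat\<close>.\<close>

lemma row_stat_take: "row_stat r + (\<Sum>k\<le>length r. sum_list (take k r)) = length r * sum_list r"
proof (induction r)
  case (Cons n r)
  have "(\<Sum>k\<le>length (n # r). sum_list (take k (n # r))) = (\<Sum>k\<le>length r. n + sum_list (take k r))"
    unfolding list.size(4) add_Suc_right add_0_right by (subst sum.atMost_Suc_shift) simp
  also have "\<dots> = Suc (length r) * n + (\<Sum>k\<le>length r. sum_list (take k r))"
    by (simp add: sum.distrib)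
  finally show ?case using Cons by (simp add: algebra_simps)
qed simp

lemma row_stat_rowlist:
  assumes "is_partition mu"
  shows "row_stat (rowlist (psize mu) mu) + dom_rank mu = psize mu * psize mu"
proof -
  have "(\<Sum>k\<le>psize mu. psum mu (min k (psize mu))) = dom_rank mu"
    unfolding dom_rank_def by (rule sum.cong) (auto simp: min_def)
  then show ?thesis
    using assms row_stat_take[of "rowlist (psize mu) mu"] by (simp add: sum_take_rowlist sum_rowlist psum_eq_psize)
qed

section \<open>Coefficients of monomial symmetric functions\<close>

text \<open>\<open>pmon\<close> and \<open>ptn\<close> are inverse bijections between partitions and
  the multisets that index monomials in the power sums.\<close>

definition pmon :: "expo \<Rightarrow> nat multiset" where
  "pmon lam = mset (map (\<lambda>i. lk lam i - 1) [0..<plength lam])"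

definition ptn :: "nat multiset \<Rightarrow> expo" where
  "ptn M = Poly_Mapping.nth (rev (sorted_list_of_multiset (image_mset Suc M)))"

lemma ptn_partition: "is_partition (ptn M)"
  unfolding ptn_def by (rule is_partition_nth) simp

lemma rowlist_pos:
  assumes "is_partition lam" "i < plength lam"
  shows "0 < lk lam i"
proof -
  have "i \<in> Poly_Mapping.keys lam" using assms partition_keys by simp
  then show ?thesis by (simp add: in_keys_iff)
qed

lemma rowlist_elem: "j < N \<Longrightarrow> rowlist N \<alpha> ! j = lk \<alpha> j"
  by (simp add: rowlist_def)

lemma Suc_pmon: "is_partition lam \<Longrightarrow> image_mset Suc (pmon lam) = mset (rowlist (plength lam) lam)"
  unfolding pmon_def rowlist_def mset_map[symmetric] map_map
  by (rule arg_cong[of _ _ mset], rule map_cong) (auto dest: rowlist_pos)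

lemma ptn_pmon:
  assumes "is_partition lam"
  shows "ptn (pmon lam) = lam"
proof -
  have "sorted (rev (rowlist (plength lam) lam))"
    using assms by (auto simp: sorted_rev_iff_nth_mono rowlist_def is_partition_def antimono_def)
  then have "sorted_list_of_multiset (image_mset Suc (pmon lam)) = rev (rowlist (plength lam) lam)"
    unfolding Suc_pmon[OF assms] sorted_list_of_multiset_mset
    by (intro properties_for_sort) auto
  then have "ptn (pmon lam) = Poly_Mapping.nth (rowlist (plength lam) lam)" by (simp add: ptn_def)
  also have "\<dots> = lam" by (rule nth_rowlist) (simp add: partition_keys assms)
  finally show ?thesis .
qed

lemma pmon_ptn: "pmon (ptn M) = M"
proof -
  define ys where "ys = rev (sorted_list_of_multiset (image_mset Suc M))"
  have mset: "mset ys = image_mset Suc M" by (simp add: ys_def)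
  have pos: "ys ! i \<noteq> 0" if "i < length ys" for i
    using nth_mem[OF that] unfolding set_mset_mset[symmetric] mset by auto
  have "Poly_Mapping.keys (Poly_Mapping.nth ys) = {..<length ys}"
    using pos by (auto simp: in_keys_iff lookup_nth_list simp del: lookup_nth keys_nth split: if_splits)
  then have "plength (ptn M) = length ys" by (simp add: plength_def ptn_def ys_def)
  then have "rowlist (plength (ptn M)) (ptn M) = ys" unfolding ptn_def ys_def[symmetric]
    by (simp add: rowlist_nth)
  then have "image_mset Suc (pmon (ptn M)) = image_mset Suc M"
    using Suc_pmon[OF ptn_partition, of M] mset by simp
  then show ?thesis by (rule injD[OF multiset.inj_map[OF inj_Suc]])
qed

lemma wt_pmon:
  assumes "is_partition lam"
  shows "wt (pmon lam) = psize lam"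
proof -
  have "wt (pmon lam) = sum_mset (image_mset Suc (pmon lam))" by (simp add: wt_def)
  also have "\<dots> = sum_list (rowlist (plength lam) lam)" by (simp add: Suc_pmon assms sum_mset_sum_list)
  also have "\<dots> = psize lam" using assms by (simp add: sum_rowlist psize_eq[of lam "plength lam"] partition_keys)
  finally show ?thesis .
qed

lemma lookup_minus_pm: "lk (f - g) k = lk f k - lk (g :: 'k \<Rightarrow>\<^sub>0 nat) k"
  by (rule lookup_minus)

lemma series_mult_power_sum:
  assumes "Poly_Mapping.keys \<alpha> \<subseteq> {..<N}" "0 < r"
  shows "series_mult (power_sum r) F \<alpha> =
    (\<Sum>j<N. if r \<le> lk \<alpha> j then F (\<alpha> - Poly_Mapping.single j r) else (0::'a::comm_ring_1))"
proof -
  let ?s = "\<lambda>j. Poly_Mapping.single j r :: expo"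
  let ?J = "{j. j < N \<and> r \<le> lk \<alpha> j}"
  have inj: "?s i = ?s j \<Longrightarrow> i = j" for i j
    using assms(2) by (metis lookup_single_eq lookup_single_not_eq not_gr_zero)
  have split: "?s j + (\<alpha> - ?s j) = \<alpha>" if "r \<le> lk \<alpha> j" for j
    by (rule poly_mapping_eqI) (use that in \<open>auto simp: lookup_add lookup_minus_pm lookup_single when_def\<close>)
  have "series_mult (power_sum r) F \<alpha> =
      (\<Sum>(\<beta>, \<gamma>)\<in>(\<lambda>j. (?s j, \<alpha> - ?s j)) ` ?J. power_sum r \<beta> * F \<gamma>)"
    unfolding series_mult_def
  proof (rule sum.mono_neutral_right[OF finite_splittings])
    show "(\<lambda>j. (?s j, \<alpha> - ?s j)) ` ?J \<subseteq> {(\<beta>, \<gamma>). \<beta> + \<gamma> = \<alpha>}" using split by auto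
    show "\<forall>p\<in>{(\<beta>, \<gamma>). \<beta> + \<gamma> = \<alpha>} - (\<lambda>j. (?s j, \<alpha> - ?s j)) ` ?J.
        (case p of (\<beta>, \<gamma>) \<Rightarrow> power_sum r \<beta> * F \<gamma>) = 0"
    proof safe
      fix \<beta> \<gamma> :: expo
      assume a: "\<alpha> = \<beta> + \<gamma>" "(\<beta>, \<gamma>) \<notin> (\<lambda>j. (?s j, \<beta> + \<gamma> - ?s j)) ` {j. j < N \<and> r \<le> lk (\<beta> + \<gamma>) j}"
      have "\<beta> \<noteq> ?s j" for j
      proof
        assume b: "\<beta> = ?s j"
        then have "r \<le> lk \<alpha> j" by (simp add: a(1) lookup_add)
        moreover from this have "j < N" using assms by (metis a(1) in_keys_iff leD lessThan_iff subsetD)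
        ultimately show False using a b by auto
      qed
      then show "power_sum r \<beta> * F \<gamma> = 0" by (simp add: power_sum_def)
    qed
  qed
  also have "\<dots> = (\<Sum>j\<in>?J. F (\<alpha> - ?s j))"
  proof -
    have "power_sum r (?s j) = (1::'a)" for j by (auto simp: power_sum_def)
    then show ?thesis by (subst sum.reindex) (auto simp: inj_on_def dest: inj)
  qed
  also have "\<dots> = (\<Sum>j<N. if r \<le> lk \<alpha> j then F (\<alpha> - ?s j) else 0)"
    by (rule sum.mono_neutral_cong_left) auto
  finally show ?thesis .
qed

section \<open>Coefficients of ring elements at exponent vectors\<close>

context macdonald
begin

definition gexp :: "expo \<Rightarrow> 'a sf" where "gexp \<alpha> = (\<Prod>i\<in>Poly_Mapping.keys \<alpha>. g (lk \<alpha> i))"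

text \<open>The coefficient of x^alpha in the symmetric function \<open>f\<close>. That pairing with
  products of g's computes it is the content of \<open>power_sum_product_eq_cf\<close>.\<close>

definition cf :: "'a sf \<Rightarrow> expo \<Rightarrow> 'a" where "cf f \<alpha> = ip (gexp \<alpha>) f"

lemma gprod_eq_gexp: "gprod s = gexp (Poly_Mapping.nth s)"
proof -
  have "gprod s = (\<Prod>i<length s. g (s ! i))"
    by (simp add: gprod_def prod.list_conv_set_nth atLeast0LessThan)
  also have "\<dots> = (\<Prod>i<length s. g (lk (Poly_Mapping.nth s) i))"
    by (rule prod.cong) (auto simp: lookup_nth_list simp del: lookup_nth)
  also have "\<dots> = gexp (Poly_Mapping.nth s)"
    unfolding gexp_def using keys_nth_subset[of s]
    by (intro prod.mono_neutral_right) (auto simp: in_keys_iff simp del: lookup_nth keys_nth)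
  finally show ?thesis .
qed

lemma gexp_eq_gprod: "Poly_Mapping.keys \<alpha> \<subseteq> {..<N} \<Longrightarrow> gexp \<alpha> = gprod (rowlist N \<alpha>)"
  by (simp add: gprod_eq_gexp nth_rowlist)

lemma gexp_srt: "gexp (srt \<alpha>) = gexp \<alpha>"
  unfolding gexp_def using rearrangement_prod[OF srt(2)] by metis

lemma cf_srt: "cf f (srt \<alpha>) = cf f \<alpha>" by (simp add: cf_def gexp_srt)

lemma cf_add: "cf (f + u) \<alpha> = cf f \<alpha> + cf u \<alpha>" by (simp add: cf_def ip_add_right)
lemma cf_diff: "cf (f - u) \<alpha> = cf f \<alpha> - cf u \<alpha>" by (simp add: cf_def ip_diff_right)
lemma cf_sum: "cf (sum f A) \<alpha> = (\<Sum>k\<in>A. cf (f k) \<alpha>)" by (simp add: cf_def ip_sum_right)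
lemma cf_cst_mult: "cf (cst c * f) \<alpha> = c * cf f \<alpha>" by (simp add: cf_def ip_cst_mult_right)

text \<open>Adjoint to multiplication by g_n is the coefficient of z^n after splitting off a
  variable z. This turns the power sum into p_(i+1) + z^(i+1), which uses up i + 1 from exactly one
  of the rows.\<close>

lemma ip_gprod_pvar:
  "ip (gprod s) (pvar i * f) =
    (\<Sum>j<length s. if Suc i \<le> s ! j then ip (gprod (s[j := s ! j - Suc i])) f else 0)"
proof (induction s arbitrary: f)
  case Nil
  then show ?case by (simp add: ip_one lookup_pvar_mult)
next
  case (Cons n s)
  have "ip (gprod (n # s)) (pvar i * f) = ip (gprod s) (B (\<lambda>_. 1) n (pvar i * f))"
    unfolding gprod_simps g_def by (rule G_adjoint)
  also have "\<dots> = ip (gprod s) (pvar i * B (\<lambda>_. 1) n f) +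
      (if Suc i \<le> n then ip (gprod s) (B (\<lambda>_. 1) (n - Suc i) f) else 0)"
    by (simp add: B_pvar_mult ip_add_right)
  also have "(if Suc i \<le> n then ip (gprod s) (B (\<lambda>_. 1) (n - Suc i) f) else 0) =
     (if Suc i \<le> n then ip (gprod ((n - Suc i) # s)) f else 0)"
    unfolding gprod_simps g_def G_adjoint ..
  also have "ip (gprod s) (pvar i * B (\<lambda>_. 1) n f) =
      (\<Sum>j<length s. if Suc i \<le> s ! j then ip (gprod (n # s[j := s ! j - Suc i])) f else 0)"
    unfolding Cons gprod_simps g_def G_adjoint ..
  finally show ?case
    unfolding list.size(4) add_Suc_right add_0_right by (subst sum.lessThan_Suc_shift) (simp del: gprod_simps cong: if_cong)
qed

text \<open>The same recursion as \<open>series_mult_power_sum\<close>; it matches multiplication by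
  a power sum in the ring with multiplication of series.\<close>

lemma cf_pvar:
  assumes "Poly_Mapping.keys \<alpha> \<subseteq> {..<N}"
  shows "cf (pvar i * f) \<alpha> =
    (\<Sum>j<N. if Suc i \<le> lk \<alpha> j then cf f (\<alpha> - Poly_Mapping.single j (Suc i)) else 0)"
proof -
  have eq: "gprod ((rowlist N \<alpha>)[j := rowlist N \<alpha> ! j - Suc i]) = gexp (\<alpha> - Poly_Mapping.single j (Suc i))"
    if "j < N" for j
  proof -
    let ?\<gamma> = "\<alpha> - Poly_Mapping.single j (Suc i)"
    have "Poly_Mapping.keys ?\<gamma> \<subseteq> {..<N}"
    proof
      fix k assume "k \<in> Poly_Mapping.keys ?\<gamma>"
      then have "k \<in> Poly_Mapping.keys \<alpha>" by (auto simp: in_keys_iff lookup_minus_pm)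
      then show "k \<in> {..<N}" using assms by blast
    qed
    moreover have "rowlist N ?\<gamma> = (rowlist N \<alpha>)[j := rowlist N \<alpha> ! j - Suc i]"
      by (rule nth_equalityI) (use that in \<open>auto simp: rowlist_def lookup_minus_pm lookup_single when_def nth_list_update\<close>)
    ultimately show ?thesis by (simp add: gexp_eq_gprod)
  qed
  show ?thesis
    unfolding cf_def gexp_eq_gprod[OF assms] ip_gprod_pvar length_rowlist
    by (rule sum.cong) (use eq in \<open>auto simp: rowlist_elem\<close>)
qed

lemma lookup_empty_gexp: "lk (gexp \<alpha>) {#} = (if \<alpha> = 0 then 1 else 0)"
proof -
  have prod: "lk (\<Prod>i\<in>A. F i) {#} = (\<Prod>i\<in>A. lk (F i :: 'a sf) {#})" if "finite A" for A :: "nat set" and F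
    using that by induction (simp_all add: lookup_mult_empty lookup_one when_def)
  have "lk (gexp \<alpha>) {#} = (\<Prod>i\<in>Poly_Mapping.keys \<alpha>. 0)"
    unfolding gexp_def prod[OF finite_keys]
    by (rule prod.cong) (auto simp: g_def lookup_G in_keys_iff)
  then show ?thesis by (auto simp: prod_constant power_0_left)
qed

lemma power_sum_product_eq_cf:
  assumes "is_partition lam"
  shows "power_sum_product lam = cf (Poly_Mapping.single (pmon lam) 1)"
proof -
  have *: "foldr series_mult (map (\<lambda>i. power_sum (lk lam i)) js) series_one \<alpha> =
      cf (Poly_Mapping.single (mset (map (\<lambda>i. lk lam i - 1) js)) 1) \<alpha>"
    if "set js \<subseteq> {..<plength lam}" for js \<alpha>
    using that
  proof (induction js arbitrary: \<alpha>)
    case Nil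
    have "cf (1::'a sf) \<alpha> = (if \<alpha> = 0 then 1 else 0)"
      unfolding cf_def ip_commute[of _ 1] ip_one by (rule lookup_empty_gexp)
    then show ?case by (simp add: series_one_def)
  next
    case (Cons j js)
    let ?G = "foldr series_mult (map (\<lambda>i. power_sum (lk lam i)) js) series_one :: 'a series"
    have "?G = cf (Poly_Mapping.single (mset (map (\<lambda>i. lk lam i - 1) js)) 1)" (is "_ = cf ?f")
      using Cons by (intro ext) auto
    then have G: "foldr series_mult (map (\<lambda>i. power_sum (lk lam i)) (j # js)) series_one \<alpha> =
        series_mult (power_sum (lk lam j)) (cf ?f) \<alpha>" by simp
    obtain N where N: "Poly_Mapping.keys \<alpha> \<subseteq> {..<N}" using keys_bounded by blast
    have pos: "0 < lk lam j" using rowlist_pos[OF assms] Cons.prems by simp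
    have S: "Poly_Mapping.single (mset (map (\<lambda>i. lk lam i - 1) (j # js))) 1 = pvar (lk lam j - 1) * ?f"
      by (simp add: mult_single)
    show ?case
      unfolding G S series_mult_power_sum[OF N pos] cf_pvar[OF N] using pos by (simp cong: if_cong)
  qed
  have "set [0..<plength lam] \<subseteq> {..<plength lam}" by auto
  then show ?thesis unfolding power_sum_product_def pmon_def by (intro ext *)
qed

text \<open>The \<open>g\<close>-products span the ring, since \<open>g\<^sub>n\<close> involves \<open>p\<^sub>n\<close> with a nonzero coefficient.\<close>

lemma gprod_separates:
  assumes f: "\<And>s. ip (gprod s) f = 0"
  shows "f = 0"
proof -
  \<comment> \<open>Euler's identity for g_(i+1) is solved for p_(i+1) g_0; the other products
    contain some p_(j+1) with j < i and are settled by induction. The factor g_0 = 1 keeps all terms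
    in the form \<open>gprod (_ # s)\<close>.\<close>
  have step: "ip (pvar i * u * gprod s) f = 0" if u: "\<And>s. ip (u * gprod s) f = 0" for i u s
  proof (induction i arbitrary: s rule: less_induct)
    case (less i)
    let ?c = "\<lambda>j. of_nat (Suc j) * (1 / mac_weight q t j)"
    have "cst (of_nat (Suc i)) * g (Suc i) = (\<Sum>j<Suc i. cst (?c j) * (pvar j * g (Suc i - Suc j)))"
      unfolding g_def by (rule G_rec)
    then have "cst (of_nat (Suc i)) * (u * gprod (Suc i # s)) =
        (\<Sum>j<Suc i. cst (?c j) * (pvar j * g (Suc i - Suc j))) * (u * gprod s)"
      by (simp add: mult_ac)
    also have "\<dots> = (\<Sum>j<Suc i. cst (?c j) * (pvar j * u * gprod ((Suc i - Suc j) # s)))"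
      unfolding sum_distrib_right by (rule sum.cong) (simp_all add: mult_ac)
    finally have "ip (cst (of_nat (Suc i)) * (u * gprod (Suc i # s))) f =
        (\<Sum>j<Suc i. ?c j * ip (pvar j * u * gprod ((Suc i - Suc j) # s)) f)"
      by (simp only: ip_sum_left ip_cst_mult_left)
    moreover have "(\<Sum>j<i. ?c j * ip (pvar j * u * gprod ((Suc i - Suc j) # s)) f) = 0"
      by (intro sum.neutral ballI) (simp only: less.IH lessThan_iff mult_zero_right)
    ultimately have "0 = ?c i * ip (pvar i * u * gprod (0 # s)) f"
      unfolding sum.lessThan_Suc ip_cst_mult_left u by (simp del: gprod_simps)
    moreover have "?c i \<noteq> 0" using w_nz[of i] of_nat_neq_0[of i, where ?'a='a] by (simp del: of_nat_Suc)
    ultimately have "ip (pvar i * u * gprod (0 # s)) f = 0"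
      by (metis mult_eq_0_iff)
    then show ?case by simp
  qed
  have "ip (Poly_Mapping.single M 1 * gprod s) f = 0" for M s
  proof (induction M arbitrary: s)
    case empty
    then show ?case using f by simp
  next
    case (add i M)
    show ?case unfolding single_add_mset[of i M 1] by (rule step) (rule add)
  qed
  from this[of _ "[]"] have "lk f M = 0" for M
    using Z_nz[of M] by (auto simp: ip_single)
  then show ?thesis by (intro poly_mapping_eqI) simp
qed

lemma cf_partitions_separate:
  assumes "\<And>mu. is_partition mu \<Longrightarrow> cf f mu = cf u mu"
  shows "f = u"
proof -
  have "f - u = 0"
  proof (rule gprod_separates)
    fix s
    have "ip (gprod s) (f - u) = cf (f - u) (srt (Poly_Mapping.nth s))"
      unfolding cf_srt by (simp add: cf_def gprod_eq_gexp)
    then show "ip (gprod s) (f - u) = 0" using assms[OF srt(1)] by (simp add: cf_diff)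
  qed
  then show ?thesis by simp
qed

section \<open>Homogeneous elements and the basis dual to the products of g's\<close>

definition homog :: "nat \<Rightarrow> 'a sf \<Rightarrow> bool" where
  "homog n f \<longleftrightarrow> (\<forall>M. lk f M \<noteq> 0 \<longrightarrow> wt M = n)"

lemma homog_mult:
  assumes "homog m f" "homog n u"
  shows "homog (m + n) (f * u)"
  unfolding homog_def
proof safe
  fix M assume "lk (f * u) M \<noteq> 0"
  then have "M \<in> Poly_Mapping.keys (f * u)" by (simp add: in_keys_iff)
  then obtain a b where "M = a + b" "a \<in> Poly_Mapping.keys f" "b \<in> Poly_Mapping.keys u"
    using keys_mult[of f u] by blast
  then show "wt M = m + n" using assms by (auto simp: homog_def in_keys_iff)
qed

lemma homog_gprod: "homog (sum_list s) (gprod s)"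
proof (induction s)
  case Nil
  then show ?case by (simp add: homog_def lookup_one when_def)
next
  case (Cons n s)
  have "homog n (g n)" by (simp add: homog_def g_def lookup_G)
  then show ?case using homog_mult Cons by simp
qed

lemma cf_homog:
  assumes "homog n f" "psize \<alpha> \<noteq> n"
  shows "cf f \<alpha> = 0"
proof -
  obtain N where N: "Poly_Mapping.keys \<alpha> \<subseteq> {..<N}" using keys_bounded by blast
  have "homog (psize \<alpha>) (gexp \<alpha>)"
    using homog_gprod[of "rowlist N \<alpha>"] by (simp add: gexp_eq_gprod[OF N] sum_rowlist psize_eq[OF N])
  then show ?thesis using assms unfolding cf_def ip_def lin_ext_def
    by (intro sum.neutral) (auto simp: homog_def in_keys_iff)
qed

lemma homog_add: "homog n f \<Longrightarrow> homog n u \<Longrightarrow> homog n (f + u)"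
proof -
  assume *: "homog n f" "homog n u"
  have "lk f M \<noteq> 0 \<or> lk u M \<noteq> 0" if "lk (f + u) M \<noteq> 0" for M
    using that by (auto simp: lookup_add)
  then show ?thesis using * unfolding homog_def by blast
qed

lemma homog_sum: "(\<And>k. k \<in> A \<Longrightarrow> homog n (f k)) \<Longrightarrow> homog n (sum f A)"
  by (induction A rule: infinite_finite_induct) (auto intro: homog_add simp: homog_def[of n 0])

lemma homog_cst_mult: "homog n f \<Longrightarrow> homog n (cst c * f)"
  by (simp add: homog_def)

lemma homog_single: "wt M = n \<Longrightarrow> homog n (Poly_Mapping.single M c)"
  by (simp add: homog_def lookup_single when_def)

text \<open>Power sum products and monomial functions of a fixed degree are equinumerous, so the linear
  independence of the former makes them a basis.\<close>

lemma dual_basis_exists: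
  "\<exists>f. homog (wt M0) f \<and> (\<forall>M. wt M = wt M0 \<longrightarrow> cf f (ptn M) = (if M = M0 then 1 else 0))"
proof -
  interpret vs: vector_space "\<lambda>c (f :: 'a sf). cst c * f"
    by unfold_locales (simp_all add: distrib_left distrib_right single_add cst_mult mult.assoc)
  define W where "W = {M. wt M = wt M0}"
  have finW: "finite W" unfolding W_def by (rule finite_wt)
  \<comment> \<open>Reusing the power sums as coordinates for the coefficients at partitions makes
    \<open>\<Phi>\<close> map the degree component to itself, so that its surjectivity can be drawn
    from its injectivity.\<close>
  define \<Phi> where "\<Phi> f = (\<Sum>M\<in>W. cst (cf f (ptn M)) * Poly_Mapping.single M 1)" for f :: "'a sf"
  have lk\<Phi>: "lk (\<Phi> f) M = (if M \<in> W then cf f (ptn M) else 0)" for f M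
    using finW by (simp add: \<Phi>_def lookup_sum lookup_single when_def if_distrib[of "\<lambda>x. _ * x"] sum.delta cong: if_cong)
  have \<Phi>sum: "\<Phi> (\<Sum>M\<in>A. cst (c M) * f M) = (\<Sum>M\<in>A. cst (c M) * \<Phi> (f M))" for A :: "nat multiset set" and c f
    by (rule poly_mapping_eqI) (simp add: lk\<Phi> lookup_sum cf_sum cf_cst_mult)
  have \<Phi>inj: "f = 0" if "homog (wt M0) f" "\<Phi> f = 0" for f
  proof (rule cf_partitions_separate)
    fix mu assume mu: "is_partition mu"
    show "cf f mu = cf 0 mu"
    proof (cases "psize mu = wt M0")
      case True
      then have "pmon mu \<in> W" using mu by (simp add: W_def wt_pmon)
      then have "cf f mu = lk (\<Phi> f) (pmon mu)" by (simp add: lk\<Phi> ptn_pmon mu)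
      then show ?thesis using that by (simp add: cf_def)
    next
      case False
      then show ?thesis using cf_homog[OF that(1)] by (simp add: cf_def)
    qed
  qed
  let ?p = "\<lambda>M. Poly_Mapping.single M (1::'a)"
  have homog: "homog (wt M0) (\<Sum>M\<in>A. cst (c M) * ?p M)" if "A \<subseteq> W" for A and c :: "nat multiset \<Rightarrow> 'a"
    using that by (intro homog_sum homog_cst_mult homog_single) (auto simp: W_def)
  have lkp: "lk (\<Sum>M\<in>A. cst (c M) * ?p M) M = (if M \<in> A then c M else 0)" if "finite A" for A M and c :: "nat multiset \<Rightarrow> 'a"
    using that by (simp add: lookup_sum lookup_single when_def if_distrib[of "\<lambda>x. _ * x"] sum.delta cong: if_cong)
  have coeffs0: "c M = 0" if "(\<Sum>M\<in>W. cst (c M) * \<Phi> (?p M)) = 0" "M \<in> W" for c M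
  proof -
    have "(\<Sum>M\<in>W. cst (c M) * ?p M) = 0"
      by (rule \<Phi>inj[OF homog]) (use that \<Phi>sum in auto)
    then show ?thesis using lkp[OF finW, of c M] that by simp
  qed
  have inj: "inj_on (\<lambda>M. \<Phi> (?p M)) W"
  proof (rule inj_onI, rule ccontr)
    fix M N assume MN: "M \<in> W" "N \<in> W" "\<Phi> (?p M) = \<Phi> (?p N)" "M \<noteq> N"
    let ?c = "\<lambda>K. if K = M then 1 else if K = N then - 1 else (0::'a)"
    have "(\<Sum>K\<in>W. cst (?c K) * \<Phi> (?p K)) = (\<Sum>K\<in>{M, N}. cst (?c K) * \<Phi> (?p K))"
      by (rule sum.mono_neutral_right) (use MN finW in auto)
    also have "\<dots> = 0" using MN by (simp add: single_uminus)
    finally show False using coeffs0[of ?c M] MN by simp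
  qed
  let ?T = "(\<lambda>M. \<Phi> (?p M)) ` W" and ?S = "?p ` W"
  have injp: "inj_on ?p W" by (auto simp: inj_on_def dest: arg_cong[of _ _ Poly_Mapping.keys])
  have ind: "vs.independent ?T"
    unfolding vs.dependent_finite[OF finite_imageI[OF finW]]
  proof safe
    fix u M assume "(\<Sum>v\<in>?T. cst (u v) * v) = 0" "M \<in> W" and ne: "u (\<Phi> (?p M)) \<noteq> 0"
    then have "(\<Sum>M\<in>W. cst (u (\<Phi> (?p M))) * \<Phi> (?p M)) = 0" by (simp add: sum.reindex[OF inj])
    from coeffs0[OF this \<open>M \<in> W\<close>] show False using ne by simp
  qed
  have sp: "?T \<subseteq> vs.span ?S"
  proof safe
    fix M assume "M \<in> W"
    show "\<Phi> (?p M) \<in> vs.span ?S"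
      unfolding \<Phi>_def by (intro vs.span_sum vs.span_scale vs.span_base) auto
  qed
  \<comment> \<open>Otherwise \<open>?T\<close> with \<open>?p M0\<close> added would be an
    independent set of \<open>card W + 1\<close> elements in the span of \<open>card W\<close>
    elements.\<close>
  have "?p M0 \<in> vs.span ?T"
  proof (rule ccontr)
    assume p: "?p M0 \<notin> vs.span ?T"
    then have "vs.independent (insert (?p M0) ?T)" using ind by (rule vs.independent_insertI)
    moreover have "insert (?p M0) ?T \<subseteq> vs.span ?S"
      using sp vs.span_base[of "?p M0" ?S] by (auto simp: W_def)
    ultimately have "card (insert (?p M0) ?T) \<le> card ?S"
      using vs.independent_span_bound[OF finite_imageI[OF finW]] by blast
    moreover have "?p M0 \<notin> ?T" using contrapos_nn[OF p vs.span_base] .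
    ultimately show False using finW by (simp add: card_image inj injp)
  qed
  then obtain u where "?p M0 = (\<Sum>v\<in>?T. cst (u v) * v)"
    using vs.span_finite[OF finite_imageI[OF finW], of "\<lambda>M. \<Phi> (?p M)"] by auto
  then have p: "?p M0 = (\<Sum>M\<in>W. cst (u (\<Phi> (?p M))) * \<Phi> (?p M))" by (simp add: sum.reindex[OF inj])
  define f where "f = (\<Sum>M\<in>W. cst (u (\<Phi> (?p M))) * ?p M)"
  have "\<Phi> f = ?p M0" unfolding f_def \<Phi>sum p[symmetric] ..
  then have "cf f (ptn M) = (if M = M0 then 1 else 0)" if "wt M = wt M0" for M
    using lk\<Phi>[of f M] that by (auto simp: W_def lookup_single when_def)
  moreover have "homog (wt M0) f" unfolding f_def by (rule homog) simp
  ultimately show ?thesis by blast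
qed

definition mono_sf :: "expo \<Rightarrow> 'a sf" where
  "mono_sf mu = (SOME f. homog (psize mu) f \<and>
     (\<forall>nu. is_partition nu \<longrightarrow> psize nu = psize mu \<longrightarrow> cf f nu = (if nu = mu then 1 else 0)))"

lemma mono_sf:
  assumes "is_partition mu"
  shows "homog (psize mu) (mono_sf mu)" "is_partition nu \<Longrightarrow> cf (mono_sf mu) nu = (if nu = mu then 1 else 0)"
proof -
  obtain f where f: "homog (wt (pmon mu)) f"
    "\<And>M. wt M = wt (pmon mu) \<Longrightarrow> cf f (ptn M) = (if M = pmon mu then 1 else 0)"
    using dual_basis_exists by blast
  have "cf f nu = (if nu = mu then 1 else 0)" if "is_partition nu" "psize nu = psize mu" for nu
  proof -
    have "pmon nu = pmon mu \<longleftrightarrow> nu = mu" using ptn_pmon that assms by metis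
    then show ?thesis using f(2)[of "pmon nu"] that assms by (simp add: wt_pmon ptn_pmon)
  qed
  then have "\<exists>f. homog (psize mu) f \<and>
     (\<forall>nu. is_partition nu \<longrightarrow> psize nu = psize mu \<longrightarrow> cf f nu = (if nu = mu then 1 else 0))"
    using f(1) assms by (auto simp: wt_pmon)
  from someI_ex[OF this] have *: "homog (psize mu) (mono_sf mu)"
    "\<And>nu. is_partition nu \<Longrightarrow> psize nu = psize mu \<Longrightarrow> cf (mono_sf mu) nu = (if nu = mu then 1 else 0)"
    unfolding mono_sf_def by auto
  show "homog (psize mu) (mono_sf mu)" by (rule *)
  show "cf (mono_sf mu) nu = (if nu = mu then 1 else 0)" if "is_partition nu"
    using * that cf_homog[of "psize mu" "mono_sf mu" nu] by (cases "psize nu = psize mu") auto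
qed

lemma cf_mono_sf:
  assumes "is_partition mu"
  shows "cf (mono_sf mu) = monomial_sym mu"
proof
  fix \<alpha>
  have "cf (mono_sf mu) \<alpha> = cf (mono_sf mu) (srt \<alpha>)" by (simp add: cf_srt)
  then show "cf (mono_sf mu) \<alpha> = monomial_sym mu \<alpha>"
    using assms by (simp add: mono_sf srt monomial_sym_def rearrangement_iff_srt)
qed

text \<open>Uniqueness resolves the definite description: any expansion reassembles to a ring
  element with the same coefficients, hence to \<open>f\<close>.\<close>

lemma power_sum_expansion_cf:
  "Poly_Mapping.lookup (power_sum_expansion (cf f)) lam = (if is_partition lam then lk f (pmon lam) else 0)"
proof -
  define Q where "Q c \<longleftrightarrow> (\<forall>lam\<in>Poly_Mapping.keys c. is_partition lam) \<and>
     (\<forall>\<alpha>. cf f \<alpha> = (\<Sum>lam\<in>Poly_Mapping.keys c. lk c lam * power_sum_product lam \<alpha>))" for c :: "expo \<Rightarrow>\<^sub>0 'a"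
  have uniq: "lk c lam = (if is_partition lam then lk f (pmon lam) else 0)" if "Q c" for c lam
  proof -
    have part: "is_partition mu" if "mu \<in> Poly_Mapping.keys c" for mu using \<open>Q c\<close> that by (simp add: Q_def)
    define f' where "f' = (\<Sum>mu\<in>Poly_Mapping.keys c. cst (lk c mu) * Poly_Mapping.single (pmon mu) 1)"
    have "f' = f"
    proof (rule cf_partitions_separate)
      fix mu
      show "cf f' mu = cf f mu"
        using \<open>Q c\<close> part by (simp add: Q_def f'_def cf_sum cf_cst_mult power_sum_product_eq_cf cong: sum.cong)
    qed
    moreover have "lk f' (pmon lam) = lk c lam" if "is_partition lam"
    proof -
      have "pmon mu = pmon lam \<longleftrightarrow> mu = lam" if "mu \<in> Poly_Mapping.keys c" for mu
        using ptn_pmon part that \<open>is_partition lam\<close> by metis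
      then have "lk f' (pmon lam) = (\<Sum>mu\<in>Poly_Mapping.keys c. if mu = lam then lk c mu else 0)"
        unfolding f'_def lookup_sum by (intro sum.cong) (auto simp: lookup_single when_def)
      then show ?thesis by (simp add: in_keys_iff)
    qed
    ultimately show ?thesis using part in_keys_iff by fastforce
  qed
  define c0 where "c0 = (\<Sum>M\<in>Poly_Mapping.keys f. Poly_Mapping.single (ptn M) (lk f M))"
  have lkc0: "lk c0 lam = (if is_partition lam then lk f (pmon lam) else 0)" for lam
  proof -
    have "lk c0 lam = (\<Sum>M\<in>Poly_Mapping.keys f. if M = pmon lam \<and> is_partition lam then lk f M else 0)"
      unfolding c0_def lookup_sum
      by (intro sum.cong) (auto simp: lookup_single when_def ptn_pmon pmon_ptn ptn_partition)
    then show ?thesis by (cases "is_partition lam") (auto simp: in_keys_iff)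
  qed
  have keysc0: "Poly_Mapping.keys c0 = ptn ` Poly_Mapping.keys f"
    by (auto simp: in_keys_iff lkc0 ptn_partition pmon_ptn split: if_splits)
       (metis (no_types, lifting) image_eqI in_keys_iff ptn_pmon)
  have "Q c0"
    unfolding Q_def
  proof safe
    fix \<alpha>
    have f: "f = (\<Sum>M\<in>Poly_Mapping.keys f. cst (lk f M) * Poly_Mapping.single M 1)"
      by (rule poly_mapping_eqI)
         (simp add: lookup_sum lookup_single when_def in_keys_iff if_distrib[of "\<lambda>x. _ * x"] cong: if_cong)
    have inj: "inj_on ptn (Poly_Mapping.keys f)" by (metis inj_onI pmon_ptn)
    have "cf f \<alpha> = (\<Sum>M\<in>Poly_Mapping.keys f. lk f M * cf (Poly_Mapping.single M 1) \<alpha>)"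
      by (subst f) (simp add: cf_sum cf_cst_mult)
    also have "\<dots> = (\<Sum>lam\<in>Poly_Mapping.keys c0. lk c0 lam * power_sum_product lam \<alpha>)"
      unfolding keysc0 sum.reindex[OF inj] comp_def
      by (rule sum.cong) (simp_all add: lkc0 ptn_partition pmon_ptn power_sum_product_eq_cf)
    finally show "cf f \<alpha> = \<dots>" .
  qed (use keysc0 ptn_partition in auto)
  moreover have "power_sum_expansion (cf f) = (THE c. Q c)"
    unfolding power_sum_expansion_def Q_def ..
  moreover have "(THE c. Q c) = c0"
    by (rule the_equality) (use \<open>Q c0\<close> uniq lkc0 in \<open>auto intro: poly_mapping_eqI\<close>)
  ultimately show ?thesis using lkc0 by simp
qed

end

section \<open>Existence and uniqueness of Macdonald polynomials\<close>

lemma finite_partitions: "finite {mu. is_partition mu \<and> psize mu = n}"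
proof (rule finite_subset)
  show "{mu. is_partition mu \<and> psize mu = n} \<subseteq> ptn ` {M. wt M = n}"
  proof safe
    fix mu assume "is_partition mu"
    then show "mu \<in> ptn ` {M. wt M = psize mu}"
      by (intro image_eqI[of mu ptn "pmon mu"]) (simp_all add: ptn_pmon wt_pmon)
  qed
qed (intro finite_imageI finite_wt)

definition mac_eigen :: "'a::comm_ring_1 \<Rightarrow> 'a \<Rightarrow> expo \<Rightarrow> 'a" where
  "mac_eigen x q lam = Tcoef x q (rowlist (psize lam) lam) (rowlist (psize lam) lam)"

text \<open>Distinctness is demanded across degrees as well, so that
  \<open>mac_sf_orthogonal\<close> treats all pairs of partitions alike.\<close>

locale macdonald_generic = macdonald +
  assumes distinct: "is_partition lam \<Longrightarrow> is_partition mu \<Longrightarrow> lam \<noteq> mu \<Longrightarrow>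
    mac_eigen (1 - 1 / t) q lam \<noteq> mac_eigen (1 - 1 / t) q mu"
begin

abbreviation coef :: "expo \<Rightarrow> expo \<Rightarrow> 'a" where "coef \<equiv> mac_coef xt q"

definition mac_sf :: "expo \<Rightarrow> 'a sf" where
  "mac_sf lam = (\<Sum>mu | is_partition mu \<and> psize mu = psize lam. cst (coef lam mu) * mono_sf mu)"

lemma cf_mac_sf: "cf (mac_sf lam) \<alpha> = coef lam (srt \<alpha>)"
proof -
  have "cf (mac_sf lam) \<alpha> = (\<Sum>mu | is_partition mu \<and> psize mu = psize lam.
      if mu = srt \<alpha> then coef lam mu else 0)"
    unfolding mac_sf_def cf_sum cf_cst_mult
    by (rule sum.cong) (auto simp: cf_mono_sf monomial_sym_def rearrangement_iff_srt)
  also have "\<dots> = (if psize \<alpha> = psize lam then coef lam (srt \<alpha>) else 0)"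
    by (simp add: sum.delta finite_partitions srt psize_srt)
  also have "\<dots> = coef lam (srt \<alpha>)"
    using mac_coef_nonzero[of xt q lam "srt \<alpha>"] by (auto simp: dominated_psum psize_srt)
  finally show ?thesis .
qed

lemma mac_sf_eq:
  assumes "is_partition lam"
  shows "mac_sf lam = mono_sf lam +
    (\<Sum>mu | is_partition mu \<and> mu \<prec>D lam. cst (coef lam mu) * mono_sf mu)"
proof -
  let ?P = "{mu. is_partition mu \<and> psize mu = psize lam}"
  have "mac_sf lam = cst (coef lam lam) * mono_sf lam + (\<Sum>mu\<in>?P - {lam}. cst (coef lam mu) * mono_sf mu)"
    unfolding mac_sf_def by (rule sum.remove) (use assms finite_partitions in auto)
  also have "(\<Sum>mu\<in>?P - {lam}. cst (coef lam mu) * mono_sf mu) =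
      (\<Sum>mu | is_partition mu \<and> mu \<prec>D lam. cst (coef lam mu) * mono_sf mu)"
  proof (rule sum.mono_neutral_right)
    have "coef lam mu = 0" if "mu \<in> ?P - {lam} - {mu. is_partition mu \<and> mu \<prec>D lam}" for mu
      using that mac_coef_nonzero[of xt q lam mu] by (auto simp: strictly_dominated_def)
    then show "\<forall>mu\<in>?P - {lam} - {mu. is_partition mu \<and> mu \<prec>D lam}. cst (coef lam mu) * mono_sf mu = 0"
      by simp
  qed (auto simp: finite_partitions strictly_dominated_def dominated_psum)
  finally show ?thesis by simp
qed

text \<open>Tested against each g_mu: self-adjointness moves the operator to g_mu, where
  \<open>Ecoef\<close> gives its expansion. In equal degree the \<open>Bcoef\<close> part is the
  identity, and the \<open>Tcoef\<close> part is the recursion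
  \<open>mac_coef_eigen\<close>.\<close>

lemma mac_sf_eigen:
  assumes lam: "is_partition lam"
  shows "Emode 0 (mac_sf lam) = cst (1 - (1 - q) * xt * mac_eigen xt q lam) * mac_sf lam"
proof (rule cf_partitions_separate)
  fix mu assume mu: "is_partition mu"
  define N where "N = psize mu"
  let ?r = "rowlist N mu" and ?F = "\<lambda>s. coef lam (srt (Poly_Mapping.nth s))"
  have keys: "Poly_Mapping.keys mu \<subseteq> {..<N}" using mu by (simp add: partition_keys_psize N_def)
  have r: "?r \<in> compositions N N" using rowlist_compositions[OF mu] by (simp add: N_def)
  have sum_r: "sum_list ?r = N" using r by (simp add: compositions_def)
  have "cf (Emode 0 (mac_sf lam)) mu = ip (Emode 0 (gprod ?r)) (mac_sf lam)"
    unfolding cf_def gexp_eq_gprod[OF keys] Emode_0_selfadjoint ..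
  also have "\<dots> = (\<Sum>s\<in>compositions N N. Ecoef xt q ?r s * ?F s)"
    unfolding Emode_gprod length_rowlist sum_r ip_sum_left ip_cst_mult_left
    by (simp add: cf_mac_sf[symmetric] cf_def gprod_eq_gexp)
  also have "\<dots> = (\<Sum>s\<in>compositions N N. Bcoef xt ?r s * ?F s) -
      (1 - q) * xt * (\<Sum>s\<in>compositions N N. Tcoef xt q ?r s * ?F s)"
    by (simp only: Ecoef_eq_Tcoef left_diff_distrib sum_subtractf sum_distrib_left mult.assoc)
  also have "(\<Sum>s\<in>compositions N N. Bcoef xt ?r s * ?F s) = (\<Sum>s\<in>{?r}. Bcoef xt ?r s * ?F s)"
  proof (rule sum.mono_neutral_right[OF finite_compositions])
    have "Bcoef xt ?r s = 0" if "s \<in> compositions N N - {?r}" for s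
      by (rule Bcoef_off_diagonal) (use that sum_r in \<open>auto simp: compositions_def\<close>)
    then show "\<forall>s\<in>compositions N N - {?r}. Bcoef xt ?r s * ?F s = 0" by simp
  qed (use r in simp)
  also have "\<dots> = coef lam mu"
  proof -
    have "Bcoef xt s s = 1" for s by (induction s) auto
    then show ?thesis by (simp add: nth_rowlist[OF keys] srt_partition mu)
  qed
  also have "(\<Sum>s\<in>compositions N N. Tcoef xt q ?r s * ?F s) = mac_eigen xt q lam * coef lam mu"
  proof (cases "N = psize lam")
    case True
    show ?thesis unfolding True mac_eigen_def
      by (rule mac_coef_eigen) (use mu lam True distinct[of mu lam] in \<open>auto simp: N_def mac_eigen_def\<close>)
  next
    case False
    then have "?F s = 0" if "s \<in> compositions N N" for s
      using that mac_coef_nonzero[of xt q lam "srt (Poly_Mapping.nth s)"]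
      by (auto simp: dominated_psum psize_srt psize_nth compositions_def)
    moreover have "coef lam mu = 0"
      using False mac_coef_nonzero[of xt q lam mu] by (auto simp: dominated_psum N_def)
    ultimately show ?thesis by simp
  qed
  also have "coef lam mu - (1 - q) * xt * (mac_eigen xt q lam * coef lam mu) =
      cf (cst (1 - (1 - q) * xt * mac_eigen xt q lam) * mac_sf lam) mu"
    unfolding cf_cst_mult cf_mac_sf srt_partition[OF mu] by (simp add: algebra_simps)
  finally show "cf (Emode 0 (mac_sf lam)) mu =
      cf (cst (1 - (1 - q) * xt * mac_eigen xt q lam) * mac_sf lam) mu" .
qed

lemma mac_sf_orthogonal:
  assumes "is_partition lam" "is_partition mu" "lam \<noteq> mu"
  shows "ip (mac_sf lam) (mac_sf mu) = 0"
proof -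
  let ?e = "\<lambda>lam. 1 - (1 - q) * xt * mac_eigen xt q lam"
  have "?e lam * ip (mac_sf lam) (mac_sf mu) = ip (Emode 0 (mac_sf lam)) (mac_sf mu)"
    by (simp only: mac_sf_eigen[OF assms(1)] ip_cst_mult_left)
  also have "\<dots> = ?e mu * ip (mac_sf lam) (mac_sf mu)"
    by (simp only: Emode_0_selfadjoint mac_sf_eigen[OF assms(2)] ip_cst_mult_right)
  finally have "(1 - q) * xt * (mac_eigen xt q mu - mac_eigen xt q lam) * ip (mac_sf lam) (mac_sf mu) = 0"
    by (simp add: algebra_simps)
  moreover have "1 - q \<noteq> 0" using q_nontriv[of 0] by simp
  moreover have "xt \<noteq> 0" using t_nontriv[of 0] t_nz by simp
  moreover have "mac_eigen xt q mu - mac_eigen xt q lam \<noteq> 0" using distinct[OF assms] by simp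
  ultimately show ?thesis by (simp only: mult_eq_0_iff) simp
qed

section \<open>Uniqueness of triangular orthogonal families\<close>

definition triangular_orthogonal :: "(expo \<Rightarrow> 'a sf) \<Rightarrow> bool" where
  "triangular_orthogonal f \<longleftrightarrow>
    (\<forall>lam. is_partition lam \<longrightarrow> (\<exists>c. f lam = mono_sf lam +
        (\<Sum>mu | is_partition mu \<and> mu \<prec>D lam. cst (c mu) * mono_sf mu))) \<and>
    (\<forall>lam mu. is_partition lam \<longrightarrow> is_partition mu \<longrightarrow> lam \<noteq> mu \<longrightarrow> ip (f lam) (f mu) = 0)"

lemma triangular_orthogonal_mac_sf: "triangular_orthogonal mac_sf"
  unfolding triangular_orthogonal_def using mac_sf_eq mac_sf_orthogonal by blast

text \<open>Inverts the unitriangular relation between \<open>f\<close> and the monomial functions,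
  from the bottom of the dominance order upwards.\<close>

lemma triangular_orthogonal_lower:
  assumes f: "triangular_orthogonal f" and v: "\<And>kappa. is_partition kappa \<Longrightarrow> kappa \<preceq>D mu \<Longrightarrow> ip v (f kappa) = 0"
    and mu: "is_partition mu"
  shows "ip v (mono_sf mu) = 0"
  using mu v
proof (induction "dom_rank mu" arbitrary: mu rule: less_induct)
  case less
  obtain c where c: "f mu = mono_sf mu +
      (\<Sum>nu | is_partition nu \<and> nu \<prec>D mu. cst (c nu) * mono_sf nu)"
    using f less.prems(1) unfolding triangular_orthogonal_def by blast
  have "ip v (mono_sf nu) = 0" if "is_partition nu" "nu \<prec>D mu" for nu
    using less.hyps[OF dom_rank_less[OF that(1) less.prems(1) that(2)] that(1)] less.prems(2) that(2)
    by (metis dominated_trans strictly_dominated_def)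
  then have "ip v (f mu) = ip v (mono_sf mu)"
    unfolding c by (simp add: ip_add_right ip_sum_right ip_cst_mult_right)
  then show ?case using less.prems by (simp add: dominated_refl)
qed

lemma triangular_orthogonal_mono_sf:
  assumes f: "triangular_orthogonal f" and "is_partition lam" "is_partition mu" "\<not> lam \<preceq>D mu"
  shows "ip (f lam) (mono_sf mu) = 0"
proof (rule triangular_orthogonal_lower[OF f _ assms(3)])
  fix kappa assume "is_partition kappa" "kappa \<preceq>D mu"
  moreover from this have "lam \<noteq> kappa" using assms(4) by auto
  ultimately show "ip (f lam) (f kappa) = 0"
    using f assms(2) unfolding triangular_orthogonal_def by blast
qed

lemma mono_sf_expansion:
  "Poly_Mapping.single M 1 =
    (\<Sum>mu | is_partition mu \<and> psize mu = wt M. cst (cf (Poly_Mapping.single M 1) mu) * mono_sf mu)"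
proof (rule cf_partitions_separate)
  fix nu assume nu: "is_partition nu"
  let ?u = "Poly_Mapping.single M (1::'a)"
  have "cf (\<Sum>mu | is_partition mu \<and> psize mu = wt M. cst (cf ?u mu) * mono_sf mu) nu =
      (\<Sum>mu | is_partition mu \<and> psize mu = wt M. if mu = nu then cf ?u mu else 0)"
    unfolding cf_sum cf_cst_mult by (rule sum.cong) (auto simp: mono_sf nu)
  also have "\<dots> = (if psize nu = wt M then cf ?u nu else 0)"
    by (simp add: sum.delta finite_partitions nu)
  also have "\<dots> = cf ?u nu" using cf_homog[OF homog_single, of M "wt M" nu 1] by auto
  finally show "cf ?u nu = cf (\<Sum>mu | is_partition mu \<and> psize mu = wt M. cst (cf ?u mu) * mono_sf mu) nu" ..
qed

lemma mac_sf_norm_nonzero: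
  assumes lam: "is_partition lam"
  shows "ip (mac_sf lam) (mac_sf lam) \<noteq> 0"
proof
  assume 0: "ip (mac_sf lam) (mac_sf lam) = 0"
  have all: "ip (mac_sf lam) (mac_sf mu) = 0" if "is_partition mu" for mu
    using 0 mac_sf_orthogonal[OF lam that] by (cases "lam = mu") auto
  have mono: "ip (mac_sf lam) (mono_sf mu) = 0" if "is_partition mu" for mu
    by (rule triangular_orthogonal_lower[OF triangular_orthogonal_mac_sf _ that]) (rule all)
  have "lk (mac_sf lam) M * Z M = ip (mac_sf lam) (Poly_Mapping.single M 1)" for M
    unfolding ip_commute[of "mac_sf lam"] ip_single by simp
  also have "ip (mac_sf lam) (Poly_Mapping.single M 1) = 0" for M
    by (subst mono_sf_expansion) (simp add: ip_sum_right ip_cst_mult_right mono)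
  finally have "mac_sf lam = 0" using Z_nz by (intro poly_mapping_eqI) simp
  then have "cf (mac_sf lam) lam = 0" by (simp add: cf_def)
  then show False using lam by (simp add: cf_mac_sf srt_partition)
qed

text \<open>Dominance is only partial, so a term nu of the difference is chosen with maximal
  \<open>dom_rank\<close> and the difference is paired with \<open>mac_sf nu\<close>. The result is
  0, since nothing below nu lies above \<open>lam\<close>; yet only the term nu contributes, so that
  <m_nu, P_nu> = <P_nu, P_nu> would vanish.\<close>

lemma triangular_orthogonal_unique:
  assumes f: "triangular_orthogonal f" and lam: "is_partition lam"
  shows "f lam = mac_sf lam"
proof -
  let ?L = "{mu. is_partition mu \<and> mu \<prec>D lam}"
  obtain c where c: "f lam = mono_sf lam + (\<Sum>mu\<in>?L. cst (c mu) * mono_sf mu)"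
    using f lam unfolding triangular_orthogonal_def by blast
  define a where "a mu = c mu - coef lam mu" for mu
  have D: "f lam - mac_sf lam = (\<Sum>mu\<in>?L. cst (a mu) * mono_sf mu)"
    unfolding c mac_sf_eq[OF lam] by (simp add: a_def single_diff left_diff_distrib sum_subtractf)
  have "a mu = 0" if "mu \<in> ?L" for mu
  proof (rule ccontr)
    assume "a mu \<noteq> 0"
    define S where "S = {mu \<in> ?L. a mu \<noteq> 0}"
    have S: "finite S" "S \<noteq> {}" using \<open>a mu \<noteq> 0\<close> that finite_subset[OF _ finite_strictly_dominated[of lam], of S] by (auto simp: S_def)
    define nu where "nu = (ARG_MAX dom_rank nu. nu \<in> S)"
    have nuS: "nu \<in> S" and max: "\<And>mu. mu \<in> S \<Longrightarrow> dom_rank mu \<le> dom_rank nu"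
    proof -
      obtain k where k: "k \<in> S" using S by blast
      have bd: "\<forall>y. y \<in> S \<longrightarrow> dom_rank y < Suc (Max (dom_rank ` S))"
        using S by (simp add: less_Suc_eq_le)
      show "nu \<in> S" unfolding nu_def by (rule arg_max_natI[OF k bd])
      show "dom_rank mu \<le> dom_rank nu" if "mu \<in> S" for mu
        unfolding nu_def by (rule arg_max_nat_le[OF that bd])
    qed
    then have nu: "is_partition nu" "nu \<prec>D lam" "a nu \<noteq> 0" by (auto simp: S_def)
    have below: "\<not> lam \<preceq>D kappa" if "kappa \<preceq>D nu" for kappa
    proof
      assume "lam \<preceq>D kappa"
      then have "lam \<preceq>D nu" using that by (rule dominated_trans)
      then show False using nu(2) dominated_antisym by (auto simp: strictly_dominated_def)
    qed
    have zero: "ip (f lam - mac_sf lam) (mono_sf kappa) = 0" if "is_partition kappa" "kappa \<preceq>D nu" for kappa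
      using triangular_orthogonal_mono_sf[OF f lam that(1) below[OF that(2)]]
        triangular_orthogonal_mono_sf[OF triangular_orthogonal_mac_sf lam that(1) below[OF that(2)]]
      by (metis ip_commute ip_diff_right diff_zero)
    have eq: "mac_sf nu = mono_sf nu +
        (\<Sum>mu | is_partition mu \<and> mu \<prec>D nu. cst (coef nu mu) * mono_sf mu)"
      by (rule mac_sf_eq[OF nu(1)])
    have "ip (f lam - mac_sf lam) (mac_sf nu) = 0"
      unfolding eq ip_add_right ip_sum_right ip_cst_mult_right
      by (simp add: zero nu(1) dominated_refl strictly_dominated_def)
    moreover have "ip (f lam - mac_sf lam) (mac_sf nu) = (\<Sum>mu\<in>?L. a mu * ip (mono_sf mu) (mac_sf nu))"
      by (simp add: D ip_sum_left ip_cst_mult_left)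
    moreover have "\<dots> = (\<Sum>mu\<in>{nu}. a mu * ip (mono_sf mu) (mac_sf nu))"
    proof (rule sum.mono_neutral_right[OF finite_strictly_dominated])
      show "{nu} \<subseteq> ?L" using nu by simp
      show "\<forall>mu\<in>?L - {nu}. a mu * ip (mono_sf mu) (mac_sf nu) = 0"
      proof
        fix mu assume mu: "mu \<in> ?L - {nu}"
        show "a mu * ip (mono_sf mu) (mac_sf nu) = 0"
        proof (cases "a mu = 0")
          case False
          then have "dom_rank mu \<le> dom_rank nu" using mu max by (auto simp: S_def)
          then have "\<not> nu \<preceq>D mu"
            using dom_rank_less[OF nu(1), of mu] mu by (auto simp: strictly_dominated_def)
          then show ?thesis
            using triangular_orthogonal_mono_sf[OF triangular_orthogonal_mac_sf nu(1), of mu] mu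
            by (simp add: ip_commute)
        qed simp
      qed
    qed
    ultimately have "ip (mono_sf nu) (mac_sf nu) = 0" using nu(3) by simp
    moreover have "ip (mac_sf nu) (mono_sf kappa) = 0" if "is_partition kappa" "kappa \<prec>D nu" for kappa
      using triangular_orthogonal_mono_sf[OF triangular_orthogonal_mac_sf nu(1), of kappa] that
        dominated_antisym by (auto simp: strictly_dominated_def)
    then have "ip (mac_sf nu) (\<Sum>mu | is_partition mu \<and> mu \<prec>D nu. cst (coef nu mu) * mono_sf mu) = 0"
      by (simp add: ip_sum_right ip_cst_mult_right)
    ultimately have "ip (mac_sf nu) (mac_sf nu) = 0"
      by (subst (2) eq) (simp add: ip_add_right ip_commute)
    then show False using mac_sf_norm_nonzero[OF nu(1)] by contradiction
  qed
  then have "f lam - mac_sf lam = 0" unfolding D by (intro sum.neutral) simp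
  then show ?thesis by simp
qed

end

section \<open>The field of rational functions in \<open>q\<close> and \<open>t\<close>\<close>

lemma Fract_power: "Fract a 1 ^ n = Fract (a ^ n) (1 :: 'a::idom)"
  by (induction n) (simp_all add: One_fract_def)

lemma Fract_one_sum: "(\<Sum>x\<in>A. Fract (f x) 1) = Fract (\<Sum>x\<in>A. f x) (1 :: 'a::idom)"
  by (induction A rule: infinite_finite_induct) (simp_all add: Zero_fract_def)

lemma Fract_one_eq_iff: "Fract a 1 = Fract b 1 \<longleftrightarrow> a = (b :: 'a::idom)"
  by (simp add: eq_fract)

lemma qvar_power: "qvar ^ n = Fract [:monom 1 n:] 1"
proof -
  have "[:[:0, 1:]:] ^ n = [:monom (1::rat) n:]"
    by (induction n) (simp_all add: monom_Suc one_pCons[symmetric])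
  then show ?thesis by (simp add: qvar_def Fract_power)
qed

lemma tvar_power: "tvar ^ n = Fract (monom 1 n) 1"
  unfolding tvar_def Fract_power by (simp add: monom_altdef)

lemma tvar_qvar_power: "tvar ^ m * qvar ^ k = Fract (monom (monom 1 k) m) 1"
  by (simp add: qvar_power tvar_power mult_monom flip: monom_0)

text \<open>For x = 1 - 1/t this is the classical eigenvalue, the sum of t^(-j) (1 -
  q^(r_j)).\<close>

lemma Tcoef_diagonal_sum:
  "(1 - q) * Tcoef x q r r = (\<Sum>j<length r. (1 - x) ^ j * (1 - q ^ (r ! j)))"
proof (induction r)
  case (Cons n r)
  have B: "Bcoef x r r = 1" by (induction r) auto
  have "(1 - q) * Tcoef x q (n # r) (n # r) = (1 - q) * qnum q n + (1 - x) * ((1 - q) * Tcoef x q r r)"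
    by (simp add: B algebra_simps)
  also have "\<dots> = (1 - q ^ n) + (\<Sum>j<length r. (1 - x) ^ Suc j * (1 - q ^ (r ! j)))"
    unfolding Cons qnum_mult sum_distrib_left by (simp add: mult.assoc)
  finally show ?case
    unfolding list.size(4) add_Suc_right add_0_right by (subst sum.lessThan_Suc_shift) simp
qed simp

lemma partition_lookup_eq_0:
  assumes "is_partition mu" "psize mu \<le> k"
  shows "lk mu k = 0"
proof -
  have "k \<notin> Poly_Mapping.keys mu" using partition_keys_psize[OF assms(1) order.refl] assms(2) by auto
  then show ?thesis by (simp add: in_keys_iff)
qed

text \<open>Rows of length 0 contribute nothing, so partitions of different sizes can be compared
  over a common number of rows.\<close>

lemma mac_eigen_sum:
  assumes "is_partition lam" "psize lam \<le> N"
  shows "(1 - q) * mac_eigen x q lam = (\<Sum>j<N. (1 - x) ^ j * (1 - q ^ lk lam j))"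
proof -
  have "(1 - q) * mac_eigen x q lam = (\<Sum>j<psize lam. (1 - x) ^ j * (1 - q ^ lk lam j))"
    unfolding mac_eigen_def Tcoef_diagonal_sum length_rowlist by (rule sum.cong) (auto simp: rowlist_elem)
  also have "\<dots> = (\<Sum>j<N. (1 - x) ^ j * (1 - q ^ lk lam j))"
  proof (rule sum.mono_neutral_left)
    show "\<forall>j\<in>{..<N} - {..<psize lam}. (1 - x) ^ j * (1 - q ^ lk lam j) = 0"
      using partition_lookup_eq_0[OF assms(1)] by simp
  qed (use assms in auto)
  finally show ?thesis .
qed

interpretation mac: macdonald_generic qvar tvar
proof
  fix i
  show "qvar ^ Suc i \<noteq> 1"
    unfolding qvar_power One_fract_def Fract_one_eq_iff
    by (auto simp: one_pCons monom_Suc)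
  show "tvar ^ Suc i \<noteq> 1"
    unfolding tvar_power One_fract_def Fract_one_eq_iff by (auto simp: one_pCons monom_Suc)
  show tnz: "tvar \<noteq> 0"
    by (simp add: tvar_def Zero_fract_def Fract_one_eq_iff)
  fix lam mu assume part: "is_partition lam" "is_partition mu" "lam \<noteq> mu"
  define N where "N = max (psize lam) (psize mu)"
  show "mac_eigen (1 - 1 / tvar) qvar lam \<noteq> mac_eigen (1 - 1 / tvar) qvar mu"
  proof
    assume "mac_eigen (1 - 1 / tvar) qvar lam = mac_eigen (1 - 1 / tvar) qvar mu"
    then have "(\<Sum>j<N. (1 - (1 - 1 / tvar)) ^ j * (1 - qvar ^ lk lam j)) =
        (\<Sum>j<N. (1 - (1 - 1 / tvar)) ^ j * (1 - qvar ^ lk mu j))"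
      using mac_eigen_sum[OF part(1), of N qvar "1 - 1 / tvar"]
        mac_eigen_sum[OF part(2), of N qvar "1 - 1 / tvar"] by (simp add: N_def)
    then have "(\<Sum>j<N. (1 / tvar) ^ j * qvar ^ lk lam j) = (\<Sum>j<N. (1 / tvar) ^ j * qvar ^ lk mu j)"
      by (simp add: right_diff_distrib sum_subtractf)
    \<comment> \<open>Clearing the negative powers of t gives a polynomial whose coefficient of t^(N
      - k) is the monomial q^(lam_k), which reveals row k.\<close>
    then have "tvar ^ N * (\<Sum>j<N. (1 / tvar) ^ j * qvar ^ lk lam j) =
        tvar ^ N * (\<Sum>j<N. (1 / tvar) ^ j * qvar ^ lk mu j)" by simp
    moreover have "tvar ^ N * (\<Sum>j<N. (1 / tvar) ^ j * qvar ^ lk \<alpha> j) =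
        Fract (\<Sum>j<N. monom (monom 1 (lk \<alpha> j)) (N - j)) 1" for \<alpha> :: expo
    proof -
      have "tvar ^ N * (1 / tvar) ^ j = tvar ^ (N - j)" if "j < N" for j
        using that tnz by (simp add: power_diff power_divide)
      then have "tvar ^ N * (\<Sum>j<N. (1 / tvar) ^ j * qvar ^ lk \<alpha> j) =
          (\<Sum>j<N. tvar ^ (N - j) * qvar ^ lk \<alpha> j)"
        unfolding sum_distrib_left by (intro sum.cong) (auto simp: mult.assoc[symmetric])
      then show ?thesis by (simp add: tvar_qvar_power Fract_one_sum)
    qed
    ultimately have eq: "(\<Sum>j<N. monom (monom (1::rat) (lk lam j)) (N - j)) =
        (\<Sum>j<N. monom (monom 1 (lk mu j)) (N - j))"
      by (simp only: Fract_one_eq_iff)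
    have coeff: "coeff (\<Sum>j<N. monom (monom (1::rat) (lk \<alpha> j)) (N - j)) (N - k) = monom 1 (lk \<alpha> k)"
      if "k < N" for \<alpha> :: expo and k
    proof -
      have "coeff (\<Sum>j<N. monom (monom (1::rat) (lk \<alpha> j)) (N - j)) (N - k) =
          (\<Sum>j<N. if j = k then monom 1 (lk \<alpha> j) else 0)"
        unfolding coeff_sum by (rule sum.cong) (use that in auto)
      then show ?thesis using that by simp
    qed
    have "lk lam k = lk mu k" for k
    proof (cases "k < N")
      case True
      then have "monom (1::rat) (lk lam k) = monom 1 (lk mu k)"
        using coeff[OF True, of lam] coeff[OF True, of mu] eq by simp
      then show ?thesis by (metis degree_monom_eq zero_neq_one)
    next
      case False
      then show ?thesis
        using partition_lookup_eq_0[of lam k] partition_lookup_eq_0[of mu k] part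
        by (simp add: N_def)
    qed
    then show False using part(3) by (metis poly_mapping_eqI)
  qed
qed

section \<open>Comparison of the abstract inner product with \<open>qt_inner\<close>\<close>

lemma mac_weight_prod:
  assumes "is_partition lam"
  shows "(\<Prod>i\<in>#pmon lam. mac_weight q t i) =
    (\<Prod>i<plength lam. of_nat (lk lam i) * ((1 - q ^ lk lam i) / (1 - t ^ lk lam i)))"
proof -
  have "(\<Prod>i\<in>#pmon lam. mac_weight q t i) = (\<Prod>i\<leftarrow>[0..<plength lam]. mac_weight q t (lk lam i - 1))"
    unfolding pmon_def mset_map[symmetric] prod_mset_prod_list map_map comp_def ..
  also have "\<dots> = (\<Prod>i<plength lam. mac_weight q t (lk lam i - 1))"
    by (subst prod.distinct_set_conv_list[symmetric]) (auto simp: atLeast0LessThan)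
  also have "\<dots> = (\<Prod>i<plength lam. of_nat (lk lam i) * ((1 - q ^ lk lam i) / (1 - t ^ lk lam i)))"
    by (rule prod.cong) (use rowlist_pos[OF assms] in \<open>auto simp: mac_weight_def\<close>)
  finally show ?thesis .
qed

lemma count_pmon:
  assumes "is_partition lam"
  shows "count (pmon lam) i = card {j. lk lam j = Suc i}"
proof -
  have "count (pmon lam) i = card {j. j < plength lam \<and> lk lam j - 1 = i}"
    unfolding pmon_def count_mset count_list_eq_length_filter length_filter_conv_card by (auto intro!: arg_cong[of _ _ card])
  also have "{j. j < plength lam \<and> lk lam j - 1 = i} = {j. lk lam j = Suc i}"
  proof safe
    fix j assume "j < plength lam" "i = lk lam j - 1"
    then show "lk lam j = Suc (lk lam j - 1)" using rowlist_pos[OF assms, of j] by simp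
  next
    fix j assume "lk lam j = Suc i"
    then have "j \<in> Poly_Mapping.keys lam" by (simp add: in_keys_iff)
    then show "j < plength lam" using partition_keys[OF assms] by simp
  qed auto
  finally show ?thesis .
qed

text \<open>The powers r^m in \<open>zee\<close> are the integer factors of
  \<open>mac_weight\<close>, and its factorials are those of \<open>Z\<close>.\<close>

lemma qt_pairing_self:
  assumes lam: "is_partition lam"
  shows "qt_pairing lam lam = mac.Z (pmon lam)"
proof -
  let ?m = "\<lambda>r. card {i. lk lam i = r}"
  have keys: "Poly_Mapping.keys lam = {..<plength lam}" by (rule partition_keys[OF lam])
  have range: "Poly_Mapping.range lam = lk lam ` {..<plength lam}"
    unfolding keys[symmetric] by (auto simp: Poly_Mapping.range.rep_eq in_keys_iff)
  have range': "Poly_Mapping.range lam = Suc ` set_mset (pmon lam)"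
    unfolding range pmon_def using rowlist_pos[OF lam]
    by (auto simp: image_image atLeast0LessThan intro!: image_cong)
  have "(\<Prod>r\<in>Poly_Mapping.range lam. r ^ ?m r) = (\<Prod>i<plength lam. lk lam i)"
  proof -
    have "(\<Prod>i<plength lam. lk lam i) =
        (\<Prod>r\<in>lk lam ` {..<plength lam}. \<Prod>i\<in>{i \<in> {..<plength lam}. lk lam i = r}. lk lam i)"
      by (rule prod.image_gen) simp
    also have "\<dots> = (\<Prod>r\<in>Poly_Mapping.range lam. r ^ ?m r)"
      unfolding range
    proof (rule prod.cong[OF refl])
      fix r assume "r \<in> lk lam ` {..<plength lam}"
      then have "r \<noteq> 0" using rowlist_pos[OF lam] by auto
      then have "{i \<in> {..<plength lam}. lk lam i = r} = {i. lk lam i = r}"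
        unfolding keys[symmetric] by (auto simp: in_keys_iff)
      then show "(\<Prod>i\<in>{i \<in> {..<plength lam}. lk lam i = r}. lk lam i) = r ^ ?m r" by simp
    qed
    finally show ?thesis ..
  qed
  moreover have "(\<Prod>r\<in>Poly_Mapping.range lam. fact (?m r) :: nat) =
      (\<Prod>i\<in>set_mset (pmon lam). fact (count (pmon lam) i))"
    unfolding range' by (subst prod.reindex) (simp_all add: count_pmon[OF lam])
  ultimately have zee: "zee lam = (\<Prod>i<plength lam. lk lam i) *
      (\<Prod>i\<in>set_mset (pmon lam). fact (count (pmon lam) i))"
    by (simp add: zee_def Let_def prod.distrib)
  show ?thesis
    unfolding qt_pairing_def mac.Z_def mac_weight_prod[OF lam] zee of_nat_mult of_nat_prod prod.distrib
    by (simp add: mult_ac)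
qed

lemma qt_inner_cf: "qt_inner (mac.cf f) (mac.cf u) = mac.ip f u"
proof -
  let ?f = "power_sum_expansion (mac.cf f)" and ?u = "power_sum_expansion (mac.cf u)"
  have lkf: "lk ?f lam = (if is_partition lam then lk f (pmon lam) else 0)"
   and lku: "lk ?u lam = (if is_partition lam then lk u (pmon lam) else 0)" for lam
    by (rule mac.power_sum_expansion_cf)+
  have part: "is_partition lam" if "lam \<in> Poly_Mapping.keys ?f" for lam
    using that lkf[of lam] by (auto simp: in_keys_iff split: if_splits)
  have "qt_inner (mac.cf f) (mac.cf u) = (\<Sum>lam\<in>Poly_Mapping.keys ?f. lk ?f lam * lk ?u lam * qt_pairing lam lam)"
    unfolding qt_inner_def
  proof (rule sum.cong[OF refl])
    fix lam
    have "(\<Sum>mu\<in>Poly_Mapping.keys ?u. lk ?f lam * lk ?u mu * qt_pairing lam mu) =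
        (\<Sum>mu\<in>Poly_Mapping.keys ?u. if mu = lam then lk ?f lam * lk ?u lam * qt_pairing lam lam else 0)"
      by (rule sum.cong) (auto simp: qt_pairing_def)
    then show "(\<Sum>mu\<in>Poly_Mapping.keys ?u. lk ?f lam * lk ?u mu * qt_pairing lam mu) =
        lk ?f lam * lk ?u lam * qt_pairing lam lam"
      by (simp add: in_keys_iff)
  qed
  also have "\<dots> = (\<Sum>lam\<in>Poly_Mapping.keys ?f. lk f (pmon lam) * lk u (pmon lam) * mac.Z (pmon lam))"
    by (rule sum.cong) (simp_all add: lkf lku part qt_pairing_self)
  also have "\<dots> = (\<Sum>M\<in>Poly_Mapping.keys f. lk f M * lk u M * mac.Z M)"
  proof (rule sum.reindex_bij_witness[of _ ptn pmon])
    fix M assume "M \<in> Poly_Mapping.keys f"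
    then show "ptn M \<in> Poly_Mapping.keys ?f" by (simp add: in_keys_iff lkf ptn_partition pmon_ptn)
  next
    fix lam assume lam: "lam \<in> Poly_Mapping.keys ?f"
    then show "pmon lam \<in> Poly_Mapping.keys f" using part[OF lam] by (simp add: in_keys_iff lkf)
    show "ptn (pmon lam) = lam" using part[OF lam] by (rule ptn_pmon)
  qed (simp_all add: pmon_ptn)
  finally show ?thesis by (simp add: mac.ip_def lin_ext_def)
qed

theorem macdonald_P_eq:
  assumes lam: "is_partition lam"
  shows "macdonald_P lam = mac.cf (mac.mac_sf lam)"
proof -
  have cf: "mac.cf (mac.mono_sf lam + (\<Sum>mu | is_partition mu \<and> mu \<prec>D lam. cst (c mu) * mac.mono_sf mu)) \<alpha> =
      monomial_sym lam \<alpha> + (\<Sum>mu\<in>{mu. is_partition mu \<and> mu \<prec>D lam}. c mu * monomial_sym mu \<alpha>)"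
    if "is_partition lam" for lam c \<alpha>
    using that by (simp add: mac.cf_add mac.cf_sum mac.cf_cst_mult mac.cf_mono_sf)
  have ex: "macdonald_family (\<lambda>lam. mac.cf (mac.mac_sf lam))"
    unfolding macdonald_family_def qt_inner_cf
  proof (intro conjI allI impI)
    fix lam assume lam: "is_partition lam"
    show "\<exists>c. \<forall>\<alpha>. mac.cf (mac.mac_sf lam) \<alpha> = monomial_sym lam \<alpha> +
        (\<Sum>mu\<in>{mu. is_partition mu \<and> mu \<prec>D lam}. c mu * monomial_sym mu \<alpha>)"
      unfolding mac.mac_sf_eq[OF lam] cf[OF lam] by blast
  qed (rule mac.mac_sf_orthogonal)
  have uniq: "P lam = mac.cf (mac.mac_sf lam)" if P: "macdonald_family P" for P
  proof -
    have "\<forall>lam. \<exists>c. is_partition lam \<longrightarrow> (\<forall>\<alpha>. P lam \<alpha> = monomial_sym lam \<alpha> +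
         (\<Sum>mu\<in>{mu. is_partition mu \<and> mu \<prec>D lam}. c mu * monomial_sym mu \<alpha>))"
      using P unfolding macdonald_family_def by blast
    from choice[OF this] obtain c where c: "\<And>lam \<alpha>. is_partition lam \<Longrightarrow> P lam \<alpha> = monomial_sym lam \<alpha> +
         (\<Sum>mu\<in>{mu. is_partition mu \<and> mu \<prec>D lam}. c lam mu * monomial_sym mu \<alpha>)"
      by blast
    \<comment> \<open>An admissible family of series lifts to the ring through its expansion in
      monomial functions, and there uniqueness is known.\<close>
    define f where "f lam = mac.mono_sf lam +
      (\<Sum>mu | is_partition mu \<and> mu \<prec>D lam. cst (c lam mu) * mac.mono_sf mu)" for lam
    have Pf: "P lam = mac.cf (f lam)" if "is_partition lam" for lam
      using that by (intro ext) (simp add: f_def cf c)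
    have "mac.triangular_orthogonal f"
      unfolding mac.triangular_orthogonal_def
    proof (intro conjI allI impI)
      fix lam show "\<exists>c. f lam = mac.mono_sf lam +
          (\<Sum>mu | is_partition mu \<and> mu \<prec>D lam. cst (c mu) * mac.mono_sf mu)"
        unfolding f_def by blast
    next
      fix lam mu assume "is_partition lam" "is_partition mu" "lam \<noteq> mu"
      then show "mac.ip (f lam) (f mu) = 0"
        using P Pf unfolding macdonald_family_def qt_inner_cf[symmetric] by metis
    qed
    then show ?thesis using mac.triangular_orthogonal_unique lam Pf by metis
  qed
  show ?thesis unfolding macdonald_P_def
    by (rule the_equality) (use ex uniq in blast)+
qed

section \<open>Nonvanishing of the coefficients\<close>

lemma eval_qt_add: "eval_qt (a + b) q0 t0 = eval_qt a q0 t0 + eval_qt b q0 t0"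
proof -
  have "map_poly (of_rat :: rat \<Rightarrow> complex) (a + b) = map_poly of_rat a + map_poly of_rat b" for a b
    by (rule poly_eqI) (simp add: coeff_map_poly of_rat_add)
  then have "map_poly (map_poly (of_rat :: rat \<Rightarrow> complex)) (a + b) =
      map_poly (map_poly of_rat) a + map_poly (map_poly of_rat) b"
    by (intro poly_eqI) (simp add: coeff_map_poly)
  then show ?thesis by (simp add: eval_qt_def eval2_def)
qed

lemma eval_qt_0 [simp]: "eval_qt 0 q0 t0 = 0"
  by (simp add: eval_qt_def eval2_def)

lemma eval_qt_1 [simp]: "eval_qt 1 q0 t0 = 1"
  by (simp add: eval_qt_def eval2_def one_pCons map_poly_pCons)

text \<open>\<open>has_germ r f\<close>: the rational function \<open>r\<close> is defined along the curve
  \<open>(q, t) = (1 - x\<^sup>2, 1 / (1 - x))\<close> near, but not necessarily at, \<open>x = 0\<close>, and equals \<open>f\<close> there.\<close>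

definition has_germ :: "ratqt \<Rightarrow> (complex \<Rightarrow> complex) \<Rightarrow> bool" where
  "has_germ r f \<longleftrightarrow> (\<exists>a b. r = Fract a b \<and> (\<forall>\<^sub>F x in at 0. eval_qt b (1 - x\<^sup>2) (1 / (1 - x)) \<noteq> 0 \<and>
     f x = eval_qt a (1 - x\<^sup>2) (1 / (1 - x)) / eval_qt b (1 - x\<^sup>2) (1 / (1 - x))))"

lemma has_germD:
  assumes "has_germ r f"
  obtains a b where "r = Fract a b" "b \<noteq> 0" "\<forall>\<^sub>F x in at 0. eval_qt b (1 - x\<^sup>2) (1 / (1 - x)) \<noteq> 0 \<and>
     f x = eval_qt a (1 - x\<^sup>2) (1 / (1 - x)) / eval_qt b (1 - x\<^sup>2) (1 / (1 - x))"
proof -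
  obtain a b where ab: "r = Fract a b" "\<forall>\<^sub>F x in at 0. eval_qt b (1 - x\<^sup>2) (1 / (1 - x)) \<noteq> 0 \<and>
     f x = eval_qt a (1 - x\<^sup>2) (1 / (1 - x)) / eval_qt b (1 - x\<^sup>2) (1 / (1 - x))"
    using assms unfolding has_germ_def by blast
  \<comment> \<open>The filter of punctured neighbourhoods is nontrivial, so the denominator is
    nonzero at some point.\<close>
  have "b \<noteq> 0" using eventually_happens[OF ab(2)] by (auto simp: trivial_limit_at)
  then show thesis using that ab by blast
qed

lemma has_germ_add: "has_germ r f \<Longrightarrow> has_germ s g \<Longrightarrow> has_germ (r + s) (\<lambda>x. f x + g x)"
proof -
  assume r: "has_germ r f" and s: "has_germ s g"
  obtain a b where 1: "r = Fract a b" "b \<noteq> 0" and ev1: "\<forall>\<^sub>F x in at 0. eval_qt b (1 - x\<^sup>2) (1 / (1 - x)) \<noteq> 0 \<and>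
     f x = eval_qt a (1 - x\<^sup>2) (1 / (1 - x)) / eval_qt b (1 - x\<^sup>2) (1 / (1 - x))"
    using r by (rule has_germD)
  obtain c d where 2: "s = Fract c d" "d \<noteq> 0" and ev2: "\<forall>\<^sub>F x in at 0. eval_qt d (1 - x\<^sup>2) (1 / (1 - x)) \<noteq> 0 \<and>
     g x = eval_qt c (1 - x\<^sup>2) (1 / (1 - x)) / eval_qt d (1 - x\<^sup>2) (1 / (1 - x))"
    using s by (rule has_germD)
  have "\<forall>\<^sub>F x in at 0. eval_qt (b * d) (1 - x\<^sup>2) (1 / (1 - x)) \<noteq> 0 \<and>
      f x + g x = eval_qt (a * d + c * b) (1 - x\<^sup>2) (1 / (1 - x)) / eval_qt (b * d) (1 - x\<^sup>2) (1 / (1 - x))"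
    using ev1 ev2 by eventually_elim (auto simp: eval_qt_add eval_qt_mult add_frac_eq)
  moreover have "r + s = Fract (a * d + c * b) (b * d)" using 1 2 by simp
  ultimately show ?thesis unfolding has_germ_def by blast
qed

lemma has_germ_mult: "has_germ r f \<Longrightarrow> has_germ s g \<Longrightarrow> has_germ (r * s) (\<lambda>x. f x * g x)"
proof -
  assume r: "has_germ r f" and s: "has_germ s g"
  obtain a b where 1: "r = Fract a b" "b \<noteq> 0" and ev1: "\<forall>\<^sub>F x in at 0. eval_qt b (1 - x\<^sup>2) (1 / (1 - x)) \<noteq> 0 \<and>
     f x = eval_qt a (1 - x\<^sup>2) (1 / (1 - x)) / eval_qt b (1 - x\<^sup>2) (1 / (1 - x))"
    using r by (rule has_germD)
  obtain c d where 2: "s = Fract c d" "d \<noteq> 0" and ev2: "\<forall>\<^sub>F x in at 0. eval_qt d (1 - x\<^sup>2) (1 / (1 - x)) \<noteq> 0 \<and>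
     g x = eval_qt c (1 - x\<^sup>2) (1 / (1 - x)) / eval_qt d (1 - x\<^sup>2) (1 / (1 - x))"
    using s by (rule has_germD)
  have "\<forall>\<^sub>F x in at 0. eval_qt (b * d) (1 - x\<^sup>2) (1 / (1 - x)) \<noteq> 0 \<and>
      f x * g x = eval_qt (a * c) (1 - x\<^sup>2) (1 / (1 - x)) / eval_qt (b * d) (1 - x\<^sup>2) (1 / (1 - x))"
    using ev1 ev2 by eventually_elim (auto simp: eval_qt_mult)
  moreover have "r * s = Fract (a * c) (b * d)" using 1 2 by simp
  ultimately show ?thesis unfolding has_germ_def by blast
qed

lemma has_germ_inverse:
  assumes "has_germ r f" "\<forall>\<^sub>F x in at 0. f x \<noteq> 0"
  shows "has_germ (inverse r) (\<lambda>x. inverse (f x))"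
proof -
  obtain a b where *: "r = Fract a b" "b \<noteq> 0"
    and ev: "\<forall>\<^sub>F x in at 0. eval_qt b (1 - x\<^sup>2) (1 / (1 - x)) \<noteq> 0 \<and>
     f x = eval_qt a (1 - x\<^sup>2) (1 / (1 - x)) / eval_qt b (1 - x\<^sup>2) (1 / (1 - x))"
    using assms(1) by (rule has_germD)
  have "\<forall>\<^sub>F x in at 0. eval_qt a (1 - x\<^sup>2) (1 / (1 - x)) \<noteq> 0 \<and>
      inverse (f x) = eval_qt b (1 - x\<^sup>2) (1 / (1 - x)) / eval_qt a (1 - x\<^sup>2) (1 / (1 - x))"
    using ev assms(2) by eventually_elim auto
  moreover have "inverse r = Fract b a" using * by simp
  ultimately show ?thesis unfolding has_germ_def by blast
qed

lemma has_germ_cong: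
  assumes "has_germ r f" and fg: "\<forall>\<^sub>F x in at 0. f x = g x"
  shows "has_germ r g"
proof -
  obtain a b where r: "r = Fract a b" and ev: "\<forall>\<^sub>F x in at 0. eval_qt b (1 - x\<^sup>2) (1 / (1 - x)) \<noteq> 0 \<and>
     f x = eval_qt a (1 - x\<^sup>2) (1 / (1 - x)) / eval_qt b (1 - x\<^sup>2) (1 / (1 - x))"
    using assms(1) by (rule has_germD)
  have "\<forall>\<^sub>F x in at 0. eval_qt b (1 - x\<^sup>2) (1 / (1 - x)) \<noteq> 0 \<and>
     g x = eval_qt a (1 - x\<^sup>2) (1 / (1 - x)) / eval_qt b (1 - x\<^sup>2) (1 / (1 - x))"
    using ev fg by eventually_elim simp
  then show ?thesis using r unfolding has_germ_def by blast
qed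

lemma has_germ_0: "has_germ 0 (\<lambda>_. 0)"
  unfolding has_germ_def Zero_fract_def by (rule exI[of _ 0], rule exI[of _ 1]) simp

lemma has_germ_1: "has_germ 1 (\<lambda>_. 1)"
  unfolding has_germ_def One_fract_def by (rule exI[of _ 1], rule exI[of _ 1]) simp

lemma has_germ_uminus: "has_germ r f \<Longrightarrow> has_germ (- r) (\<lambda>x. - f x)"
proof -
  assume r: "has_germ r f"
  have m1: "eval_qt (- 1) q0 t0 = - 1" for q0 t0
    using eval_qt_add[of 1 "- 1" q0 t0] by (simp add: add_eq_0_iff)
  have "has_germ (- 1) (\<lambda>_. - 1)"
    unfolding has_germ_def by (rule exI[of _ "- 1"], rule exI[of _ 1]) (simp add: One_fract_def m1)
  from has_germ_mult[OF this r] show ?thesis by simp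
qed

lemma has_germ_diff: "has_germ r f \<Longrightarrow> has_germ s g \<Longrightarrow> has_germ (r - s) (\<lambda>x. f x - g x)"
  using has_germ_add[of r f "- s" "\<lambda>x. - g x"] has_germ_uminus[of s g] by simp

lemma has_germ_divide:
  "has_germ r f \<Longrightarrow> has_germ s g \<Longrightarrow> \<forall>\<^sub>F x in at 0. g x \<noteq> 0 \<Longrightarrow> has_germ (r / s) (\<lambda>x. f x / g x)"
  unfolding divide_inverse by (intro has_germ_mult has_germ_inverse)

lemma has_germ_sum: "(\<And>k. k \<in> A \<Longrightarrow> has_germ (r k) (f k)) \<Longrightarrow> has_germ (\<Sum>k\<in>A. r k) (\<lambda>x. \<Sum>k\<in>A. f k x)"
  by (induction A rule: infinite_finite_induct) (auto intro: has_germ_0 has_germ_add)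

lemma has_germ_power: "has_germ r f \<Longrightarrow> has_germ (r ^ n) (\<lambda>x. f x ^ n)"
  by (induction n) (auto intro: has_germ_1 has_germ_mult)

lemma has_germ_qvar: "has_germ qvar (\<lambda>x. 1 - x\<^sup>2)"
  unfolding has_germ_def qvar_def
  by (rule exI[of _ "[:[:0, 1:]:]"], rule exI[of _ 1]) (simp add: eval_qt_def[of "[:_:]"] eval2_def map_poly_pCons)

lemma has_germ_tvar: "has_germ tvar (\<lambda>x. 1 / (1 - x))"
  unfolding has_germ_def tvar_def
  by (rule exI[of _ "[:0, 1:]"], rule exI[of _ 1]) (simp add: eval_qt_def[of "[:0, _:]"] eval2_def map_poly_pCons)

lemma has_germ_xt: "has_germ (1 - 1 / tvar) (\<lambda>x. x)"
proof -
  have "((\<lambda>x::complex. 1 - x) \<longlongrightarrow> 1 - 0) (at 0)" by (intro tendsto_intros)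
  then have ev: "\<forall>\<^sub>F x::complex in at 0. 1 - x \<noteq> 0"
    by (rule tendsto_imp_eventually_ne) simp
  have "has_germ (1 - 1 / tvar) (\<lambda>x. 1 - 1 / (1 / (1 - x)))"
    by (intro has_germ_diff has_germ_1 has_germ_divide has_germ_tvar) (use ev in \<open>auto elim: eventually_mono\<close>)
  then show ?thesis by (rule has_germ_cong) simp
qed

lemma has_germ_Bcoef: "has_germ (Bcoef (1 - 1 / tvar) r s) (\<lambda>x. Bcoef x r s)"
proof (induction r s rule: list_induct2')
  case (4 n r m s)
  then show ?case unfolding Bcoef.simps
    by (cases m n rule: linorder_cases) (auto intro!: has_germ_mult has_germ_xt simp: has_germ_0)
qed (auto intro: has_germ_1)

lemma has_germ_Tcoef: "has_germ (Tcoef (1 - 1 / tvar) qvar r s) (\<lambda>x. Tcoef x (1 - x\<^sup>2) r s)"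
proof (induction r s rule: list_induct2')
  case (4 n r m s)
  have "has_germ (if m = n then 1 - (1 - 1 / tvar) else if m > n then - (1 - 1 / tvar) else 0)
      (\<lambda>x. if m = n then 1 - x else if m > n then - x else 0)"
    by (cases m n rule: linorder_cases)
       (simp_all add: has_germ_0 has_germ_diff[OF has_germ_1 has_germ_xt, simplified] has_germ_uminus[OF has_germ_xt, simplified])
  then show ?case unfolding Tcoef.simps qnum_def
    by (intro has_germ_add has_germ_mult has_germ_sum has_germ_power has_germ_qvar has_germ_Bcoef 4)
qed (auto intro: has_germ_0)

text \<open>Induction downwards from \<open>lam\<close>. Numerator and denominator of the recursion
  are both divided by x, which gives the limit \<open>A / R\<close>; all terms of \<open>A\<close>
  are nonnegative, so nothing can cancel the positive one.\<close>

lemma mac_coef_positive_germ: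
  assumes lam: "is_partition lam"
  shows "is_partition mu \<Longrightarrow> mu \<preceq>D lam \<Longrightarrow> \<exists>f L. has_germ (mac_coef (1 - 1 / tvar) qvar lam mu) f \<and>
    (f \<longlongrightarrow> complex_of_real L) (at 0) \<and> 0 < L"
proof (induction "dom_rank lam - dom_rank mu" arbitrary: mu rule: less_induct)
  case less
  let ?F = "mac_coef (1 - 1 / tvar) qvar lam"
  note mu = less.prems
  define N where "N = psize lam"
  have psmu: "psize mu = N" using mu by (simp add: dominated_psum N_def)
  show ?case
  proof (cases "mu = lam")
    case True
    then show ?thesis by (intro exI[of _ "\<lambda>_. 1"] exI[of _ 1]) (simp add: has_germ_1)
  next
    case False
    then have lt: "mu \<prec>D lam" using mu by (simp add: strictly_dominated_def)
    define S where "S = {s \<in> compositions N N. mu \<prec>D srt (Poly_Mapping.nth s)}"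
    have finS: "finite S" unfolding S_def using finite_compositions by simp
    let ?n = "\<lambda>s. srt (Poly_Mapping.nth s)" and ?r = "rowlist N mu"
    have "\<exists>f L. has_germ (?F (?n s)) f \<and> (f \<longlongrightarrow> complex_of_real L) (at 0) \<and> 0 \<le> L \<and> (?n s \<preceq>D lam \<longrightarrow> 0 < L)"
      if s: "s \<in> S" for s
    proof (cases "?n s \<preceq>D lam")
      case True
      have "dom_rank mu < dom_rank (?n s)"
        using s srt(1) mu(1) by (intro dom_rank_less) (auto simp: S_def)
      moreover have "dom_rank (?n s) \<le> dom_rank lam"
        using dom_rank_less[OF srt(1) lam, of "Poly_Mapping.nth s"] True
        by (cases "?n s = lam") (auto simp: strictly_dominated_def)
      ultimately have "dom_rank lam - dom_rank (?n s) < dom_rank lam - dom_rank mu" by simp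
      from less.hyps[OF this srt(1) True] show ?thesis using less_imp_le by blast
    next
      case False
      then have "?F (?n s) = 0" using mac_coef_nonzero by blast
      then show ?thesis using False has_germ_0 by (intro exI[of _ "\<lambda>_. 0"] exI[of _ 0]) simp
    qed
    then obtain H L where H: "\<And>s. s \<in> S \<Longrightarrow> has_germ (?F (?n s)) (H s)"
      "\<And>s. s \<in> S \<Longrightarrow> (H s \<longlongrightarrow> complex_of_real (L s)) (at 0)" "\<And>s. s \<in> S \<Longrightarrow> 0 \<le> L s"
      "\<And>s. s \<in> S \<Longrightarrow> ?n s \<preceq>D lam \<Longrightarrow> 0 < L s" by metis
    define T where "T s x = Tcoef x (1 - x\<^sup>2) ?r s" for s and x :: complex
    define d where "d nu x = Tcoef x (1 - x\<^sup>2) (rowlist N nu) (rowlist N nu)" for nu and x :: complex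
    define A where "A = (\<Sum>s\<in>S. real_of_int (tau_lim ?r s) * L s)"
    define R where "R = real (row_stat (rowlist N mu)) - real (row_stat (rowlist N lam))"
    have sum_r: "sum_list ?r = N" using mu psmu by (simp add: sum_rowlist psum_eq_psize)
    have sortr: "sorted_wrt (\<ge>) ?r"
      using mu(1) by (auto simp: sorted_wrt_iff_nth_less rowlist_def is_partition_def antimono_def)
    have s_facts: "length ?r = length s" "sum_list ?r = sum_list s" "?r \<noteq> s" if "s \<in> S" for s
    proof -
      show "length ?r = length s" "sum_list ?r = sum_list s"
        using that sum_r by (auto simp: S_def compositions_def)
      show "?r \<noteq> s"
      proof
        assume "?r = s"
        then have "?n s = mu" using nth_rowlist[of mu N] partition_keys_psize[of mu N] mu psmu
          by (auto simp: srt_partition)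
        then show False using that by (simp add: S_def strictly_dominated_def)
      qed
    qed
    have limN: "((\<lambda>x. \<Sum>s\<in>S. T s x / x * H s x) \<longlongrightarrow> (\<Sum>s\<in>S. of_int (tau_lim ?r s) * complex_of_real (L s))) (at 0)"
      unfolding T_def by (intro tendsto_sum tendsto_mult H tendsto_Tcoef_deriv s_facts)
    have limd: "((\<lambda>x. (d nu x - of_nat N) / x) \<longlongrightarrow> - of_nat (row_stat (rowlist N nu))) (at 0)"
      if "is_partition nu" "psize nu = N" for nu
      using tendsto_Tcoef_diagonal[of "rowlist N nu"] that by (simp add: d_def sum_rowlist psum_eq_psize)
    have limD: "((\<lambda>x. (d lam x - of_nat N) / x - (d mu x - of_nat N) / x) \<longlongrightarrow>
        - of_nat (row_stat (rowlist N lam)) - - of_nat (row_stat (rowlist N mu))) (at 0)"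
      by (intro tendsto_diff limd) (use lam mu psmu N_def in auto)
    \<comment> \<open>\<open>row_stat\<close> and \<open>dom_rank\<close> add up to the square of
      the size, so the larger partition has the smaller \<open>row_stat\<close>.\<close>
    have Rpos: "0 < R"
    proof -
      have "dom_rank mu < dom_rank lam" by (rule dom_rank_less[OF mu(1) lam lt])
      then show ?thesis
        using row_stat_rowlist[OF mu(1)] row_stat_rowlist[OF lam] psmu by (simp add: R_def N_def)
    qed
    have Dlim: "((\<lambda>x. (d lam x - d mu x) / x) \<longlongrightarrow> complex_of_real R) (at 0)"
      using limD by (simp add: R_def diff_divide_distrib[symmetric])
    have Dne: "\<forall>\<^sub>F x in at 0. d lam x - d mu x \<noteq> 0"
      using tendsto_imp_eventually_ne[OF Dlim, of 0] Rpos by (auto elim: eventually_mono)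
    define f where "f x = (\<Sum>s\<in>S. T s x * H s x) / (d lam x - d mu x)" for x
    have "?F mu = (\<Sum>s\<in>S. Tcoef (1 - 1 / tvar) qvar ?r s * ?F (?n s)) /
        (Tcoef (1 - 1 / tvar) qvar (rowlist N lam) (rowlist N lam) - Tcoef (1 - 1 / tvar) qvar ?r ?r)"
      using False mu by (subst mac_coef.simps) (simp add: S_def N_def)
    then have "has_germ (?F mu) f"
      unfolding f_def T_def d_def using Dne
      by (simp only:) (intro has_germ_divide has_germ_sum has_germ_mult has_germ_diff has_germ_Tcoef H,
        simp_all add: d_def)
    moreover have "(f \<longlongrightarrow> complex_of_real (A / R)) (at 0)"
    proof -
      have "((\<lambda>x. (\<Sum>s\<in>S. T s x / x * H s x) / ((d lam x - d mu x) / x)) \<longlongrightarrow>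
          complex_of_real A / complex_of_real R) (at 0)"
        using tendsto_divide[OF limN Dlim] Rpos by (simp add: A_def)
      then have "(f \<longlongrightarrow> complex_of_real A / complex_of_real R) (at 0)"
        by (rule Lim_transform_eventually[OF _ eventually_mono[OF eventually_at0]])
           (simp add: f_def sum_divide_distrib[symmetric] times_divide_eq_left)
      then show ?thesis by simp
    qed
    moreover have "0 < A / R"
    proof -
      \<comment> \<open>A single-box move towards \<open>lam\<close> provides a term of
        \<open>A\<close> that is strictly positive.\<close>
      obtain nu i j where nu: "i < j" "0 < lk mu j" "is_partition nu" "nu \<preceq>D lam" "mu \<prec>D nu"
        "lk nu = (lk mu)(i := Suc (lk mu i), j := lk mu j - 1)"
        using dominance_step[OF mu(1) lam lt] by metis
      define s0 where "s0 = rowlist N nu"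
      have psnu: "psize nu = N" using nu(4) by (simp add: dominated_psum N_def)
      have jN: "j < N"
        using partition_keys_psize[OF mu(1), of N] psmu nu(2) by (auto simp: in_keys_iff subset_iff)
      have s0: "s0 = ?r[i := Suc (?r ! i), j := ?r ! j - 1]"
        by (rule nth_equalityI) (use nu(1) jN in \<open>auto simp: s0_def rowlist_elem nth_list_update nu(6)\<close>)
      have n: "?n s0 = nu"
        using nth_rowlist[of nu N] partition_keys_psize[of nu N] nu(3) psnu by (simp add: s0_def srt_partition)
      then have S0: "s0 \<in> S"
        using rowlist_compositions[OF nu(3)] psnu nu(5) by (simp add: S_def s0_def)
      have "0 < tau_lim ?r s0"
        unfolding s0 by (rule tau_lim_step) (use nu jN sortr in \<open>auto simp: rowlist_elem\<close>)
      then have "0 < real_of_int (tau_lim ?r s0) * L s0" using H(4)[OF S0] n nu(4) by simp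
      moreover have "0 \<le> real_of_int (tau_lim ?r s) * L s" if "s \<in> S" for s
        using tau_lim_nonneg[OF s_facts(1,2)[OF that] sortr] H(3)[OF that] by simp
      ultimately have "0 < A" unfolding A_def using finS S0 by (intro sum_pos2) auto
      then show ?thesis using Rpos by simp
    qed
    ultimately show ?thesis by blast
  qed
qed

lemma mac_coef_qt_nonzero_iff:
  assumes "is_partition lam" "is_partition mu"
  shows "mac_coef (1 - 1 / tvar) qvar lam mu \<noteq> 0 \<longleftrightarrow> mu \<preceq>D lam"
proof
  assume "mu \<preceq>D lam"
  then obtain f L where f: "has_germ (mac_coef (1 - 1 / tvar) qvar lam mu) f"
    "(f \<longlongrightarrow> complex_of_real L) (at 0)" "0 < L"
    using mac_coef_positive_germ[OF assms(1,2)] by blast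
  show "mac_coef (1 - 1 / tvar) qvar lam mu \<noteq> 0"
  proof
    assume 0: "mac_coef (1 - 1 / tvar) qvar lam mu = 0"
    obtain a b where ab: "mac_coef (1 - 1 / tvar) qvar lam mu = Fract a b" "b \<noteq> 0"
      "\<forall>\<^sub>F x in at 0. eval_qt b (1 - x\<^sup>2) (1 / (1 - x)) \<noteq> 0 \<and>
        f x = eval_qt a (1 - x\<^sup>2) (1 / (1 - x)) / eval_qt b (1 - x\<^sup>2) (1 / (1 - x))"
      using has_germD[OF f(1)] by blast
    have "a = 0" using ab(1,2) 0 by (simp add: Zero_fract_def eq_fract)
    then have "\<forall>\<^sub>F x in at 0. f x = 0" using ab(3) by (auto elim: eventually_mono)
    moreover have "\<forall>\<^sub>F x in at 0. f x \<noteq> 0"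
      using tendsto_imp_eventually_ne[OF f(2), of 0] f(3) by simp
    ultimately have "\<forall>\<^sub>F x::complex in at 0. False" by eventually_elim simp
    then show False by (simp add: trivial_limit_at)
  qed
qed (rule mac_coef_nonzero)

lemma eval2_nonzero_exists:
  fixes f :: "complex poly poly"
  assumes "f \<noteq> 0"
  obtains x y where "eval2 f x y \<noteq> 0"
proof -
  have "finite {c. poly f c = 0}" using assms by (rule poly_roots_finite)
  then have "finite ((\<lambda>y. [:y:]) -` {c. poly f c = 0})"
    by (rule finite_vimageI) (simp add: inj_on_def)
  from ex_new_if_finite[OF infinite_UNIV_char_0 this]
  obtain y where "y \<notin> (\<lambda>y. [:y:]) -` {c. poly f c = 0}" by blast
  then have "poly f [:y:] \<noteq> 0" by simp
  then have "finite {x. poly (poly f [:y:]) x = 0}" by (rule poly_roots_finite)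
  from ex_new_if_finite[OF infinite_UNIV_char_0 this]
  obtain x where "poly (poly f [:y:]) x \<noteq> 0" by blast
  then show thesis using that by (simp add: eval2_def)
qed

lemma eval_qt_prod: "eval_qt (prod F A) x y = (\<Prod>k\<in>A. eval_qt (F k) x y)"
  by (induction A rule: infinite_finite_induct) (simp_all add: eval_qt_mult)

theorem theorem3p1:
  fixes lam :: expo
  assumes "is_partition lam"
  shows "\<exists>U :: (complex \<times> complex) set. zariski_open U \<and> U \<noteq> {} \<and>
    (\<forall>q0 t0. (q0, t0) \<in> U \<longrightarrow>
       specialization_defined (macdonald_P lam) q0 t0 \<and>
       symmetric_SNP (specialize (macdonald_P lam) q0 t0) \<and>
       (\<forall>n \<ge> plength lam.
          newton (set_vars_zero n (specialize (macdonald_P lam) q0 t0)) = permutohedron n lam))"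
proof -
  let ?F = "mac_coef (1 - 1 / tvar) qvar lam"
  define D where "D = {mu. is_partition mu \<and> mu \<preceq>D lam}"
  have P: "macdonald_P lam \<alpha> = ?F (srt \<alpha>)" for \<alpha>
    by (simp add: macdonald_P_eq[OF assms] mac.cf_mac_sf)
  have "\<exists>a b. ?F mu = Fract a b \<and> a \<noteq> 0 \<and> b \<noteq> 0" if "mu \<in> D" for mu
  proof -
    obtain a b where ab: "?F mu = Fract a b" "b \<noteq> 0" by (cases "?F mu") auto
    moreover have "?F mu \<noteq> 0" using mac_coef_qt_nonzero_iff[OF assms, of mu] that by (simp add: D_def)
    ultimately show ?thesis by (auto simp: Zero_fract_def eq_fract)
  qed
  then obtain a b where ab: "\<And>mu. mu \<in> D \<Longrightarrow> ?F mu = Fract (a mu) (b mu) \<and> a mu \<noteq> 0 \<and> b mu \<noteq> 0"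
    by metis
  \<comment> \<open>Only finitely many coefficients occur, so one polynomial guards both against
    poles and against zeros.\<close>
  define f where "f = (\<Prod>mu\<in>D. a mu * b mu)"
  define f' where "f' = map_poly (map_poly (of_rat :: rat \<Rightarrow> complex)) f"
  define U where "U = {(x, y). eval2 f' x y \<noteq> 0}"
  have finD: "finite D" unfolding D_def by (rule finite_dominated)
  have "f \<noteq> 0" using ab finD by (simp add: f_def)
  then have "f' \<noteq> 0"
    unfolding f'_def by (subst map_poly_eq_0_iff) (auto simp: map_poly_eq_0_iff)
  then obtain x y where "eval2 f' x y \<noteq> 0" by (rule eval2_nonzero_exists)
  then have "U \<noteq> {}" by (auto simp: U_def)
  moreover have "zariski_open U" unfolding zariski_open_def U_def by (rule exI[of _ "{f'}"]) simp
  moreover have "specialization_defined (macdonald_P lam) q0 t0 \<and>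
       symmetric_SNP (specialize (macdonald_P lam) q0 t0) \<and>
       (\<forall>n \<ge> plength lam.
          newton (set_vars_zero n (specialize (macdonald_P lam) q0 t0)) = permutohedron n lam)"
    if "(q0, t0) \<in> U" for q0 t0
  proof -
    have "eval_qt f q0 t0 \<noteq> 0" using that by (simp add: U_def f'_def eval_qt_def)
    then have nz: "eval_qt (a mu) q0 t0 \<noteq> 0" "eval_qt (b mu) q0 t0 \<noteq> 0" if "mu \<in> D" for mu
      using that finD by (auto simp: f_def eval_qt_prod eval_qt_mult)
    have zero: "?F mu = Fract 0 1" if "\<not> mu \<preceq>D lam" for mu
      using that mac_coef_nonzero[of "1 - 1 / tvar" qvar lam mu] unfolding Zero_fract_def[symmetric] by blast
    have "regular_at (macdonald_P lam \<alpha>) q0 t0 \<and>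
        (specialize (macdonald_P lam) q0 t0 \<alpha> \<noteq> 0 \<longleftrightarrow> srt \<alpha> \<preceq>D lam)" for \<alpha>
    proof (cases "srt \<alpha> \<preceq>D lam")
      case True
      then have D: "srt \<alpha> \<in> D" by (simp add: D_def srt)
      have "macdonald_P lam \<alpha> = Fract (a (srt \<alpha>)) (b (srt \<alpha>))" using ab[OF D] P by simp
      then show ?thesis
        using nz[OF D] True unfolding regular_at_def specialize_def by (auto simp: ratqt_value_Fract)
    next
      case False
      have "macdonald_P lam \<alpha> = Fract 0 1" using zero[OF False] P by simp
      moreover have "regular_at (Fract 0 1) q0 t0"
        unfolding regular_at_def by (rule exI[of _ 0], rule exI[of _ 1]) simp
      ultimately show ?thesis using False ratqt_value_Fract[of 1 q0 t0 0]
        by (simp add: specialize_def)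
    qed
    then show ?thesis
      using SNP_of_dominated_support[OF assms, of "specialize (macdonald_P lam) q0 t0"]
      unfolding specialization_defined_def by blast
  qed
  ultimately show ?thesis by blast
qed

end
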